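(* Let $\phi:\mathbb{R}^+\to\mathbb{R}$ be smooth and suppose there is $m_2>0$ such that for every integer $\alpha\ge2$: $|\phi'(r)|\sim r^{m_2-1}$ and $|\phi^{(\alpha)}(r)|\lesssim r^{m_2-\alpha}$ for $0<r<1$. Let $g\in C^\infty(\mathbb{R})$ be supported in $[1/2,2]$, and let $\eta\in C^\infty(\mathbb{R})$ be supported in $[1/5,5]$ with $\eta\equiv1$ on $[1/4,4]$. Then there exist $c_0>1$ and, for each $t>0$, functions $\rho_t(x,\lambda)$ and $a_t(s,\lambda)$ such that $$\operatorname{supp}\rho_t(\cdot,\lambda)\subset[\lambda^2/5,5\lambda^2],\qquad |\rho_t(x,\lambda)|\le C(k,\|g\|_{C^k},\phi)\,(t\lambda^{2m_2})^{-k}\quad\text{for every integer }k\ge0,$$ $$\operatorname{supp}a_t(\cdot,\lambda)\subset[2c_0^{-1},2c_0],\qquad |a_t(s,\lambda)|\le C(\|g\|_{C^1},\phi),$$ and $$g(\lambda^{-1}\sqrt x)e^{it\phi(x)}=\rho_t(x,\lambda)+t\lambda^{2m_2}\,\eta(\lambda^{-2}x)\int e^{ixt\lambda^{2m_2-2}s}a_t(s,\lambda)\,ds$$ for all $x,t>0$ and $0<\lambda<1$. If in addition there is $\alpha_2>0$ such that $|\phi''(r)|\sim r^{\alpha_2-2}$ for $0<r<1$, then there are $c_0$, $\rho_t$ and $a_t$ with the same support properties and bounds such that $$g(\lambda^{-1}\sqrt x)e^{it\phi(x)}=\rho_t(x,\lambda)+t^{\frac12}\lambda^{2m_2-\alpha_2}\,\eta(\lambda^{-2}x)\int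 e^{ixt\lambda^{2m_2-2}s}a_t(s,\lambda)\,ds$$ for all $x,t>0$ and $0<\lambda<1$.
   Context: $A\lesssim B$ means $A\le CB$ for a constant $C>0$ (independent of $r$, possibly depending on $\alpha$), and $A\sim B$ means $A\lesssim B$ and $B\lesssim A$. $C(k,\|g\|_{C^k},\phi)$ and $C(\|g\|_{C^1},\phi)$ denote constants depending only on the displayed quantities (and on the fixed cutoff $\eta$), in particular not on $t,\lambda,x,s$.
   Formalization: Proved with supp a_t in σ[2/c_0,2c_0], σ the sign of φ', and for 0<λ<Λ (any Λ≤1), assuming φ'≠0 (second part: also φ''≠0) on [1,4Λ²], which is automatic for Λ≤1/2; as stated the claim fails for φ(r)=-r, or if φ is constant on part of (1,4). *)

theory Defs
  imports "HOL-Analysis.Analysis"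
begin

text \<open>Iterated derivative of a function of one real variable. Its value at a point depends
  only on the germ of the function there, so for a function on the open half line
  \<open>{0<..}\<close> the values of the total HOL function at \<open>r \<le> 0\<close> are irrelevant.\<close>

definition nth_deriv :: "nat \<Rightarrow> (real \<Rightarrow> 'a::real_normed_vector) \<Rightarrow> real \<Rightarrow> 'a" where
  "nth_deriv n f = ((\<lambda>h x. vector_derivative h (at x)) ^^ n) f"

text \<open>Meant for open \<open>S\<close>.\<close>

definition smooth_on :: "real set \<Rightarrow> (real \<Rightarrow> 'a::real_normed_vector) \<Rightarrow> bool" where
  "smooth_on S f \<longleftrightarrow> (\<forall>n. \<forall>x\<in>S. nth_deriv n f differentiable (at x))"

definition tsupport :: "(real \<Rightarrow> 'a::real_normed_vector) \<Rightarrow> real set" where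
  "tsupport f = closure {x. f x \<noteq> 0}"

text \<open>Only used for smooth \<open>f\<close> of compact support, where the suprema are finite.\<close>

definition Ck_norm :: "nat \<Rightarrow> (real \<Rightarrow> 'a::real_normed_vector) \<Rightarrow> real" where
  "Ck_norm k f = (\<Sum>j\<le>k. SUP x. norm (nth_deriv j f x))"

definition lesssim_on :: "real set \<Rightarrow> (real \<Rightarrow> real) \<Rightarrow> (real \<Rightarrow> real) \<Rightarrow> bool" where
  "lesssim_on S A B \<longleftrightarrow> (\<exists>C>0. \<forall>r\<in>S. A r \<le> C * B r)"

definition sim_on :: "real set \<Rightarrow> (real \<Rightarrow> real) \<Rightarrow> (real \<Rightarrow> real) \<Rightarrow> bool" where
  "sim_on S A B \<longleftrightarrow> lesssim_on S A B \<and> lesssim_on S B A"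

text \<open>The support properties and bounds of \<open>\<rho>\<^sub>t(x,lam) = \<rho> t x lam\<close> and \<open>a\<^sub>t(s,lam) = a t s lam\<close>, for
  \<open>t > 0\<close> and \<open>0 < lam < \<Lambda>\<close>. The functions \<open>C k\<close> and \<open>D\<close> give the constants in terms of the norms of
  \<open>g\<close>. The function \<open>\<rho>\<^sub>t(\<cdot>,lam)\<close> on the half line is extended by zero.

  The parameter \<open>\<sigma>\<close> is the sign of \<open>\<phi>'\<close>. The integral representation localises \<open>exp (i t \<phi>)\<close> to
  the frequencies \<open>t lam\<^bsup>2m-2\<^esup> s\<close>, which have the sign of \<open>\<phi>'\<close>; for decreasing \<open>\<phi>\<close> the
  interval \<open>[2/c\<^sub>0, 2c\<^sub>0]\<close> therefore has to be reflected.
  Since \<open>g (sqrt x / lam)\<close> lives on \<open>lam\<^sup>2/4 \<le> x \<le> 4 lam\<^sup>2\<close>, which leaves \<open>(0,1)\<close> when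
  \<open>lam > 1/2\<close>, the bound \<open>\<Lambda> \<le> 1\<close> on \<open>lam\<close> is a parameter: the decomposition can only hold if \<open>\<phi>'\<close>
  does not vanish on \<open>[1, 4 \<Lambda>\<^sup>2]\<close>, which is automatic for \<open>\<Lambda> \<le> 1/2\<close>. Measurability of \<open>a\<^sub>t(\<cdot>,lam)\<close> makes the
  integral a genuine one (the Bochner integral of a non-integrable function is 0 in HOL).\<close>

definition admissible_pair ::
  "real \<Rightarrow> real \<Rightarrow> real \<Rightarrow> (nat \<Rightarrow> real \<Rightarrow> real) \<Rightarrow> (real \<Rightarrow> real) \<Rightarrow> (real \<Rightarrow> complex) \<Rightarrow> real
    \<Rightarrow> (real \<Rightarrow> real \<Rightarrow> real \<Rightarrow> complex) \<Rightarrow> (real \<Rightarrow> real \<Rightarrow> real \<Rightarrow> complex) \<Rightarrow> bool" where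
  "admissible_pair \<sigma> m \<Lambda> C D g c0 \<rho> a \<longleftrightarrow>
    (\<forall>t>0. \<forall>lam. 0 < lam \<and> lam < \<Lambda> \<longrightarrow>
      tsupport (\<lambda>x. \<rho> t x lam) \<subseteq> {lam\<^sup>2 / 5 .. 5 * lam\<^sup>2} \<and>
      (\<forall>k x. norm (\<rho> t x lam) \<le> C k (Ck_norm k g) / (t * lam powr (2 * m)) ^ k) \<and>
      (\<lambda>s. a t s lam) \<in> borel_measurable borel \<and>
      tsupport (\<lambda>s. a t s lam) \<subseteq> (\<lambda>s. \<sigma> * s) ` {2 / c0 .. 2 * c0} \<and>
      (\<forall>s. norm (a t s lam) \<le> D (Ck_norm 1 g)))"

end

theory Submission
  imports Defs "HOL-Probability.Sinc_Integral"
begin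

text \<open>Put \<open>u = x / lam\<^sup>2\<close>, \<open>T = t lam\<^bsup>2m\<^esup>\<close> and \<open>\<psi> u = lam\<^bsup>-2m\<^esup> \<phi> (lam\<^sup>2 u)\<close>. On \<open>[1/4, 4]\<close> the derivatives of
  \<open>\<psi>\<close> are bounded uniformly in \<open>lam\<close> and \<open>\<bar>\<psi>'\<bar>\<close> is bounded below. Take for \<open>a(s)\<close> the Fourier transform of
  \<open>F u = g (sqrt u) exp (i T \<psi> u)\<close> at \<open>T s\<close>, cut off to a neighbourhood of the range of \<open>\<psi>'\<close>. The remainder
  is a dyadic sum of integrals over frequencies where \<open>\<bar>s - \<psi>' u\<bar>\<close> is bounded below. There \<open>k\<close>
  integrations by parts in \<open>u\<close> gain \<open>T\<^bsup>-k\<^esup>\<close>, and performing the integral in \<open>s\<close> first, whose kernel has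
  \<open>L\<^sup>1\<close> norm of order \<open>1/T\<close>, compensates the Jacobian \<open>T\<close>, so that no more than \<open>k\<close> derivatives of \<open>g\<close> are used.
  The bound for \<open>a\<close> is trivial in the first case and van der Corput's second derivative test in the
  second.\<close>

subsection \<open>Functions with bounded derivatives on an interval\<close>

text \<open>Two demands shape the argument. The constants must not depend on t, lam, x or s, so each
  estimate fixes its constant before the phase, the scale, the point and the amplitude, and speaks
  of all phases with given derivative bounds. And the frequencies that the cutoff removes form an
  unbounded set, on which an amplitude with few derivatives gives no absolutely convergent integral;
  hence the exhaustion by dilated compact cutoffs, with a limit at the end. All powers of 1/T come
  from the smoothness of F in u. Of a cutoff in s one asks only that its Fourier transform decay
  like 1/(1 + w^2), which is integrable; two continuous derivatives give this, so cutoffs built from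
  truncated cubes suffice. For k = 0 the dyadic pieces do not decay, and main term and Fourier term
  are bounded separately. Both decompositions have the same remainder: T is the product of t^(1/2)
  lam^(2m-\<alpha>) and t^(1/2) lam^\<alpha>, and the second decomposition moves the latter factor
  into the amplitude, where the decay from the second derivative test absorbs it.\<close>

text \<open>The derivatives are hidden behind an existential quantifier, so closure under sums and
  products needs no formula for them; at the ends of the interval they are one-sided. The flag
  \<open>z\<close> makes the function and its derivatives up to order \<open>k\<close> vanish at
  both ends, which removes all boundary terms in repeated integrations by parts.\<close>

fun bounded_Ck :: "real \<Rightarrow> real \<Rightarrow> bool \<Rightarrow> nat \<Rightarrow> real \<Rightarrow> (real \<Rightarrow> complex) \<Rightarrow> bool" where
  "bounded_Ck a b z 0 M v \<longleftrightarrow>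
     continuous_on {a..b} v \<and> (\<forall>u\<in>{a..b}. norm (v u) \<le> M) \<and> (z \<longrightarrow> v a = 0 \<and> v b = 0)"
| "bounded_Ck a b z (Suc k) M v \<longleftrightarrow>
     bounded_Ck a b z 0 M v \<and>
     (\<exists>v'. (\<forall>u\<in>{a..b}. (v has_vector_derivative v' u) (at u within {a..b})) \<and> bounded_Ck a b z k M v')"

lemma bounded_Ck_SucI:
  assumes "bounded_Ck a b z 0 M v" "bounded_Ck a b z k M v'"
    and "\<And>u. u \<in> {a..b} \<Longrightarrow> (v has_vector_derivative v' u) (at u within {a..b})"
  shows "bounded_Ck a b z (Suc k) M v"
  using assms by (simp only: bounded_Ck.simps(2)) blast

lemma bounded_Ck_SucE:
  assumes "bounded_Ck a b z (Suc k) M v"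
  obtains v' where "bounded_Ck a b z 0 M v" "bounded_Ck a b z k M v'"
    and "\<And>u. u \<in> {a..b} \<Longrightarrow> (v has_vector_derivative v' u) (at u within {a..b})"
  using assms by (simp only: bounded_Ck.simps(2)) blast

declare bounded_Ck.simps(2) [simp del]

lemma bounded_Ck_0: "bounded_Ck a b z k M v \<Longrightarrow> bounded_Ck a b z 0 M v"
  by (cases k) (auto elim: bounded_Ck_SucE simp del: bounded_Ck.simps)

lemma bounded_Ck_Suc: "bounded_Ck a b z (Suc k) M v \<Longrightarrow> bounded_Ck a b z k M v"
proof (induction k arbitrary: v)
  case 0
  then show ?case by (rule bounded_Ck_0)
next
  case (Suc k)
  from Suc.prems obtain v' where v': "bounded_Ck a b z 0 M v" "bounded_Ck a b z (Suc k) M v'"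
    "\<And>u. u \<in> {a..b} \<Longrightarrow> (v has_vector_derivative v' u) (at u within {a..b})"
    by (rule bounded_Ck_SucE) blast
  show ?case by (rule bounded_Ck_SucI[OF v'(1) Suc.IH[OF v'(2)] v'(3)])
qed

lemma bounded_Ck_mono: "bounded_Ck a b z k M v \<Longrightarrow> M \<le> N \<Longrightarrow> bounded_Ck a b z k N v"
proof (induction k arbitrary: v)
  case 0
  then show ?case by force
next
  case (Suc k)
  from Suc.prems(1) obtain v' where v': "bounded_Ck a b z 0 M v" "bounded_Ck a b z k M v'"
    "\<And>u. u \<in> {a..b} \<Longrightarrow> (v has_vector_derivative v' u) (at u within {a..b})"
    by (rule bounded_Ck_SucE) blast
  have "bounded_Ck a b z 0 N v" using v'(1) Suc.prems(2) by force
  then show ?case by (rule bounded_Ck_SucI[OF _ Suc.IH[OF v'(2) Suc.prems(2)] v'(3)])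
qed

lemma bounded_Ck_nonneg: "bounded_Ck a b z k M v \<Longrightarrow> a \<le> b \<Longrightarrow> 0 \<le> M"
  using bounded_Ck_0[of a b z k M v] by (auto intro: order_trans[OF norm_ge_zero])

lemma bounded_Ck_add:
  "bounded_Ck a b z k M v \<Longrightarrow> bounded_Ck a b z k N w \<Longrightarrow> bounded_Ck a b z k (M + N) (\<lambda>u. v u + w u)"
proof (induction k arbitrary: v w)
  case 0
  then show ?case by (auto intro!: continuous_intros norm_triangle_le add_mono)
next
  case (Suc k)
  obtain v' where v: "bounded_Ck a b z 0 M v" "bounded_Ck a b z k M v'"
    "\<And>u. u \<in> {a..b} \<Longrightarrow> (v has_vector_derivative v' u) (at u within {a..b})"
    using Suc.prems(1) by (rule bounded_Ck_SucE) blast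
  obtain w' where w: "bounded_Ck a b z 0 N w" "bounded_Ck a b z k N w'"
    "\<And>u. u \<in> {a..b} \<Longrightarrow> (w has_vector_derivative w' u) (at u within {a..b})"
    using Suc.prems(2) by (rule bounded_Ck_SucE) blast
  have "bounded_Ck a b z 0 (M + N) (\<lambda>u. v u + w u)"
    using v(1) w(1) by (auto intro!: continuous_intros norm_triangle_le add_mono)
  moreover have "((\<lambda>u. v u + w u) has_vector_derivative v' u + w' u) (at u within {a..b})"
    if "u \<in> {a..b}" for u
    using that v w by (auto intro!: derivative_intros)
  ultimately show ?case by (rule bounded_Ck_SucI[OF _ Suc.IH[OF v(2) w(2)]])
qed

text \<open>Each use of the product rule doubles the number of terms, whence \<open>2 ^ k\<close>.
  One factor vanishing at the ends is enough for the product to inherit the flag.\<close>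

lemma bounded_Ck_mult:
  assumes "a \<le> b"
  shows "bounded_Ck a b z k M v \<Longrightarrow> bounded_Ck a b False k N w \<Longrightarrow>
    bounded_Ck a b z k (2 ^ k * M * N) (\<lambda>u. v u * w u)"
proof (induction k arbitrary: v w)
  case 0
  then show ?case using bounded_Ck_nonneg[OF 0(1) assms]
    by (auto intro!: continuous_intros mult_mono simp: norm_mult)
next
  case (Suc k)
  have pos: "0 \<le> M" "0 \<le> N" using Suc.prems bounded_Ck_nonneg assms by blast+
  obtain v' where v: "bounded_Ck a b z 0 M v" "bounded_Ck a b z k M v'"
    "\<And>u. u \<in> {a..b} \<Longrightarrow> (v has_vector_derivative v' u) (at u within {a..b})"
    using Suc.prems(1) by (rule bounded_Ck_SucE) blast
  obtain w' where w: "bounded_Ck a b False 0 N w" "bounded_Ck a b False k N w'"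
    "\<And>u. u \<in> {a..b} \<Longrightarrow> (w has_vector_derivative w' u) (at u within {a..b})"
    using Suc.prems(2) by (rule bounded_Ck_SucE) blast
  have "1 * (M * N) \<le> 2 ^ Suc k * (M * N)"
    using pos by (intro mult_right_mono one_le_power) auto
  then have "norm (v u * w u) \<le> 2 ^ Suc k * M * N" if "u \<in> {a..b}" for u
    using v(1) w(1) that pos mult_mono[of "norm (v u)" M "norm (w u)" N] by (auto simp: norm_mult mult.assoc)
  then have "bounded_Ck a b z 0 (2 ^ Suc k * M * N) (\<lambda>u. v u * w u)"
    using v(1) w(1) by (auto intro!: continuous_intros)
  moreover have "((\<lambda>u. v u * w u) has_vector_derivative v u * w' u + v' u * w u) (at u within {a..b})"
    if "u \<in> {a..b}" for u
    using that v w by (auto intro!: has_vector_derivative_mult)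
  moreover have "bounded_Ck a b z k (2 ^ Suc k * M * N) (\<lambda>u. v u * w' u + v' u * w u)"
    using bounded_Ck_add[OF Suc.IH[OF Suc.prems(1)[THEN bounded_Ck_Suc] w(2)]
        Suc.IH[OF v(2) Suc.prems(2)[THEN bounded_Ck_Suc]]] by (simp add: mult_ac)
  ultimately show ?case by (intro bounded_Ck_SucI) 
qed

section \<open>Integration by parts and the decay of Fourier integrals\<close>

lemma has_vector_derivative_cis:
  assumes "(f has_real_derivative f') (at x within S)"
  shows "((\<lambda>x. cis (f x)) has_vector_derivative \<i> * of_real f' * cis (f x)) (at x within S)"
proof -
  have "((\<lambda>x. \<i> * of_real (f x)) has_vector_derivative \<i> * of_real f') (at x within S)"
    using assms by (auto intro!: derivative_eq_intros simp: has_real_derivative_iff_has_vector_derivative)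
  from field_vector_diff_chain_within[OF this DERIV_subset[OF DERIV_exp]]
  show ?thesis by (simp add: cis_conv_exp[abs_def] o_def)
qed

lemma integral_by_parts_complex:
  fixes f e :: "real \<Rightarrow> complex"
  assumes "a \<le> b"
    and f: "\<And>u. u \<in> {a..b} \<Longrightarrow> (f has_vector_derivative f' u) (at u within {a..b})"
    and e: "\<And>u. u \<in> {a..b} \<Longrightarrow> (e has_vector_derivative e' u) (at u within {a..b})"
    and c: "continuous_on {a..b} f'" "continuous_on {a..b} e'"
  shows "integral {a..b} (\<lambda>u. f u * e' u) = f b * e b - f a * e a - integral {a..b} (\<lambda>u. f' u * e u)"
proof -
  have ct: "continuous_on {a..b} f" "continuous_on {a..b} e"
    using continuous_on_vector_derivative f e by blast+
  have "((\<lambda>u. f u * e' u + f' u * e u) has_integral f b * e b - f a * e a) {a..b}"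
    using assms by (intro fundamental_theorem_of_calculus has_vector_derivative_mult) auto
  moreover have "((\<lambda>u. f' u * e u) has_integral integral {a..b} (\<lambda>u. f' u * e u)) {a..b}"
    using c ct by (intro integrable_integral integrable_continuous_real continuous_intros) auto
  ultimately have "((\<lambda>u. (f u * e' u + f' u * e u) - f' u * e u) has_integral
      f b * e b - f a * e a - integral {a..b} (\<lambda>u. f' u * e u)) {a..b}"
    by (rule has_integral_diff)
  then show ?thesis by (intro integral_unique) simp
qed

lemma norm_integral_le_const:
  fixes f :: "real \<Rightarrow> complex"
  assumes "a \<le> b" "continuous_on {a..b} f" "\<And>u. u \<in> {a..b} \<Longrightarrow> norm (f u) \<le> B"
  shows "norm (integral {a..b} f) \<le> B * (b - a)"
  using assms by (intro integral_bound) auto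

text \<open>Two integrations by parts give \<open>w\<^sup>2\<close> times the integral as minus the
  integral with \<open>f''\<close>. Adding the trivial bound, each of the two costing
  \<open>2 * L * B\<close>, turns the denominator into \<open>1 + w\<^sup>2\<close> and covers small
  \<open>w\<close>.\<close>

lemma fourier_C2_bound:
  fixes f :: "real \<Rightarrow> complex"
  assumes L: "0 \<le> L"
    and f: "\<And>s. s \<in> {-L..L} \<Longrightarrow> (f has_vector_derivative f' s) (at s within {-L..L})"
    and f': "\<And>s. s \<in> {-L..L} \<Longrightarrow> (f' has_vector_derivative f'' s) (at s within {-L..L})"
    and c: "continuous_on {-L..L} f''"
    and b: "\<And>s. s \<in> {-L..L} \<Longrightarrow> norm (f s) \<le> B" "\<And>s. s \<in> {-L..L} \<Longrightarrow> norm (f'' s) \<le> B"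
    and z: "f L = 0" "f (-L) = 0" "f' L = 0" "f' (-L) = 0"
  shows "norm (integral {-L..L} (\<lambda>s. f s * cis (w * s))) \<le> 4 * L * B / (1 + w\<^sup>2)"
proof -
  define I0 where "I0 = integral {-L..L} (\<lambda>s. f s * cis (w * s))"
  define I2 where "I2 = integral {-L..L} (\<lambda>s. f'' s * cis (w * s))"
  have cf: "continuous_on {-L..L} f" "continuous_on {-L..L} f'"
    using continuous_on_vector_derivative f f' by blast+
  have d: "((\<lambda>s. cis (w * s)) has_vector_derivative \<i> * of_real w * cis (w * s)) (at s within {-L..L})" for s
    by (rule has_vector_derivative_cis) (auto intro!: derivative_eq_intros)
  have e1: "integral {-L..L} (\<lambda>s. f s * (\<i> * of_real w * cis (w * s))) = - integral {-L..L} (\<lambda>s. f' s * cis (w * s))"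
    by (subst integral_by_parts_complex[OF _ f d]) (use L cf z in \<open>auto intro!: continuous_intros\<close>)
  have e2: "integral {-L..L} (\<lambda>s. f' s * (\<i> * of_real w * cis (w * s))) = - I2"
    unfolding I2_def
    by (subst integral_by_parts_complex[OF _ f' d]) (use L c z in \<open>auto intro!: continuous_intros\<close>)
  have "\<i> * of_real w * (\<i> * of_real w * I0) = I2"
    unfolding I0_def
    using e1 e2 by (simp add: mult.left_commute[of "f _"] mult.left_commute[of "f' _"])
  then have "of_real (w\<^sup>2) * I0 = - I2"
    by (simp add: power2_eq_square algebra_simps) (metis minus_minus)
  then have "w\<^sup>2 * norm I0 = norm I2" 
    by (metis abs_power2 norm_minus_cancel norm_mult norm_of_real)
  moreover have "norm I2 \<le> B * (L - - L)" "norm I0 \<le> B * (L - - L)"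
    unfolding I2_def I0_def
    by (intro norm_integral_le_const; use L b c cf in \<open>auto simp: norm_mult intro!: continuous_intros\<close>)+
  ultimately have "norm I0 * (1 + w\<^sup>2) \<le> 4 * L * B" by (simp add: algebra_simps)
  then show ?thesis unfolding I0_def by (simp add: pos_le_divide_eq add_pos_nonneg)
qed

text \<open>Near the pole \<open>p\<close> the numerator is zero and so is the quotient, with
  division by zero giving 0; the usual formula therefore holds at \<open>s = p\<close> too.\<close>

lemma has_real_derivative_quotient_power:
  fixes m :: "real \<Rightarrow> real"
  assumes m: "\<And>s. (m has_real_derivative m1 s) (at s)"
    and d: "0 < d" and z: "\<And>s. \<bar>s - p\<bar> < d \<Longrightarrow> m s = 0" "\<And>s. \<bar>s - p\<bar> < d \<Longrightarrow> m1 s = 0"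
  shows "((\<lambda>s. m s / (s - p) ^ j) has_real_derivative
           m1 s / (s - p) ^ j - real j * (m s / (s - p) ^ Suc j)) (at s)"
proof (cases "s = p")
  case True
  have "((\<lambda>s. 0) has_real_derivative 0) (at p)" by simp
  then have "((\<lambda>s. m s / (s - p) ^ j) has_real_derivative 0) (at p)"
    by (rule has_field_derivative_transform_within_open[of _ _ _ "{p - d<..<p + d}"])
      (use d z in \<open>auto simp: abs_less_iff\<close>)
  then show ?thesis using True z d by simp
next
  case False
  then show ?thesis
    by (auto intro!: derivative_eq_intros m simp: divide_simps)
      (cases j; simp add: algebra_simps)
qed

lemma continuous_on_quotient_power:
  fixes m :: "real \<Rightarrow> real"
  assumes m: "continuous_on UNIV m"
    and d: "0 < d" and z: "\<And>s. \<bar>s - p\<bar> < d \<Longrightarrow> m s = 0"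
  shows "continuous_on A (\<lambda>s. m s / (s - p) ^ j)"
proof -
  have "isCont (\<lambda>s. m s / (s - p) ^ j) s" for s
  proof (cases "s = p")
    case True
    have "\<forall>\<^sub>F s in nhds p. m s / (s - p) ^ j = 0"
      using eventually_nhds_in_open[of "{p - d<..<p + d}" p] d
      by (auto elim!: eventually_mono simp: z abs_less_iff)
    then show ?thesis unfolding True by (subst isCont_cong[where g = "\<lambda>_. 0"]) auto
  next
    case False
    have "isCont m s" using m by (simp add: continuous_on_eq_continuous_at)
    with False show ?thesis by (auto intro!: continuous_intros)
  qed
  then show ?thesis by (simp add: continuous_at_imp_continuous_on)
qed

lemma abs_quotient_power_le:
  fixes n :: "real \<Rightarrow> real"
  assumes "0 < d" "\<And>s. \<bar>s - p\<bar> < d \<Longrightarrow> n s = 0" "\<And>s. \<bar>n s\<bar> \<le> B"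
  shows "\<bar>n s / (s - p) ^ j\<bar> \<le> B / d ^ j"
proof (cases "\<bar>s - p\<bar> < d")
  case True
  have "0 \<le> B" using assms(3)[of 0] by linarith
  then show ?thesis using True assms by simp
next
  case False
  have "d ^ j \<le> \<bar>s - p\<bar> ^ j" using False assms(1) by (intro power_mono) auto
  then show ?thesis using assms(1,3) by (auto simp: abs_divide power_abs intro!: frac_le order_trans[OF abs_ge_zero])
qed

subsection \<open>Twice differentiable cutoffs and their Fourier kernels\<close>

definition C2 :: "(real \<Rightarrow> real) \<Rightarrow> bool" where
  "C2 m \<longleftrightarrow> (\<exists>m1 m2. (\<forall>s. (m has_real_derivative m1 s) (at s)) \<and>
     (\<forall>s. (m1 has_real_derivative m2 s) (at s)) \<and> continuous_on UNIV m2)"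

lemma C2I:
  assumes "\<And>s. (m has_real_derivative m1 s) (at s)" "\<And>s. (m1 has_real_derivative m2 s) (at s)"
    and "continuous_on UNIV m2"
  shows "C2 m"
  using assms unfolding C2_def by blast

lemma C2E:
  assumes "C2 m"
  obtains m1 m2 where "\<And>s. (m has_real_derivative m1 s) (at s)"
    "\<And>s. (m1 has_real_derivative m2 s) (at s)" "continuous_on UNIV m2"
    "continuous_on UNIV m1" "continuous_on UNIV m"
proof -
  from assms obtain m1 m2 where m: "\<And>s. (m has_real_derivative m1 s) (at s)"
    "\<And>s. (m1 has_real_derivative m2 s) (at s)" "continuous_on UNIV m2"
    unfolding C2_def by blast
  moreover have "continuous_on UNIV m1" "continuous_on UNIV m"
    using m by (auto intro!: continuous_at_imp_continuous_on DERIV_isCont)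
  ultimately show ?thesis by (rule that)
qed

lemma C2_diff: "C2 f \<Longrightarrow> C2 g \<Longrightarrow> C2 (\<lambda>s. f s - g s)"
  by (elim C2E, rule C2I) (rule derivative_intros continuous_intros | assumption)+

lemma C2_mult:
  assumes "C2 f" "C2 g"
  shows "C2 (\<lambda>s. f s * g s)"
proof -
  obtain f1 f2 where f: "\<And>s. (f has_real_derivative f1 s) (at s)"
    "\<And>s. (f1 has_real_derivative f2 s) (at s)" "continuous_on UNIV f2"
    "continuous_on UNIV f1" "continuous_on UNIV f" using assms(1) by (rule C2E) blast
  obtain g1 g2 where g: "\<And>s. (g has_real_derivative g1 s) (at s)"
    "\<And>s. (g1 has_real_derivative g2 s) (at s)" "continuous_on UNIV g2"
    "continuous_on UNIV g1" "continuous_on UNIV g" using assms(2) by (rule C2E) blast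
  show ?thesis
    by (rule C2I[of _ "\<lambda>s. f1 s * g s + f s * g1 s"
          "\<lambda>s. f2 s * g s + 2 * (f1 s * g1 s) + f s * g2 s"])
      (auto intro!: derivative_eq_intros f g continuous_intros)
qed

lemma C2_affine:
  assumes "C2 f"
  shows "C2 (\<lambda>s. f (c * s + e))"
proof -
  obtain f1 f2 where f: "\<And>s. (f has_real_derivative f1 s) (at s)"
    "\<And>s. (f1 has_real_derivative f2 s) (at s)" "continuous_on UNIV f2"
    "continuous_on UNIV f1" "continuous_on UNIV f" using assms(1) by (rule C2E) blast
  have chain: "((\<lambda>s. h (c * s + e)) has_real_derivative c * h' (c * s + e)) (at s)"
    if "\<And>s. (h has_real_derivative h' s) (at s)" for h h' :: "real \<Rightarrow> real" and s
  proof -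
    have "((\<lambda>s. c * s + e) has_real_derivative c) (at s)" by (auto intro!: derivative_eq_intros)
    from DERIV_chain2[OF that this] show ?thesis by (simp add: mult.commute)
  qed
  show ?thesis
    by (rule C2I[of _ "\<lambda>s. c * f1 (c * s + e)" "\<lambda>s. c * (c * f2 (c * s + e))"])
      (auto intro!: chain f DERIV_cmult continuous_intros continuous_on_compose2[OF f(3)])
qed

text \<open>At the corner the difference quotient is again a positive power of the truncation, so it
  tends to 0.\<close>

lemma has_real_derivative_max_0_power:
  "((\<lambda>x. max 0 x ^ Suc (Suc n)) has_real_derivative real (Suc (Suc n)) * max 0 x ^ Suc n) (at x)"
proof (cases "x = 0")
  case True
  have "((\<lambda>h. max 0 h ^ Suc (Suc n) / h) \<longlongrightarrow> 0) (at (0::real))"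
  proof (rule Lim_transform_eventually)
    show "((\<lambda>h. max 0 h ^ Suc n) \<longlongrightarrow> 0) (at (0::real))"
      by (auto intro!: tendsto_eq_intros)
    show "\<forall>\<^sub>F h in at (0::real). max 0 h ^ Suc n = max 0 h ^ Suc (Suc n) / h"
      by (auto simp: eventually_at_filter max_def)
  qed
  then show ?thesis using True by (simp add: has_field_derivative_iff)
next
  case False
  then consider "x < 0" | "x > 0" by linarith
  then show ?thesis
  proof cases
    case 1
    have "((\<lambda>x::real. 0) has_real_derivative 0) (at x)" by simp
    then have "((\<lambda>x. max 0 x ^ Suc (Suc n)) has_real_derivative 0) (at x)"
      by (rule has_field_derivative_transform_within_open[of _ _ _ "{..<0}"]) (use 1 in auto)
    then show ?thesis using 1 by simp
  next
    case 2
    have "((\<lambda>x::real. x ^ Suc (Suc n)) has_real_derivative real (Suc (Suc n)) * x ^ Suc n) (at x)"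
      by (rule derivative_eq_intros refl | simp)+
    then have "((\<lambda>x. max 0 x ^ Suc (Suc n)) has_real_derivative real (Suc (Suc n)) * x ^ Suc n) (at x)"
      by (rule has_field_derivative_transform_within_open[of _ _ _ "{0<..}"]) (use 2 in auto)
    then show ?thesis using 2 by simp
  qed
qed

text \<open>The step function is the normalised third difference of the truncated cube.\<close>

lemma C2_step_exists:
  obtains S where "C2 S" "\<And>x. x \<le> 0 \<Longrightarrow> S x = 0" "\<And>x. x \<ge> 3 \<Longrightarrow> S x = 1"
proof -
  define q where "q x = max 0 x ^ 3 / 6" for x :: real
  have "((\<lambda>x. max 0 x ^ 3 / 6) has_real_derivative max 0 x ^ 2 / 2) (at x)" for x :: real
    using DERIV_cdivide[OF has_real_derivative_max_0_power[of 1 x], of 6] by (simp add: eval_nat_numeral)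
  moreover have "((\<lambda>x. max 0 x ^ 2 / 2) has_real_derivative max 0 x) (at x)" for x :: real
    using DERIV_cdivide[OF has_real_derivative_max_0_power[of 0 x], of 2] by (simp add: eval_nat_numeral)
  ultimately have q: "C2 q"
    unfolding q_def by (rule C2I) (auto intro!: continuous_intros)
  have q': "C2 (\<lambda>x. q (x - c))" for c
    using C2_affine[OF q, of 1 "-c"] by simp
  define D where "D x = q x - q (x - 1)" for x
  have D: "C2 D" unfolding D_def by (intro C2_diff q q')
  define E where "E x = D x - D (x - 1)" for x
  have E: "C2 E" unfolding E_def using C2_diff[OF D C2_affine[OF D, of 1 "-1"]] by simp
  define S where "S x = E x - E (x - 1)" for x
  have "C2 S" unfolding S_def using C2_diff[OF E C2_affine[OF E, of 1 "-1"]] by simp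
  moreover have "S x = 0" if "x \<le> 0" for x
    using that by (simp add: S_def E_def D_def q_def)
  moreover have "S x = 1" if "x \<ge> 3" for x
    using that by (simp add: S_def E_def D_def q_def power3_eq_cube field_simps)
  ultimately show ?thesis by (rule that)
qed

lemma C2_cutoff_exists:
  assumes "a' < a" "b < b'"
  obtains \<theta> where "C2 \<theta>" "\<And>s. a \<le> s \<Longrightarrow> s \<le> b \<Longrightarrow> \<theta> s = 1" "\<And>s. s \<le> a' \<or> b' \<le> s \<Longrightarrow> \<theta> s = 0"
proof -
  obtain S where S: "C2 S" "\<And>x. x \<le> 0 \<Longrightarrow> S x = 0" "\<And>x. x \<ge> 3 \<Longrightarrow> S x = 1"
    by (rule C2_step_exists) blast
  \<comment> \<open>\<open>S\<close> rises over a length of 3, which gives the slopes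
    \<open>3 / (a - a')\<close> and \<open>3 / (b' - b)\<close>; the arguments are kept in the
    affine form that \<open>C2_affine\<close> expects.\<close>
  define \<theta> where "\<theta> s = S (3 / (a - a') * s + - (3 / (a - a') * a')) * S (- (3 / (b' - b)) * s + 3 / (b' - b) * b')" for s
  have e: "\<theta> s = S (3 * (s - a') / (a - a')) * S (3 * (b' - s) / (b' - b))" for s
    by (simp add: \<theta>_def algebra_simps diff_divide_distrib)
  have "C2 \<theta>" unfolding \<theta>_def by (intro C2_mult C2_affine S)
  moreover have "\<theta> s = 1" if "a \<le> s" "s \<le> b" for s
    unfolding e using that assms by (simp add: S(3) pos_le_divide_eq)
  moreover have "\<theta> s = 0" if "s \<le> a' \<or> b' \<le> s" for s
    unfolding e using that assms by (auto simp: S(2) divide_nonpos_pos)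
  ultimately show ?thesis by (rule that)
qed

lemma has_real_derivative_zero_on_open:
  assumes "(m has_real_derivative D) (at s)" "open U" "s \<in> U" "\<And>x. x \<in> U \<Longrightarrow> m x = 0"
  shows "D = 0"
proof -
  have "((\<lambda>x. 0) has_real_derivative D) (at s)"
    using assms(1) by (rule has_field_derivative_transform_within_open[OF _ assms(2,3)]) (simp add: assms(4))
  then show ?thesis using DERIV_const DERIV_unique by blast
qed

text \<open>Opens the existential in \<open>C2\<close> once, so that the same two derivatives come
  with all their properties. Vanishing on an open set passes to derivatives; applied to the exterior
  of the support it reduces the bounds to compactness.\<close>

lemma C2_compact_support:
  assumes "C2 m" and z: "\<And>s. L0 \<le> \<bar>s\<bar> \<Longrightarrow> m s = 0" and L0: "0 \<le> L0"
  obtains m1 m2 B where "\<And>s. (m has_real_derivative m1 s) (at s)"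
    "\<And>s. (m1 has_real_derivative m2 s) (at s)" "continuous_on UNIV m2"
    "\<forall>U. open U \<longrightarrow> (\<forall>x\<in>U. m x = 0) \<longrightarrow> (\<forall>s\<in>U. m1 s = 0 \<and> m2 s = 0)"
    "0 \<le> B" "\<And>s. \<bar>m s\<bar> \<le> B" "\<And>s. \<bar>m1 s\<bar> \<le> B" "\<And>s. \<bar>m2 s\<bar> \<le> B"
proof -
  obtain m1 m2 where m: "\<And>s. (m has_real_derivative m1 s) (at s)"
    "\<And>s. (m1 has_real_derivative m2 s) (at s)" "continuous_on UNIV m2"
    "continuous_on UNIV m1" "continuous_on UNIV m" using assms(1) by (rule C2E) blast
  have loc1: "m1 s = 0" if "open U" "\<And>x. x \<in> U \<Longrightarrow> m x = 0" "s \<in> U" for U s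
    using has_real_derivative_zero_on_open[OF m(1)] that by blast
  have loc2: "m2 s = 0" if "open U" "\<And>x. x \<in> U \<Longrightarrow> m x = 0" "s \<in> U" for U s
    using has_real_derivative_zero_on_open[OF m(2)] loc1 that by blast
  have bd: "\<exists>B. \<forall>s. \<bar>f s\<bar> \<le> B" if f: "continuous_on UNIV f" "\<And>s. L0 < \<bar>s\<bar> \<Longrightarrow> f s = 0" for f :: "real \<Rightarrow> real"
  proof -
    have "bounded (f ` {-L0..L0})"
      using f(1) by (intro compact_imp_bounded compact_continuous_image continuous_on_subset[OF f(1)]) auto
    then obtain B where "\<forall>y\<in>f ` {-L0..L0}. norm y \<le> B" unfolding bounded_iff by blast
    then have B: "\<bar>f s\<bar> \<le> B" if "s \<in> {-L0..L0}" for s using that by simp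
    have "0 \<le> B" using B[of 0] L0 by simp
    then have "\<bar>f s\<bar> \<le> B" for s using B[of s] f(2)[of s] by (cases "L0 < \<bar>s\<bar>") (auto simp: abs_if split: if_splits)
    then show ?thesis by blast
  qed
  have far: "L0 < \<bar>s\<bar> \<Longrightarrow> s \<in> {s. L0 < \<bar>s\<bar>}" "open {s::real. L0 < \<bar>s\<bar>}" for s :: real
    by (auto intro!: open_Collect_less continuous_intros)
  obtain B0 where B0: "\<And>s. \<bar>m s\<bar> \<le> B0" using bd[OF m(5)] z by force
  obtain B1 where B1: "\<And>s. \<bar>m1 s\<bar> \<le> B1" using bd[OF m(4)] loc1[OF far(2)] z by force
  obtain B2 where B2: "\<And>s. \<bar>m2 s\<bar> \<le> B2" using bd[OF m(3)] loc2[OF far(2)] z by force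
  define B where "B = max B0 (max B1 B2)"
  have B: "\<bar>m s\<bar> \<le> B" "\<bar>m1 s\<bar> \<le> B" "\<bar>m2 s\<bar> \<le> B" for s
    using B0[of s] B1[of s] B2[of s] by (auto simp: B_def)
  from B(1)[of 0] have "0 \<le> B" by linarith
  show ?thesis
    by (rule that[OF m(1,2,3) _ \<open>0 \<le> B\<close> B]) (use loc1 loc2 in blast)
qed

text \<open>The point is uniformity in the pole \<open>p\<close>: where the numerator is nonzero,
  \<open>\<bar>s - p\<bar>\<close> is at least \<open>d\<close>, so the quotient and its second
  derivative are bounded in terms of \<open>d\<close>, \<open>j\<close> and the bounds of
  \<open>m\<close> alone. In the applications \<open>p\<close> is the phase derivative, which moves
  with \<open>u\<close> and with the phase.\<close>

lemma quotient_kernel_bound: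
  assumes m: "C2 m" and z: "\<And>s. L0 \<le> \<bar>s\<bar> \<Longrightarrow> m s = 0" and L0: "0 \<le> L0" "L0 < L" and d: "0 < d"
  obtains C where "0 \<le> C"
    "\<And>p w. (\<And>s. \<bar>s - p\<bar> < d \<Longrightarrow> m s = 0) \<Longrightarrow>
      norm (integral {-L..L} (\<lambda>s. of_real (m s / (s - p) ^ j) * cis (w * s))) \<le> C / (1 + w\<^sup>2)"
proof -
  obtain m1 m2 B where m: "\<And>s. (m has_real_derivative m1 s) (at s)"
    "\<And>s. (m1 has_real_derivative m2 s) (at s)" "continuous_on UNIV m2"
    and loc: "\<forall>U. open U \<longrightarrow> (\<forall>x\<in>U. m x = 0) \<longrightarrow> (\<forall>s\<in>U. m1 s = 0 \<and> m2 s = 0)"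
    and B: "0 \<le> B" "\<And>s. \<bar>m s\<bar> \<le> B" "\<And>s. \<bar>m1 s\<bar> \<le> B" "\<And>s. \<bar>m2 s\<bar> \<le> B"
    by (rule C2_compact_support[OF m _ L0(1)], erule z) blast
  have cm: "continuous_on UNIV m" "continuous_on UNIV m1"
    using m by (auto intro!: continuous_at_imp_continuous_on DERIV_isCont)
  \<comment> \<open>The four terms of the second derivative \<open>f2\<close> below, with each
    \<open>s - p\<close> replaced by \<open>d\<close>; the first term also bounds the quotient
    itself.\<close>
  define D where "D = B / d ^ j + real j * (B / d ^ Suc j) + real j * (B / d ^ Suc j) +
      real j * (real (Suc j) * (B / d ^ Suc (Suc j)))"
  have D: "B / d ^ j \<le> D" "0 \<le> D" using d B unfolding D_def by auto
  have main: "norm (integral {-L..L} (\<lambda>s. of_real (m s / (s - p) ^ j) * cis (w * s))) \<le> 4 * L * D / (1 + w\<^sup>2)"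
    if p: "\<And>s. \<bar>s - p\<bar> < d \<Longrightarrow> m s = 0" for p w
  proof -
    have U: "open {p - d<..<p + d}" by simp
    have zm: "m s = 0" "m1 s = 0" "m2 s = 0" if "\<bar>s - p\<bar> < d" for s
      using that p loc[rule_format, OF U, of s] by (auto simp: abs_less_iff)
    define f1 where "f1 s = m1 s / (s - p) ^ j - real j * (m s / (s - p) ^ Suc j)" for s
    define f2 where "f2 s = (m2 s / (s - p) ^ j - real j * (m1 s / (s - p) ^ Suc j)) -
      real j * (m1 s / (s - p) ^ Suc j - real (Suc j) * (m s / (s - p) ^ Suc (Suc j)))" for s
    have d1: "((\<lambda>s. m s / (s - p) ^ j) has_real_derivative f1 s) (at s)" for s
      unfolding f1_def by (rule has_real_derivative_quotient_power[OF m(1) d]) (use zm in auto)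
    have d2: "(f1 has_real_derivative f2 s) (at s)" for s
    proof -
      have q1: "((\<lambda>s. m1 s / (s - p) ^ j) has_real_derivative
          m2 s / (s - p) ^ j - real j * (m1 s / (s - p) ^ Suc j)) (at s)"
        by (rule has_real_derivative_quotient_power[OF m(2) d]) (use zm in auto)
      have q2: "((\<lambda>s. m s / (s - p) ^ Suc j) has_real_derivative
          m1 s / (s - p) ^ Suc j - real (Suc j) * (m s / (s - p) ^ Suc (Suc j))) (at s)"
        by (rule has_real_derivative_quotient_power[OF m(1) d]) (use zm in auto)
      show ?thesis
        using DERIV_diff[OF q1 DERIV_cmult[OF q2, of "real j"]] by (simp only: f1_def[abs_def] f2_def)
    qed
    have c2: "continuous_on A f2" for A
    proof -
      have "continuous_on A (\<lambda>s. m s / (s - p) ^ i)" "continuous_on A (\<lambda>s. m1 s / (s - p) ^ i)"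
        "continuous_on A (\<lambda>s. m2 s / (s - p) ^ i)" for i
        by (rule continuous_on_quotient_power[OF _ d]; use zm cm m(3) in auto)+
      then show ?thesis
        unfolding f2_def by (intro continuous_on_diff continuous_on_mult continuous_on_const)
    qed
    have q: "\<bar>m s / (s - p) ^ i\<bar> \<le> B / d ^ i" "\<bar>m1 s / (s - p) ^ i\<bar> \<le> B / d ^ i"
      "\<bar>m2 s / (s - p) ^ i\<bar> \<le> B / d ^ i" for s i
      by (intro abs_quotient_power_le[OF d]; use zm B in auto)+
    have b0: "\<bar>m s / (s - p) ^ j\<bar> \<le> D" for s using q(1)[of s j] D by linarith
    have b2: "\<bar>f2 s\<bar> \<le> D" for s
    proof -
      have *: "\<bar>real j * x\<bar> \<le> real j * y" "\<bar>real (Suc j) * x\<bar> \<le> real (Suc j) * y" if "\<bar>x\<bar> \<le> y" for x y :: real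
        using that by (auto simp: abs_mult intro!: mult_left_mono)
      have triangle: "\<bar>x - y - (y - z)\<bar> \<le> x' + y' + y' + z'"
        if "\<bar>x\<bar> \<le> x'" "\<bar>y\<bar> \<le> y'" "\<bar>z\<bar> \<le> z'" for x y z x' y' z' :: real
        using that by linarith
      show ?thesis unfolding f2_def D_def
        using q(3)[of s j] *(1)[OF q(2)[of s "Suc j"]] *(1)[OF *(2)[OF q(1)[of s "Suc (Suc j)"]]]
        by (simp only: right_diff_distrib) (rule triangle; assumption)
    qed
    \<comment> \<open>Since \<open>L0 < L\<close>, the ends \<open>L\<close> and \<open>-L\<close>
      are interior to the region where \<open>m\<close> vanishes, so the derivative vanishes there
      as well.\<close>
    have far: "open {s::real. L0 < \<bar>s\<bar>}" by (auto intro!: open_Collect_less continuous_intros)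
    have zL: "m s = 0 \<and> m1 s = 0" if "s = L \<or> s = -L" for s
      using loc[rule_format, OF far, of s] z L0 that by auto
    show ?thesis
    proof (rule fourier_C2_bound)
      show "((\<lambda>s. of_real (m s / (s - p) ^ j) :: complex) has_vector_derivative of_real (f1 s)) (at s within {-L..L})" for s
        using d1[of s] by (intro has_vector_derivative_of_real) (rule has_field_derivative_at_within)
      show "((\<lambda>s. of_real (f1 s) :: complex) has_vector_derivative of_real (f2 s)) (at s within {-L..L})" for s
        using d2[of s] by (intro has_vector_derivative_of_real) (rule has_field_derivative_at_within)
      show "continuous_on {-L..L} (\<lambda>s. of_real (f2 s) :: complex)"
        by (intro continuous_intros c2)
    qed (use L0 b0 b2 zL in \<open>auto simp del: of_real_divide of_real_power simp: f1_def\<close>)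
  qed
  show ?thesis
    by (rule that[of "4 * L * D"]) (use main D L0 in auto)
qed

text \<open>The case \<open>j = 0\<close>, with an artificial pole at \<open>L0 + 1\<close>: its
  neighbourhood of radius 1 lies beyond the support.\<close>

lemma fourier_kernel_bound:
  assumes m: "C2 m" and z: "\<And>s. L0 \<le> \<bar>s\<bar> \<Longrightarrow> m s = 0" and L0: "0 \<le> L0" "L0 < L"
  obtains C where "0 \<le> C"
    "\<And>w. norm (integral {-L..L} (\<lambda>s. of_real (m s) * cis (w * s))) \<le> C / (1 + w\<^sup>2)"
proof -
  obtain C where C: "0 \<le> C"
    "\<And>p w. (\<And>s. \<bar>s - p\<bar> < 1 \<Longrightarrow> m s = 0) \<Longrightarrow>
      norm (integral {-L..L} (\<lambda>s. of_real (m s / (s - p) ^ 0) * cis (w * s))) \<le> C / (1 + w\<^sup>2)"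
    using quotient_kernel_bound[OF m z L0, of 1 0] by auto
  have "m s = 0" if "\<bar>s - (L0 + 1)\<bar> < 1" for s using that by (intro z) linarith
  from C(2)[OF this] C(1) show ?thesis by (intro that[of C]) auto
qed

subsection \<open>Nonstationary oscillatory integrals\<close>

text \<open>Each integration by parts in \<open>u\<close> divides by the phase derivative
  \<open>\<tau> * (\<psi>' u - s)\<close>, so powers of \<open>s - \<psi>' u\<close> accumulate;
  \<open>j\<close> counts them. The variable \<open>s\<close> is outermost because these
  integrations by parts are done at fixed \<open>s\<close>.\<close>

definition osc_integral ::
  "(real \<Rightarrow> real) \<Rightarrow> real \<Rightarrow> real \<Rightarrow> real \<Rightarrow> nat \<Rightarrow> (real \<Rightarrow> real) \<Rightarrow> (real \<Rightarrow> real) \<Rightarrow> real \<Rightarrow> real \<Rightarrow>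
    (real \<Rightarrow> complex) \<Rightarrow> complex" where
  "osc_integral m L a b j \<psi> \<psi>' \<tau> y v =
     integral {-L..L} (\<lambda>s. integral {a..b} (\<lambda>u.
       of_real (m s / (s - \<psi>' u) ^ j) * v u * cis (\<tau> * (\<psi> u + (y - u) * s))))"

text \<open>Quantitative control starts with the second derivative: it is what differentiating a
  power of \<open>1 / (s - \<psi>' u)\<close> produces, while \<open>\<psi>'\<close> enters through
  denominators that the cutoff bounds below.\<close>

definition phase :: "real \<Rightarrow> real \<Rightarrow> nat \<Rightarrow> real \<Rightarrow> (real \<Rightarrow> real) \<Rightarrow> (real \<Rightarrow> real) \<Rightarrow> bool" where
  "phase a b k N \<psi> \<psi>' \<longleftrightarrow>
     (\<forall>u\<in>{a..b}. (\<psi> has_real_derivative \<psi>' u) (at u within {a..b})) \<and>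
     (\<exists>\<psi>''. (\<forall>u\<in>{a..b}. (\<psi>' has_real_derivative \<psi>'' u) (at u within {a..b})) \<and>
       bounded_Ck a b False k N (\<lambda>u. of_real (\<psi>'' u)))"

lemma phase_continuous:
  assumes "phase a b k N \<psi> \<psi>'"
  shows "continuous_on {a..b} \<psi>" "continuous_on {a..b} \<psi>'"
  using assms unfolding phase_def by (auto intro: DERIV_continuous_on)

lemma osc_integrand_continuous:
  fixes v :: "real \<Rightarrow> complex"
  assumes m: "continuous_on UNIV m" and d: "0 < d"
    and z: "\<And>s u. u \<in> {a..b} \<Longrightarrow> \<bar>s - \<psi>' u\<bar> < d \<Longrightarrow> m s = 0"
    and c: "continuous_on {a..b} \<psi>" "continuous_on {a..b} \<psi>'" "continuous_on {a..b} v"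
  shows "continuous_on (cbox (-L, a) (L, b))
    (\<lambda>(s, u). of_real (m s / (s - \<psi>' u) ^ j) * v u * cis (\<tau> * (\<psi> u + (y - u) * s)))"
proof -
  \<comment> \<open>A globally continuous substitute for \<open>1 / x\<close> that agrees with it
    once \<open>d \<le> \<bar>x\<bar>\<close>, hence wherever \<open>m s\<close> is nonzero; it
    makes joint continuity a matter of composition.\<close>
  define \<iota> where "\<iota> x = x / max (x\<^sup>2) (d\<^sup>2)" for x :: real
  have \<iota>: "\<iota> x = inverse x" if "d \<le> \<bar>x\<bar>" for x
  proof -
    have "d\<^sup>2 \<le> x\<^sup>2" using that d by (metis abs_le_square_iff abs_of_pos)
    then show ?thesis by (simp add: \<iota>_def max_def power2_eq_square field_simps)
  qed
  have eq: "m s / (s - \<psi>' u) ^ j = m s * \<iota> (s - \<psi>' u) ^ j" if "u \<in> {a..b}" for s u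
    using z[OF that, of s] \<iota>[of "s - \<psi>' u"]
    by (cases "\<bar>s - \<psi>' u\<bar> < d") (auto simp: power_inverse field_simps)
  have "continuous_on UNIV \<iota>"
    unfolding \<iota>_def using d by (intro continuous_intros) (auto simp: max_def)
  note \<iota>c = continuous_on_compose2[OF this]
  have "continuous_on ({-L..L} \<times> {a..b})
    (\<lambda>p. of_real (m (fst p) * \<iota> (fst p - \<psi>' (snd p)) ^ j) * v (snd p) * cis (\<tau> * (\<psi> (snd p) + (y - snd p) * fst p)))"
    by (intro continuous_intros \<iota>c continuous_on_compose2[OF m] continuous_on_compose2[OF c(1)]
        continuous_on_compose2[OF c(2)] continuous_on_compose2[OF c(3)]) auto
  then have "continuous_on ({-L..L} \<times> {a..b})
    (\<lambda>p. of_real (m (fst p) / (fst p - \<psi>' (snd p)) ^ j) * v (snd p) * cis (\<tau> * (\<psi> (snd p) + (y - snd p) * fst p)))"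
    by (rule continuous_on_eq) (simp only: eq mem_Times_iff)
  then show ?thesis by (simp add: cbox_Pair_eq case_prod_beta)
qed

lemma integral_scaled_kernel:
  assumes "a \<le> b" "0 < \<tau>"
  shows "(\<lambda>u. 1 / (1 + (\<tau> * (y - u))\<^sup>2)) integrable_on {a..b}"
    and "integral {a..b} (\<lambda>u. 1 / (1 + (\<tau> * (y - u))\<^sup>2)) \<le> pi / \<tau>"
proof -
  have "((\<lambda>u. 1 / (1 + (\<tau> * (y - u))\<^sup>2)) has_integral
      - arctan (\<tau> * (y - b)) / \<tau> - (- arctan (\<tau> * (y - a)) / \<tau>)) {a..b}"
    by (rule fundamental_theorem_of_calculus[OF assms(1)],
        unfold has_real_derivative_iff_has_vector_derivative[symmetric])
      (use assms in \<open>auto intro!: derivative_eq_intros simp: field_simps add_nonneg_eq_0_iff\<close>)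
  then have I: "((\<lambda>u. 1 / (1 + (\<tau> * (y - u))\<^sup>2)) has_integral
      (arctan (\<tau> * (y - a)) - arctan (\<tau> * (y - b))) / \<tau>) {a..b}"
    by (simp add: diff_divide_distrib)
  have "arctan (\<tau> * (y - a)) - arctan (\<tau> * (y - b)) \<le> pi"
    using arctan_bounded[of "\<tau> * (y - a)"] arctan_bounded[of "\<tau> * (y - b)"] by linarith
  then show "integral {a..b} (\<lambda>u. 1 / (1 + (\<tau> * (y - u))\<^sup>2)) \<le> pi / \<tau>"
    using integral_unique[OF I] assms(2) by (simp add: divide_right_mono)
  show "(\<lambda>u. 1 / (1 + (\<tau> * (y - u))\<^sup>2)) integrable_on {a..b}"
    using I by (rule has_integral_integrable)
qed

text \<open>The source of one factor \<open>1 / \<tau>\<close> without any derivative: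
  \<open>1 / (1 + (\<tau> * (y - u))\<^sup>2)\<close> has integral at most
  \<open>pi / \<tau>\<close>, uniformly in \<open>y\<close> and in the interval.\<close>

lemma kernel_integral_bound:
  fixes f :: "real \<Rightarrow> complex"
  assumes "a \<le> b" "0 < \<tau>" "f integrable_on {a..b}" "0 \<le> D"
    and "\<And>u. u \<in> {a..b} \<Longrightarrow> norm (f u) \<le> D / (1 + (\<tau> * (y - u))\<^sup>2)"
  shows "norm (integral {a..b} f) \<le> D * pi / \<tau>"
proof -
  note k = integral_scaled_kernel[OF assms(1,2), of y]
  have "norm (integral {a..b} f) \<le> integral {a..b} (\<lambda>u. D * (1 / (1 + (\<tau> * (y - u))\<^sup>2)))"
    using assms by (intro integral_norm_bound_integral integrable_on_mult_right k(1)) auto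
  also have "\<dots> = D * integral {a..b} (\<lambda>u. 1 / (1 + (\<tau> * (y - u))\<^sup>2))"
    by (subst integral_mult_right[symmetric]) simp
  also have "\<dots> \<le> D * (pi / \<tau>)" using k(2) assms(4) by (rule mult_left_mono)
  finally show ?thesis by simp
qed

text \<open>By Fubini the \<open>s\<close>-integral is done first. For fixed \<open>u\<close> it is
  a quotient kernel with pole \<open>\<psi>' u\<close> at the frequency
  \<open>\<tau> * (y - u)\<close>, and \<open>v u * cis (\<tau> * \<psi> u)\<close> factors out of
  it; then the decay of the kernel is integrated in \<open>u\<close>.\<close>

lemma osc_integral_bound_0:
  assumes m: "C2 m" and z: "\<And>s. L0 \<le> \<bar>s\<bar> \<Longrightarrow> m s = 0" and L0: "0 \<le> L0" "L0 < L"
    and d: "0 < d" and ab: "a \<le> b"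
  shows "\<exists>C\<ge>0. \<forall>\<psi> \<psi>' \<tau> y v M N. phase a b 0 N \<psi> \<psi>' \<longrightarrow>
      (\<forall>u\<in>{a..b}. \<forall>s. \<bar>s - \<psi>' u\<bar> < d \<longrightarrow> m s = 0) \<longrightarrow> 0 < \<tau> \<longrightarrow> bounded_Ck a b True 0 M v \<longrightarrow>
      norm (osc_integral m L a b j \<psi> \<psi>' \<tau> y v) \<le> C * M / \<tau>"
proof -
  obtain C where C: "0 \<le> C"
    "\<And>p w. (\<And>s. \<bar>s - p\<bar> < d \<Longrightarrow> m s = 0) \<Longrightarrow>
      norm (integral {-L..L} (\<lambda>s. of_real (m s / (s - p) ^ j) * cis (w * s))) \<le> C / (1 + w\<^sup>2)"
    using quotient_kernel_bound[OF m z L0 d, of j] by blast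
  have "norm (osc_integral m L a b j \<psi> \<psi>' \<tau> y v) \<le> (C * pi) * M / \<tau>"
    if ph: "phase a b 0 N \<psi> \<psi>'" and van: "\<forall>u\<in>{a..b}. \<forall>s. \<bar>s - \<psi>' u\<bar> < d \<longrightarrow> m s = 0"
      and \<tau>: "0 < \<tau>" and v: "bounded_Ck a b True 0 M v" for \<psi> \<psi>' \<tau> y v M N
  proof -
    let ?f = "\<lambda>s u. of_real (m s / (s - \<psi>' u) ^ j) * v u * cis (\<tau> * (\<psi> u + (y - u) * s))"
    have mc: "continuous_on UNIV m" using m by (rule C2E)
    have cont: "continuous_on (cbox (-L, a) (L, b)) (\<lambda>(s, u). ?f s u)"
      using osc_integrand_continuous[OF mc d _ phase_continuous[OF ph]] van v by simp
    have cont': "continuous_on (cbox (a, -L) (b, L)) (\<lambda>(u, s). ?f s u)"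
      using swap_continuous[OF cont] .
    have eq: "osc_integral m L a b j \<psi> \<psi>' \<tau> y v = integral {a..b} (\<lambda>u. integral {-L..L} (\<lambda>s. ?f s u))"
      using integral_swap_continuous[OF cont] by (simp add: osc_integral_def)
    have int: "(\<lambda>u. integral {-L..L} (\<lambda>s. ?f s u)) integrable_on {a..b}"
      using integral_integrable_2dim[OF cont'] by simp
    have M: "0 \<le> M" using bounded_Ck_nonneg[OF v ab] .
    have "norm (integral {-L..L} (\<lambda>s. ?f s u)) \<le> M * C / (1 + (\<tau> * (y - u))\<^sup>2)" if u: "u \<in> {a..b}" for u
    proof -
      have "(\<lambda>s. ?f s u) = (\<lambda>s. (v u * cis (\<tau> * \<psi> u)) *
          (of_real (m s / (s - \<psi>' u) ^ j) * cis (\<tau> * (y - u) * s)))"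
        by (rule ext) (simp add: cis_mult[symmetric] ring_distribs mult_ac)
      then have "norm (integral {-L..L} (\<lambda>s. ?f s u)) = norm (v u) *
          norm (integral {-L..L} (\<lambda>s. of_real (m s / (s - \<psi>' u) ^ j) * cis (\<tau> * (y - u) * s)))"
        by (simp only: integral_mult_right norm_mult norm_cis)
      also have "\<dots> \<le> M * (C / (1 + (\<tau> * (y - u))\<^sup>2))"
        using C u van v M by (intro mult_mono) auto
      finally show ?thesis by simp
    qed
    from kernel_integral_bound[OF ab \<tau> int _ this] M C(1) show ?thesis
      unfolding eq by (simp add: mult_ac)
  qed
  then show ?thesis using C(1) by (intro exI[of _ "C * pi"]) auto
qed

text \<open>The exponential has \<open>u\<close>-derivative
  \<open>\<i> * \<tau> * (\<psi>' u - s)\<close> times itself. Dividing the amplitude by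
  \<open>s - \<psi>' u\<close> and integrating by parts puts the derivative either on
  \<open>v\<close>, or on the \<open>Suc j\<close> equal denominators, which yields
  \<open>\<psi>''\<close> and one more denominator.\<close>

lemma osc_integral_recursion:
  assumes m: "C2 m" and d: "0 < d" and ab: "a \<le> b" and L: "0 \<le> L" and \<tau>: "0 < \<tau>"
    and \<psi>: "\<And>u. u \<in> {a..b} \<Longrightarrow> (\<psi> has_real_derivative \<psi>' u) (at u within {a..b})"
    and \<psi>': "\<And>u. u \<in> {a..b} \<Longrightarrow> (\<psi>' has_real_derivative \<psi>'' u) (at u within {a..b})"
    and c: "continuous_on {a..b} \<psi>''"
    and van: "\<And>s u. u \<in> {a..b} \<Longrightarrow> \<bar>s - \<psi>' u\<bar> < d \<Longrightarrow> m s = 0"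
    and v: "\<And>u. u \<in> {a..b} \<Longrightarrow> (v has_vector_derivative v' u) (at u within {a..b})"
    and v': "continuous_on {a..b} v'" and v0: "v a = 0" "v b = 0"
  shows "\<i> * of_real \<tau> * osc_integral m L a b j \<psi> \<psi>' \<tau> y v =
      osc_integral m L a b (Suc j) \<psi> \<psi>' \<tau> y v' +
      of_nat (Suc j) * osc_integral m L a b (Suc (Suc j)) \<psi> \<psi>' \<tau> y (\<lambda>u. v u * of_real (\<psi>'' u))"
proof -
  have mc: "continuous_on UNIV m" using m by (rule C2E)
  have cts: "continuous_on {a..b} \<psi>" "continuous_on {a..b} \<psi>'" "continuous_on {a..b} v"
    using DERIV_continuous_on \<psi> \<psi>' continuous_on_vector_derivative v by blast+
  define E where "E s u = cis (\<tau> * (\<psi> u + (y - u) * s))" for s u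
  define G where "G i w s = integral {a..b} (\<lambda>u. of_real (m s / (s - \<psi>' u) ^ i) * w u * E s u)" for i w s
  have J: "osc_integral m L a b i \<psi> \<psi>' \<tau> y w = integral {-L..L} (G i w)" for i w
    by (simp add: osc_integral_def G_def[abs_def] E_def)
  have vc: "continuous_on {a..b} (\<lambda>u. v u * of_real (\<psi>'' u))"
    using cts c by (intro continuous_intros)
  have int: "G i w integrable_on {-L..L}" if "continuous_on {a..b} w" for i w
    using integral_integrable_2dim[OF osc_integrand_continuous[OF mc d van cts(1,2) that]]
    by (simp add: G_def[abs_def] E_def)
  have cu: "continuous_on {a..b} (\<lambda>u. of_real (m s / (s - \<psi>' u) ^ i) * w u * E s u)"
    if "continuous_on {a..b} w" "\<And>u. u \<in> {a..b} \<Longrightarrow> s \<noteq> \<psi>' u" for i s w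
    unfolding E_def using that cts by (intro continuous_intros) auto
  have G: "\<i> * of_real \<tau> * G j v s = G (Suc j) v' s + of_nat (Suc j) * G (Suc (Suc j)) (\<lambda>u. v u * of_real (\<psi>'' u)) s" for s
  proof (cases "m s = 0")
    case True
    then show ?thesis by (simp add: G_def)
  next
    case False
    \<comment> \<open>A frequency with \<open>m s\<close> nonzero stays at distance at least
      \<open>d\<close> from every \<open>\<psi>' u\<close>, so none of the denominators below
      vanishes.\<close>
    then have ne: "s \<noteq> \<psi>' u" if "u \<in> {a..b}" for u using van[OF that, of s] d by auto
    \<comment> \<open>One denominator more than in the integrand; the derivative of the exponential
      supplies the factor that cancels it.\<close>
    define f where "f u = of_real (m s / (s - \<psi>' u) ^ Suc j) * v u" for u
    define f' where "f' u = of_real (m s / (s - \<psi>' u) ^ Suc j) * v' u +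
      of_nat (Suc j) * (of_real (m s / (s - \<psi>' u) ^ Suc (Suc j)) * (v u * of_real (\<psi>'' u)))" for u
    have q: "((\<lambda>u. m s / (s - \<psi>' u) ^ Suc j) has_real_derivative
        real (Suc j) * (m s * \<psi>'' u / (s - \<psi>' u) ^ Suc (Suc j))) (at u within {a..b})" if "u \<in> {a..b}" for u
    proof -
      have "((\<lambda>u. m s * inverse (s - \<psi>' u) ^ Suc j) has_real_derivative
          real (Suc j) * (m s * \<psi>'' u * inverse (s - \<psi>' u) ^ Suc (Suc j))) (at u within {a..b})"
        using ne[OF that] by (auto intro!: derivative_eq_intros \<psi>'[OF that] simp del: power_Suc)
          (simp add: algebra_simps)
      then show ?thesis by (simp only: divide_inverse power_inverse)
    qed
    have f: "(f has_vector_derivative f' u) (at u within {a..b})" if "u \<in> {a..b}" for u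
      using has_vector_derivative_mult[OF has_vector_derivative_of_real[OF q[OF that]] v[OF that]]
      unfolding f_def[abs_def] f'_def by (simp add: mult_ac)
    have e: "(E s has_vector_derivative \<i> * of_real (\<tau> * (\<psi>' u - s)) * E s u) (at u within {a..b})" if "u \<in> {a..b}" for u
      unfolding E_def[abs_def]
      by (rule has_vector_derivative_cis) (auto intro!: derivative_eq_intros \<psi>[OF that])
    have cf': "continuous_on {a..b} f'"
      unfolding f'_def using cts v' c ne by (intro continuous_intros) auto
    have cE: "continuous_on {a..b} (E s)"
      unfolding E_def[abs_def] using cts by (intro continuous_intros)
    have "integral {a..b} (\<lambda>u. f u * (\<i> * of_real (\<tau> * (\<psi>' u - s)) * E s u)) = - integral {a..b} (\<lambda>u. f' u * E s u)"
      by (subst integral_by_parts_complex[OF ab f e cf'])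
        (use cts cE v0 in \<open>auto intro!: continuous_intros simp: f_def\<close>)
    moreover have "integral {a..b} (\<lambda>u. f u * (\<i> * of_real (\<tau> * (\<psi>' u - s)) * E s u)) = - (\<i> * of_real \<tau> * G j v s)"
    proof -
      have "f u * (\<i> * of_real (\<tau> * (\<psi>' u - s)) * E s u) =
          - (\<i> * of_real \<tau>) * (of_real (m s / (s - \<psi>' u) ^ j) * v u * E s u)" if "u \<in> {a..b}" for u
        using ne[OF that] by (simp add: f_def field_simps)
      then have "integral {a..b} (\<lambda>u. f u * (\<i> * of_real (\<tau> * (\<psi>' u - s)) * E s u)) =
          integral {a..b} (\<lambda>u. - (\<i> * of_real \<tau>) * (of_real (m s / (s - \<psi>' u) ^ j) * v u * E s u))"
        by (intro integral_cong)
      then show ?thesis by (simp only: integral_mult_right G_def) simp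
    qed
    moreover have "integral {a..b} (\<lambda>u. f' u * E s u) =
        G (Suc j) v' s + of_nat (Suc j) * G (Suc (Suc j)) (\<lambda>u. v u * of_real (\<psi>'' u)) s"
    proof -
      have "(\<lambda>u. f' u * E s u) = (\<lambda>u. of_real (m s / (s - \<psi>' u) ^ Suc j) * v' u * E s u + of_nat (Suc j) *
        (of_real (m s / (s - \<psi>' u) ^ Suc (Suc j)) * (v u * of_real (\<psi>'' u)) * E s u))"
        by (rule ext) (simp add: f'_def algebra_simps)
      moreover have i1: "(\<lambda>u. of_real (m s / (s - \<psi>' u) ^ Suc j) * v' u * E s u) integrable_on {a..b}"
        by (rule integrable_continuous_real, rule cu[OF v' ne])
      moreover have i2: "(\<lambda>u. of_real (m s / (s - \<psi>' u) ^ Suc (Suc j)) * (v u * of_real (\<psi>'' u)) * E s u)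
          integrable_on {a..b}"
        by (rule integrable_continuous_real, rule cu[OF vc ne])
      ultimately show ?thesis
        by (simp only: G_def integral_add[OF i1 integrable_on_mult_right[OF i2]] integral_mult_right)
    qed
    ultimately show ?thesis by (metis minus_minus)
  qed
  have "\<i> * of_real \<tau> * integral {-L..L} (G j v) = integral {-L..L} (\<lambda>s. \<i> * of_real \<tau> * G j v s)"
    by simp
  also have "\<dots> = integral {-L..L} (\<lambda>s. G (Suc j) v' s + of_nat (Suc j) * G (Suc (Suc j)) (\<lambda>u. v u * of_real (\<psi>'' u)) s)"
    by (simp only: G)
  also have "\<dots> = integral {-L..L} (G (Suc j) v') + of_nat (Suc j) * integral {-L..L} (G (Suc (Suc j)) (\<lambda>u. v u * of_real (\<psi>'' u)))"
    using int[OF v'] int[OF vc] by (subst integral_add) (auto intro!: integrable_on_mult_right)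
  finally show ?thesis unfolding J .
qed

text \<open>Each integration by parts trades one derivative of \<open>v\<close> for a factor \<open>1 / \<tau>\<close>; integrating in the
  frequency \<open>s\<close> first in the end gains the last such factor without a further derivative of \<open>v\<close>.\<close>

lemma osc_integral_bound:
  assumes m: "C2 m" and z: "\<And>s. L0 \<le> \<bar>s\<bar> \<Longrightarrow> m s = 0" and L0: "0 \<le> L0" "L0 < L"
    and d: "0 < d" and ab: "a \<le> b" and N: "0 \<le> N"
  shows "\<exists>C\<ge>0. \<forall>\<psi> \<psi>' \<tau> y v M. phase a b k N \<psi> \<psi>' \<longrightarrow>
      (\<forall>u\<in>{a..b}. \<forall>s. \<bar>s - \<psi>' u\<bar> < d \<longrightarrow> m s = 0) \<longrightarrow> 0 < \<tau> \<longrightarrow> bounded_Ck a b True k M v \<longrightarrow>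
      norm (osc_integral m L a b j \<psi> \<psi>' \<tau> y v) \<le> C * M / \<tau> ^ Suc k"
\<comment> \<open>The recursion raises the number of denominators by one or two, so the induction
  hypothesis must cover all \<open>j\<close>.\<close>
proof (induction k arbitrary: j)
  case 0
  show ?case using osc_integral_bound_0[OF m z L0 d ab, of j] by (simp del: bounded_Ck.simps) blast
next
  case (Suc k)
  let ?P = "\<lambda>j C. \<forall>\<psi> \<psi>' \<tau> y v M. phase a b k N \<psi> \<psi>' \<longrightarrow>
      (\<forall>u\<in>{a..b}. \<forall>s. \<bar>s - \<psi>' u\<bar> < d \<longrightarrow> m s = 0) \<longrightarrow> 0 < \<tau> \<longrightarrow> bounded_Ck a b True k M v \<longrightarrow>
      norm (osc_integral m L a b j \<psi> \<psi>' \<tau> y v) \<le> C * M / \<tau> ^ Suc k"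
  obtain C1 where C1: "0 \<le> C1" "?P (Suc j) C1" using Suc.IH[of "Suc j"] by blast
  obtain C' where C': "0 \<le> C'" "?P (Suc (Suc j)) C'" using Suc.IH[of "Suc (Suc j)"] by blast
  \<comment> \<open>\<open>C1\<close> belongs to the term with \<open>v'\<close>. The other term has
    the amplitude \<open>v * \<psi>''\<close>, whose bound \<open>2 ^ k * M * N\<close> comes from
    the product rule.\<close>
  define C where "C = C1 + real (Suc j) * (C' * (2 ^ k * N))"
  have "norm (osc_integral m L a b j \<psi> \<psi>' \<tau> y v) \<le> C * M / \<tau> ^ Suc (Suc k)"
    if ph: "phase a b (Suc k) N \<psi> \<psi>'" and van: "\<forall>u\<in>{a..b}. \<forall>s. \<bar>s - \<psi>' u\<bar> < d \<longrightarrow> m s = 0"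
      and \<tau>: "0 < \<tau>" and v: "bounded_Ck a b True (Suc k) M v" for \<psi> \<psi>' \<tau> y v M
  proof -
    obtain \<psi>'' where \<psi>: "\<And>u. u \<in> {a..b} \<Longrightarrow> (\<psi> has_real_derivative \<psi>' u) (at u within {a..b})"
      "\<And>u. u \<in> {a..b} \<Longrightarrow> (\<psi>' has_real_derivative \<psi>'' u) (at u within {a..b})"
      and b: "bounded_Ck a b False (Suc k) N (\<lambda>u. of_real (\<psi>'' u))"
      using ph unfolding phase_def by blast
    note bk = bounded_Ck_Suc[OF b]
    have phk: "phase a b k N \<psi> \<psi>'" unfolding phase_def using \<psi> bk by blast
    have "continuous_on {a..b} (\<lambda>u. Re (of_real (\<psi>'' u)))"
      using bounded_Ck_0[OF b] by (intro continuous_intros) simp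
    then have c: "continuous_on {a..b} \<psi>''" by simp
    obtain v' where v': "bounded_Ck a b True 0 M v" "bounded_Ck a b True k M v'"
      "\<And>u. u \<in> {a..b} \<Longrightarrow> (v has_vector_derivative v' u) (at u within {a..b})"
      using v by (rule bounded_Ck_SucE) blast
    have L: "0 \<le> L" using L0 by simp
    have vz: "v a = 0" "v b = 0" using v'(1) by auto
    have v'c: "continuous_on {a..b} v'" using bounded_Ck_0[OF v'(2)] by simp
    have rec: "\<i> * of_real \<tau> * osc_integral m L a b j \<psi> \<psi>' \<tau> y v =
      osc_integral m L a b (Suc j) \<psi> \<psi>' \<tau> y v' +
      of_nat (Suc j) * osc_integral m L a b (Suc (Suc j)) \<psi> \<psi>' \<tau> y (\<lambda>u. v u * of_real (\<psi>'' u))"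
      by (rule osc_integral_recursion[OF m d ab L \<tau> \<psi> c _ v'(3) v'c vz]) (use van in auto)
    have b1: "norm (osc_integral m L a b (Suc j) \<psi> \<psi>' \<tau> y v') \<le> C1 * M / \<tau> ^ Suc k"
      using C1(2) phk van \<tau> v'(2) by blast
    have b2: "norm (osc_integral m L a b (Suc (Suc j)) \<psi> \<psi>' \<tau> y (\<lambda>u. v u * of_real (\<psi>'' u)))
        \<le> C' * (2 ^ k * M * N) / \<tau> ^ Suc k"
      using C'(2) phk van \<tau> bounded_Ck_mult[OF ab bounded_Ck_Suc[OF v] bk] by blast
    have "\<tau> * norm (osc_integral m L a b j \<psi> \<psi>' \<tau> y v) = norm (\<i> * of_real \<tau> * osc_integral m L a b j \<psi> \<psi>' \<tau> y v)"
      using \<tau> by (simp add: norm_mult)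
    also have "\<dots> \<le> norm (osc_integral m L a b (Suc j) \<psi> \<psi>' \<tau> y v') +
        real (Suc j) * norm (osc_integral m L a b (Suc (Suc j)) \<psi> \<psi>' \<tau> y (\<lambda>u. v u * of_real (\<psi>'' u)))"
      unfolding rec by (rule order_trans[OF norm_triangle_ineq]) (simp only: norm_mult norm_of_nat order_refl)
    also have "\<dots> \<le> C1 * M / \<tau> ^ Suc k + real (Suc j) * (C' * (2 ^ k * M * N) / \<tau> ^ Suc k)"
      by (intro add_mono mult_left_mono b1 b2) simp
    also have "\<dots> = C * M / \<tau> ^ Suc k"
      by (simp add: C_def add_divide_distrib ring_distribs mult_ac)
    finally have "norm (osc_integral m L a b j \<psi> \<psi>' \<tau> y v) \<le> (C * M / \<tau> ^ Suc k) / \<tau>"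
      using \<tau> by (simp add: pos_le_divide_eq mult_ac)
    then show ?thesis by (simp add: mult.commute)
  qed
  moreover have "0 \<le> C" using C1(1) C'(1) N by (simp add: C_def)
  ultimately show ?case by blast
qed

subsection \<open>An approximate identity with compact frequency support\<close>

text \<open>The weight \<open>h (X n * (y - u))\<close> tends to \<open>c\<close> times the sign of
  \<open>y - u\<close>. Integrating \<open>f'\<close> against that step gives \<open>f y\<close>
  from the left and again from the right, because \<open>f\<close> vanishes at both ends.\<close>

lemma approximate_sign_limit:
  fixes f f' :: "real \<Rightarrow> 'a::euclidean_space"
  assumes ab: "a \<le> b" and f: "\<And>u. u \<in> {a..b} \<Longrightarrow> (f has_vector_derivative f' u) (at u within {a..b})"
    and f': "continuous_on {a..b} f'" and f0: "f a = 0" "f b = 0"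
    and h: "continuous_on UNIV h" "\<And>w. \<bar>h w\<bar> \<le> H" "(h \<longlongrightarrow> c) at_top" "(h \<longlongrightarrow> -c) at_bot"
    and X: "filterlim X at_top sequentially"
  shows "(\<lambda>n. integral {a..b} (\<lambda>u. h (X n * (y - u)) *\<^sub>R f' u)) \<longlonglongrightarrow>
    (2 * c) *\<^sub>R (if y \<in> {a..b} then f y else 0)"
proof -
  define g where "g u = (if u < y then c else if y < u then - c else h 0) *\<^sub>R f' u" for u
  \<comment> \<open>The projection of \<open>y\<close> to the interval: for \<open>y\<close> outside
    it \<open>p\<close> is an end, where \<open>f\<close> is 0, so the three positions of
    \<open>y\<close> are treated together.\<close>
  define p where "p = max a (min b y)"
  have p: "a \<le> p" "p \<le> b" using ab by (auto simp: p_def)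
  have F: "(f' has_integral f t - f s) {s..t}" if "a \<le> s" "s \<le> t" "t \<le> b" for s t
    using that by (intro fundamental_theorem_of_calculus has_vector_derivative_within_subset[OF f]) auto
  have "(g has_integral c *\<^sub>R (f p - f a)) {a..p}"
    by (rule has_integral_spike_finite[of "{p}", OF _ _ has_integral_cmul[OF F]])
      (use p ab in \<open>auto simp: g_def p_def max_def min_def split: if_splits\<close>)
  moreover have "(g has_integral (- c) *\<^sub>R (f b - f p)) {p..b}"
    by (rule has_integral_spike_finite[of "{p}", OF _ _ has_integral_cmul[OF F]])
      (use p ab in \<open>auto simp: g_def p_def max_def min_def split: if_splits\<close>)
  ultimately have "(g has_integral c *\<^sub>R (f p - f a) + (- c) *\<^sub>R (f b - f p)) {a..b}"
    by (rule has_integral_combine[OF p])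
  moreover have "f p = (if y \<in> {a..b} then f y else 0)"
    using f0 ab by (auto simp: p_def max_def min_def)
  ultimately have g: "integral {a..b} g = (2 * c) *\<^sub>R (if y \<in> {a..b} then f y else 0)"
    using f0 by (simp add: integral_unique scaleR_2 algebra_simps flip: scaleR_add_left)
  have "(\<lambda>n. integral {a..b} (\<lambda>u. h (X n * (y - u)) *\<^sub>R f' u)) \<longlonglongrightarrow> integral {a..b} g"
  proof (rule dominated_convergence)
    show "(\<lambda>u. h (X n * (y - u)) *\<^sub>R f' u) integrable_on {a..b}" for n
      by (intro integrable_continuous_real continuous_intros f' continuous_on_compose2[OF h(1)]) auto
    show "(\<lambda>u. H * norm (f' u)) integrable_on {a..b}"
      by (intro integrable_continuous_real continuous_intros f')
    show "norm (h (X n * (y - u)) *\<^sub>R f' u) \<le> H * norm (f' u)" for n u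
      using h(2) by (auto intro: mult_right_mono)
    show "(\<lambda>n. h (X n * (y - u)) *\<^sub>R f' u) \<longlonglongrightarrow> g u" for u
    proof -
      consider "u < y" | "y < u" | "u = y" by linarith
      then have "(\<lambda>n. h (X n * (y - u))) \<longlonglongrightarrow> (if u < y then c else if y < u then - c else h 0)"
      proof cases
        case 1
        then have "filterlim (\<lambda>n. X n * (y - u)) at_top sequentially"
          by (intro filterlim_at_top_mult_tendsto_pos[OF tendsto_const _ X]) auto
        from filterlim_compose[OF h(3) this] 1 show ?thesis by simp
      next
        case 2
        then have "filterlim (\<lambda>n. X n * (y - u)) at_bot sequentially"
          using filterlim_tendsto_neg_mult_at_bot[OF tendsto_const[of "y - u"] _ X] by (simp add: mult.commute)
        from filterlim_compose[OF h(4) this] 2 show ?thesis by simp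
      qed simp
      then show ?thesis unfolding g_def by (intro tendsto_intros)
    qed
  qed
  then show ?thesis unfolding g .
qed

definition fourier_kernel :: "(real \<Rightarrow> real) \<Rightarrow> real \<Rightarrow> real \<Rightarrow> complex" where
  "fourier_kernel m L w = integral {-L..L} (\<lambda>s. of_real (m s) * cis (w * s))"

lemma fourier_kernel_continuous:
  assumes "continuous_on UNIV m"
  shows "continuous_on UNIV (fourier_kernel m L)"
proof -
  have "continuous_on (UNIV \<times> cbox (-L) L) (\<lambda>(w, s). of_real (m s) * cis (w * s))"
    unfolding case_prod_beta by (intro continuous_intros continuous_on_compose2[OF assms]) auto
  from integral_continuous_on_param[OF this] show ?thesis
    unfolding fourier_kernel_def[abs_def] by simp
qed

lemma Si_minus: "Si (- x) = - Si x"
  using Si_neg[of x] Si_neg[of "- x"] by (cases "0 \<le> x") auto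

lemma fourier_kernel_even:
  assumes "continuous_on UNIV m" "\<And>s. m (-s) = m s"
  shows "fourier_kernel m L w = of_real (integral {-L..L} (\<lambda>s. m s * cos (w * s)))"
proof -
  have i: "(\<lambda>s. of_real (m s) * cis (w * s)) integrable_on {-L..L}" for w
    by (intro integrable_continuous_real continuous_intros continuous_on_subset[OF assms(1)]) auto
  have "fourier_kernel m L w = integral {-L..L} (\<lambda>s. of_real (m s) * cis (- w * s))"
    using Henstock_Kurzweil_Integration.integral_reflect_real[of L "-L" "\<lambda>s. of_real (m s) * cis (w * s)"] assms(2) by (simp add: fourier_kernel_def)
  then have "fourier_kernel m L w + fourier_kernel m L w =
      integral {-L..L} (\<lambda>s. of_real (m s) * cis (w * s) + of_real (m s) * cis (- w * s))"
    using integral_add[OF i[of w] i[of "-w"]] by (simp add: fourier_kernel_def)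
  also have "\<dots> = integral {-L..L} (\<lambda>s. 2 * of_real (m s * cos (w * s)))"
    by (intro integral_cong) (simp add: complex_eq_iff)
  also have "\<dots> = 2 * integral {-L..L} (\<lambda>s. of_real (m s * cos (w * s)))"
    by (rule integral_mult_right)
  also have "integral {-L..L} (\<lambda>s. of_real (m s * cos (w * s)) :: complex) =
      of_real (integral {-L..L} (\<lambda>s. m s * cos (w * s)))"
    using assms(1)
    by (intro integral_unique has_integral_of_real integrable_integral integrable_continuous_real
        continuous_intros) (auto intro: continuous_on_subset)
  finally show ?thesis by simp
qed

text \<open>The primitive of an even kernel is an average of sine integrals, which gives its limits
  \<open>\<plusminus> pi * \<Theta> 0\<close>; this replaces the Fourier inversion theorem.\<close>

lemma fourier_kernel_primitive:
  assumes \<Theta>: "C2 \<Theta>" and z: "\<And>s. L0 \<le> \<bar>s\<bar> \<Longrightarrow> \<Theta> s = 0" and L0: "0 \<le> L0" "L0 < L"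
    and even: "\<And>s. \<Theta> (-s) = \<Theta> s"
  obtains Q H where "\<And>w. (Q has_real_derivative Re (fourier_kernel \<Theta> L w)) (at w)" "\<And>w. \<bar>Q w\<bar> \<le> H"
    "(Q \<longlongrightarrow> pi * \<Theta> 0) at_top" "(Q \<longlongrightarrow> - (pi * \<Theta> 0)) at_bot"
proof -
  obtain \<Theta>' \<Theta>'' where d: "\<And>s. (\<Theta> has_real_derivative \<Theta>' s) (at s)"
    and c: "continuous_on UNIV \<Theta>'" "continuous_on UNIV \<Theta>"
    using \<Theta> by (rule C2E) blast
  obtain B where B: "\<And>w. \<bar>Si w\<bar> \<le> B" using bounded_Si by blast
  have Sc: "continuous_on UNIV Si" by (simp add: continuous_at_imp_continuous_on isCont_Si)
  note Sic = continuous_on_compose2[OF Sc]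
  have c': "continuous_on A \<Theta>'" "continuous_on A \<Theta>" for A using c continuous_on_subset by blast+
  have zL: "\<Theta> L = 0" "\<Theta> (-L) = 0" using z L0 by auto
  \<comment> \<open>The primitive in \<open>w\<close> is the integral of
    \<open>\<Theta> s * sin (w * s) / s\<close>. As \<open>sin (w * s) / s\<close> is the
    \<open>s\<close>-derivative of \<open>Si (w * s)\<close>, integration by parts puts it into this
    form without a quotient.\<close>
  define Q where "Q w = integral {-L..L} (\<lambda>s. - (Si (w * s) * \<Theta>' s))" for w
  have odd: "Q (-w) = - Q w" for w by (simp add: Q_def Si_minus)
  have "(Q has_real_derivative Re (fourier_kernel \<Theta> L w)) (at w)" for w
  proof -
    have "((\<lambda>w. integral (cbox (-L) L) (\<lambda>s. - (Si (w * s) * \<Theta>' s))) has_real_derivative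
        integral (cbox (-L) L) (\<lambda>s. - (sinc (w * s) * s * \<Theta>' s))) (at w within UNIV)"
    proof (rule leibniz_rule_field_derivative)
      show "((\<lambda>w. - (Si (w * s) * \<Theta>' s)) has_real_derivative - (sinc (w * s) * s * \<Theta>' s)) (at w within UNIV)" for w s
        by (auto intro!: derivative_eq_intros DERIV_chain2[OF DERIV_Si] simp: mult_ac simp del: mult_eq_0_iff)
      show "(\<lambda>s. - (Si (w * s) * \<Theta>' s)) integrable_on cbox (-L) L" for w
        unfolding box_real by (intro integrable_continuous_real continuous_intros Sic c') auto
      have sc: "continuous_on UNIV sinc" using isCont_sinc by (intro continuous_at_imp_continuous_on ballI)
      show "continuous_on (UNIV \<times> cbox (-L) L) (\<lambda>(w, s). - (sinc (w * s) * s * \<Theta>' s))"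
        unfolding case_prod_beta
        by (intro continuous_intros continuous_on_compose2[OF sc] continuous_on_compose2[OF c(1)]) auto
    qed auto
    moreover have "integral {-L..L} (\<lambda>s. - (sinc (w * s) * s * \<Theta>' s)) = integral {-L..L} (\<lambda>s. \<Theta> s * cos (w * s))"
    proof -
      \<comment> \<open>The primitive of \<open>cos (w * s)\<close> in \<open>s\<close> that
        vanishes at 0, with \<open>w = 0\<close> included.\<close>
      define \<sigma> where "\<sigma> s = (if w = 0 then s else sin (w * s) / w)" for s
      have \<sigma>: "sinc (w * s) * s = \<sigma> s" for s by (auto simp: \<sigma>_def)
      have d\<sigma>: "(\<sigma> has_real_derivative cos (w * s)) (at s)" for s
        unfolding \<sigma>_def by (cases "w = 0") (auto intro!: derivative_eq_intros)
      have "((\<lambda>s. \<Theta>' s * \<sigma> s + cos (w * s) * \<Theta> s) has_integral \<Theta> L * \<sigma> L - \<Theta> (-L) * \<sigma> (-L)) {-L..L}"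
      proof (rule fundamental_theorem_of_calculus)
        show "((\<lambda>s. \<Theta> s * \<sigma> s) has_vector_derivative \<Theta>' s * \<sigma> s + cos (w * s) * \<Theta> s) (at s within {-L..L})" for s
          using has_field_derivative_at_within[OF DERIV_mult[OF d d\<sigma>]]
          by (simp add: has_real_derivative_iff_has_vector_derivative)
      qed (use L0 in simp)
      moreover have "((\<lambda>s. \<Theta> s * cos (w * s)) has_integral integral {-L..L} (\<lambda>s. \<Theta> s * cos (w * s))) {-L..L}"
        by (intro integrable_integral integrable_continuous_real continuous_intros c')
      ultimately have "((\<lambda>s. \<Theta> s * cos (w * s) - (\<Theta>' s * \<sigma> s + cos (w * s) * \<Theta> s)) has_integral
          integral {-L..L} (\<lambda>s. \<Theta> s * cos (w * s)) - 0) {-L..L}"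
        using zL by (intro has_integral_diff) auto
      then show ?thesis unfolding \<sigma> by (intro integral_unique) (simp add: mult.commute)
    qed
    ultimately show ?thesis unfolding Q_def[abs_def] by (simp add: fourier_kernel_even[OF c(2) even])
  qed
  moreover have "\<bar>Q w\<bar> \<le> integral {-L..L} (\<lambda>s. B * \<bar>\<Theta>' s\<bar>)" for w
  proof -
    have "norm (Q w) \<le> integral {-L..L} (\<lambda>s. B * \<bar>\<Theta>' s\<bar>)" unfolding Q_def
      by (rule integral_norm_bound_integral)
        (auto intro!: integrable_continuous_real continuous_intros Sic c' mult_right_mono B simp: abs_mult)
    then show ?thesis by simp
  qed
  moreover have lim: "(Q \<longlongrightarrow> pi * \<Theta> 0) at_top"
  proof (rule tendsto_at_topI_sequentially)
    fix X :: "nat \<Rightarrow> real" assume X: "filterlim X at_top sequentially"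
    have b: "(Si \<longlongrightarrow> - (pi / 2)) at_bot"
      using tendsto_minus[OF filterlim_compose[OF Si_at_top filterlim_uminus_at_top_at_bot]] by (simp add: Si_minus)
    \<comment> \<open>The sign limit with \<open>h = Si\<close>, \<open>f = \<Theta>\<close> and
      \<open>y = 0\<close>: \<open>Si\<close> tends to \<open>pi / 2\<close> and
      \<open>- (pi / 2)\<close>, and the argument \<open>0 - s\<close> accounts for the minus sign
      in \<open>Q\<close>.\<close>
    have "(\<lambda>n. integral {-L..L} (\<lambda>s. Si (X n * (0 - s)) *\<^sub>R \<Theta>' s)) \<longlonglongrightarrow>
        (2 * (pi / 2)) *\<^sub>R (if 0 \<in> {-L..L} then \<Theta> 0 else 0)"
    proof (rule approximate_sign_limit[OF _ _ c'(1) _ _ Sc B Si_at_top b X])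
      show "(\<Theta> has_vector_derivative \<Theta>' s) (at s within {-L..L})" for s
        using has_field_derivative_at_within[OF d] by (simp add: has_real_derivative_iff_has_vector_derivative)
    qed (use L0 zL in auto)
    then show "(\<lambda>n. Q (X n)) \<longlonglongrightarrow> pi * \<Theta> 0"
      using L0 by (simp add: Q_def Si_minus)
  qed
  moreover have "(Q \<longlongrightarrow> - (pi * \<Theta> 0)) at_bot"
    using tendsto_minus[OF filterlim_compose[OF lim filterlim_uminus_at_top_at_bot]] by (simp add: odd)
  ultimately show ?thesis by (rule that)
qed

text \<open>Integration by parts trades the kernel for its primitive \<open>Q\<close>, evaluated at
  \<open>X n * (y - u)\<close>. Its limits \<open>pi\<close> and \<open>- pi\<close> make it an
  approximate sign, and the constant \<open>2 * pi\<close> of Fourier inversion is the jump between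
  them.\<close>

lemma approximate_identity:
  fixes F :: "real \<Rightarrow> complex"
  assumes \<Theta>: "C2 \<Theta>" and z: "\<And>s. L0 \<le> \<bar>s\<bar> \<Longrightarrow> \<Theta> s = 0" and L0: "0 \<le> L0" "L0 < L"
    and even: "\<And>s. \<Theta> (-s) = \<Theta> s" and one: "\<Theta> 0 = 1"
    and ab: "a \<le> b" and F: "\<And>u. u \<in> {a..b} \<Longrightarrow> (F has_vector_derivative F' u) (at u within {a..b})"
    and F': "continuous_on {a..b} F'" and F0: "F a = 0" "F b = 0"
    and X: "filterlim X at_top sequentially"
  shows "(\<lambda>n. of_real (X n) * integral {a..b} (\<lambda>u. F u * fourier_kernel \<Theta> L (X n * (y - u)))) \<longlonglongrightarrow>
    2 * of_real pi * (if y \<in> {a..b} then F y else 0)"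
proof -
  have c\<Theta>: "continuous_on UNIV \<Theta>" using \<Theta> by (rule C2E)
  obtain Q H where Q: "\<And>w. (Q has_real_derivative Re (fourier_kernel \<Theta> L w)) (at w)" "\<And>w. \<bar>Q w\<bar> \<le> H"
    "(Q \<longlongrightarrow> pi * \<Theta> 0) at_top" "(Q \<longlongrightarrow> - (pi * \<Theta> 0)) at_bot"
    using fourier_kernel_primitive[OF \<Theta> z L0 even] by blast
  note Kc = continuous_on_compose2[OF fourier_kernel_continuous[OF c\<Theta>]]
  have K: "fourier_kernel \<Theta> L w = of_real (Re (fourier_kernel \<Theta> L w))" for w
    by (subst (1 2) fourier_kernel_even[OF c\<Theta> even]) simp
  have Qc: "continuous_on UNIV Q" using Q(1) by (intro DERIV_continuous_on) auto
  have eq: "of_real \<tau> * integral {a..b} (\<lambda>u. F u * fourier_kernel \<Theta> L (\<tau> * (y - u))) =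
      integral {a..b} (\<lambda>u. Q (\<tau> * (y - u)) *\<^sub>R F' u)" for \<tau>
  proof -
    have e: "((\<lambda>u. of_real (Q (\<tau> * (y - u))) :: complex) has_vector_derivative
        of_real (- \<tau> * Re (fourier_kernel \<Theta> L (\<tau> * (y - u))))) (at u within {a..b})" for u
    proof -
      have "((\<lambda>u. \<tau> * (y - u)) has_real_derivative - \<tau>) (at u within {a..b})"
        by (auto intro!: derivative_eq_intros)
      from DERIV_chain2[OF Q(1) this] show ?thesis
        by (intro has_vector_derivative_of_real) (simp add: mult.commute)
    qed
    have "integral {a..b} (\<lambda>u. F u * of_real (- \<tau> * Re (fourier_kernel \<Theta> L (\<tau> * (y - u))))) =
        - integral {a..b} (\<lambda>u. F' u * of_real (Q (\<tau> * (y - u))))"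
      by (subst integral_by_parts_complex[OF ab F e F'])
        (use F0 in \<open>auto intro!: continuous_intros Kc\<close>)
    moreover have "integral {a..b} (\<lambda>u. F u * of_real (- \<tau> * Re (fourier_kernel \<Theta> L (\<tau> * (y - u))))) =
        integral {a..b} (\<lambda>u. (- of_real \<tau>) * (F u * fourier_kernel \<Theta> L (\<tau> * (y - u))))"
      by (subst K) (simp add: mult_ac)
    ultimately show ?thesis
      by (simp add: scaleR_conv_of_real mult.commute)
  qed
  have "(\<lambda>n. integral {a..b} (\<lambda>u. Q (X n * (y - u)) *\<^sub>R F' u)) \<longlonglongrightarrow>
      (2 * (pi * \<Theta> 0)) *\<^sub>R (if y \<in> {a..b} then F y else 0)"
    by (rule approximate_sign_limit[OF ab F F' F0 Qc Q(2,3,4) X])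
  then show ?thesis unfolding eq by (simp add: one scaleR_conv_of_real)
qed

text \<open>A change of variables; \<open>2 * r \<le> L\<close> ensures that the same window
  \<open>{-L..L}\<close> contains the support of the cutoff and of its dilate.\<close>

lemma fourier_kernel_dilate:
  assumes c: "continuous_on UNIV \<Theta>" and z: "\<And>s. r \<le> \<bar>s\<bar> \<Longrightarrow> \<Theta> s = 0" and L: "2 * r \<le> L" "0 \<le> L"
  shows "fourier_kernel (\<lambda>s. \<Theta> (s / 2)) L w = 2 * fourier_kernel \<Theta> L (2 * w)"
proof -
  let ?f = "\<lambda>s. of_real (\<Theta> (s / 2)) * cis (w * s)"
  have "(?f has_integral fourier_kernel (\<lambda>s. \<Theta> (s / 2)) L w) {-L..L}"
    unfolding fourier_kernel_def
    by (intro integrable_integral integrable_continuous_real continuous_intros continuous_on_compose2[OF c]) auto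
  from has_integral_stretch_real[OF this, of 2]
  have "((\<lambda>s. ?f (2 * s)) has_integral (1 / 2) *\<^sub>R fourier_kernel (\<lambda>s. \<Theta> (s / 2)) L w) {-L/2..L/2}"
    using L by (simp add: image_divide_atLeastAtMost)
  then have "((\<lambda>s. ?f (2 * s)) has_integral (1 / 2) *\<^sub>R fourier_kernel (\<lambda>s. \<Theta> (s / 2)) L w) {-L..L}"
    by (rule has_integral_on_superset) (use L in \<open>auto intro!: z\<close>)
  then have "fourier_kernel \<Theta> L (2 * w) = (1 / 2) *\<^sub>R fourier_kernel (\<lambda>s. \<Theta> (s / 2)) L w"
    unfolding fourier_kernel_def by (intro integral_unique) (simp add: mult_ac)
  then show ?thesis by (simp add: scaleR_conv_of_real mult.commute[of _ 2])
qed

lemma fourier_kernel_diff: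
  assumes "continuous_on UNIV m" "continuous_on UNIV n"
  shows "fourier_kernel (\<lambda>s. m s - n s) L w = fourier_kernel m L w - fourier_kernel n L w"
  unfolding fourier_kernel_def
  by (subst integral_diff[symmetric])
    (auto intro!: integrable_continuous_real continuous_intros continuous_on_subset[OF assms(1)]
      continuous_on_subset[OF assms(2)] simp: algebra_simps)

text \<open>With the \<open>s\<close>-integral carried out, the cutoff enters only through its
  kernel. In this form different cutoffs are subtracted and different scales compared.\<close>

lemma osc_integral_0:
  assumes m: "continuous_on UNIV m" and c: "continuous_on {a..b} \<psi>" "continuous_on {a..b} v"
  shows "osc_integral m L a b 0 \<psi> \<psi>' \<tau> y v =
    integral {a..b} (\<lambda>u. v u * cis (\<tau> * \<psi> u) * fourier_kernel m L (\<tau> * (y - u)))"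
proof -
  let ?f = "\<lambda>s u. of_real (m s) * v u * cis (\<tau> * (\<psi> u + (y - u) * s))"
  have "continuous_on ({-L..L} \<times> {a..b}) (\<lambda>p. ?f (fst p) (snd p))"
    by (intro continuous_intros continuous_on_compose2[OF m] continuous_on_compose2[OF c(1)]
        continuous_on_compose2[OF c(2)]) auto
  then have "continuous_on (cbox (-L, a) (L, b)) (\<lambda>(s, u). ?f s u)"
    by (simp add: cbox_Pair_eq case_prod_beta)
  from integral_swap_continuous[OF this]
  have "osc_integral m L a b 0 \<psi> \<psi>' \<tau> y v = integral {a..b} (\<lambda>u. integral {-L..L} (\<lambda>s. ?f s u))"
    by (simp add: osc_integral_def)
  moreover have "integral {-L..L} (\<lambda>s. ?f s u) = v u * cis (\<tau> * \<psi> u) * fourier_kernel m L (\<tau> * (y - u))" for u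
  proof -
    have "(\<lambda>s. ?f s u) = (\<lambda>s. (v u * cis (\<tau> * \<psi> u)) * (of_real (m s) * cis (\<tau> * (y - u) * s)))"
      by (rule ext) (simp add: cis_mult[symmetric] ring_distribs mult_ac)
    then show ?thesis by (simp only: integral_mult_right fourier_kernel_def)
  qed
  ultimately show ?thesis by simp
qed

subsection \<open>Frequency localization\<close>

lemma bounded_Ck_cmult:
  "bounded_Ck a b z k M v \<Longrightarrow> bounded_Ck a b z k (norm c * M) (\<lambda>u. c * v u)"
proof (induction k arbitrary: v)
  case 0
  then show ?case by (auto intro!: continuous_intros mult_left_mono simp: norm_mult)
next
  case (Suc k)
  obtain v' where v': "bounded_Ck a b z 0 M v" "bounded_Ck a b z k M v'"
    "\<And>u. u \<in> {a..b} \<Longrightarrow> (v has_vector_derivative v' u) (at u within {a..b})"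
    using Suc.prems(1) by (rule bounded_Ck_SucE) blast
  have "bounded_Ck a b z 0 (norm c * M) (\<lambda>u. c * v u)"
    using v'(1) by (auto intro!: continuous_intros mult_left_mono simp: norm_mult)
  then show ?case
    by (rule bounded_Ck_SucI[OF _ Suc.IH[OF v'(2)]]) (rule has_vector_derivative_mult_right[OF v'(3)])
qed

text \<open>Dyadic scales replace the phase by \<open>2 ^ -n\<close> times itself; since the
  derivative bounds survive, one constant serves for all scales.\<close>

lemma phase_scale:
  assumes ph: "phase a b k N \<psi> \<psi>'" and r: "\<bar>r\<bar> \<le> 1" and N: "0 \<le> N"
  shows "phase a b k N (\<lambda>u. r * \<psi> u) (\<lambda>u. r * \<psi>' u)"
proof -
  obtain \<psi>'' where \<psi>: "\<And>u. u \<in> {a..b} \<Longrightarrow> (\<psi> has_real_derivative \<psi>' u) (at u within {a..b})"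
    "\<And>u. u \<in> {a..b} \<Longrightarrow> (\<psi>' has_real_derivative \<psi>'' u) (at u within {a..b})"
    and b: "bounded_Ck a b False k N (\<lambda>u. of_real (\<psi>'' u))"
    using ph unfolding phase_def by blast
  have "bounded_Ck a b False k (norm (of_real r :: complex) * N) (\<lambda>u. of_real r * of_real (\<psi>'' u))"
    using b by (rule bounded_Ck_cmult)
  then have "bounded_Ck a b False k N (\<lambda>u. of_real r * of_real (\<psi>'' u))"
    by (rule bounded_Ck_mono) (use r N in \<open>auto intro: mult_left_le_one_le\<close>)
  then have "bounded_Ck a b False k N (\<lambda>u. of_real (r * \<psi>'' u))" by simp
  with \<psi> show ?thesis
    unfolding phase_def by (intro conjI exI[of _ "\<lambda>u. r * \<psi>'' u"]) (auto intro!: DERIV_cmult)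
qed

text \<open>With \<open>\<Theta>\<close> an even cutoff that is 1 on a neighbourhood of all phase derivatives, the identity is
  the limit of the multipliers \<open>\<Theta> (s / 2 ^ n)\<close>. The difference of two consecutive multipliers vanishes
  near the phase derivative, so it is a nonstationary integral at the frequency scale \<open>2 ^ n * \<tau>\<close>, and
  these contributions form a geometric series.\<close>

lemma frequency_localization:
  assumes \<theta>: "C2 \<theta>" and \<theta>0: "\<And>s. L0 \<le> \<bar>s\<bar> \<Longrightarrow> \<theta> s = 0" and L0: "0 \<le> L0" "L0 < L"
    and d: "0 < d" and P: "0 \<le> P" "2 * (P + d + 1) < L" and ab: "a \<le> b" and N: "0 \<le> N"
  shows "\<exists>C\<ge>0. \<forall>\<psi> \<psi>' \<tau> y v M. phase a b k N \<psi> \<psi>' \<longrightarrow>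
      (\<forall>u\<in>{a..b}. \<bar>\<psi>' u\<bar> \<le> P \<and> (\<forall>s. \<bar>s - \<psi>' u\<bar> < d \<longrightarrow> \<theta> s = 1)) \<longrightarrow> 0 < \<tau> \<longrightarrow>
      bounded_Ck a b True k M v \<longrightarrow>
      norm (2 * of_real pi * (if y \<in> {a..b} then v y * cis (\<tau> * \<psi> y) else 0) -
        of_real \<tau> * osc_integral \<theta> L a b 0 \<psi> \<psi>' \<tau> y v) \<le> C * M / \<tau> ^ k"
proof (cases k)
  case 0
  have c: "continuous_on UNIV \<theta>" using \<theta> by (rule C2E)
  \<comment> \<open>For \<open>k = 0\<close> the amplitude is merely continuous and the dyadic
    pieces do not decay, but the decay of the kernel of \<open>\<theta>\<close> already offsets the
    Jacobian \<open>\<tau>\<close>.\<close>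
  obtain C where C: "0 \<le> C" "\<And>w. norm (fourier_kernel \<theta> L w) \<le> C / (1 + w\<^sup>2)"
    using fourier_kernel_bound[OF \<theta> \<theta>0 L0] unfolding fourier_kernel_def by blast
  note Kc = continuous_on_compose2[OF fourier_kernel_continuous[OF c]]
  have "norm (2 * of_real pi * (if y \<in> {a..b} then v y * cis (\<tau> * \<psi> y) else 0) -
        of_real \<tau> * osc_integral \<theta> L a b 0 \<psi> \<psi>' \<tau> y v) \<le> (2 * pi + C * pi) * M"
    if ph: "phase a b 0 N \<psi> \<psi>'" and \<tau>: "0 < \<tau>" and v: "bounded_Ck a b True 0 M v" for \<psi> \<psi>' \<tau> y v M
  proof -
    have vc: "continuous_on {a..b} v" using v by simp
    have M: "0 \<le> M" using bounded_Ck_nonneg[OF v ab] .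
    have "norm (osc_integral \<theta> L a b 0 \<psi> \<psi>' \<tau> y v) \<le> M * C * pi / \<tau>"
      unfolding osc_integral_0[OF c phase_continuous(1)[OF ph] vc]
    proof (rule kernel_integral_bound[OF ab \<tau>])
      show "(\<lambda>u. v u * cis (\<tau> * \<psi> u) * fourier_kernel \<theta> L (\<tau> * (y - u))) integrable_on {a..b}"
        by (intro integrable_continuous_real continuous_intros vc phase_continuous(1)[OF ph] Kc) auto
      show "norm (v u * cis (\<tau> * \<psi> u) * fourier_kernel \<theta> L (\<tau> * (y - u))) \<le> M * C / (1 + (\<tau> * (y - u))\<^sup>2)"
        if "u \<in> {a..b}" for u
        using mult_mono[of "norm (v u)" M, OF _ C(2)[of "\<tau> * (y - u)"]] v that M by (auto simp: norm_mult)
    qed (use M C in auto)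
    then have "norm (of_real \<tau> * osc_integral \<theta> L a b 0 \<psi> \<psi>' \<tau> y v) \<le> C * pi * M"
      using \<tau> by (simp add: norm_mult pos_le_divide_eq mult_ac)
    moreover have "norm (2 * of_real pi * (if y \<in> {a..b} then v y * cis (\<tau> * \<psi> y) else 0)) \<le> 2 * pi * M"
      using v M by (auto simp: norm_mult)
    ultimately show ?thesis
      by (intro order_trans[OF norm_triangle_ineq4]) (simp add: ring_distribs)
  qed
  then show ?thesis unfolding 0 using C(1)
    by (intro exI[of _ "2 * pi + C * pi"]) (auto simp del: bounded_Ck.simps)
next
  case (Suc k')
  \<comment> \<open>All phase derivatives together with their \<open>d\<close>-neighbourhoods lie in
    \<open>[-(P + d), P + d]\<close>, where \<open>\<Theta>\<close> will be 1; it falls to 0 over a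
    further unit length.\<close>
  define r where "r = P + d + 1"
  obtain \<Theta>0 where \<Theta>0: "C2 \<Theta>0" "\<And>s. - (P + d) \<le> s \<Longrightarrow> s \<le> P + d \<Longrightarrow> \<Theta>0 s = 1"
    "\<And>s. s \<le> - r \<or> r \<le> s \<Longrightarrow> \<Theta>0 s = 0"
    by (rule C2_cutoff_exists[of "- r" "- (P + d)" "P + d" r]) (auto simp: r_def)
  define \<Theta> where "\<Theta> s = \<Theta>0 s * \<Theta>0 (- s)" for s
  have \<Theta>: "C2 \<Theta>" unfolding \<Theta>_def using C2_mult[OF \<Theta>0(1) C2_affine[OF \<Theta>0(1), of "-1" 0]] by simp
  have \<Theta>1: "\<Theta> s = 1" if "\<bar>s\<bar> \<le> P + d" for s using that by (simp add: \<Theta>_def \<Theta>0(2) abs_le_iff)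
  have \<Theta>z: "\<Theta> s = 0" if "r \<le> \<bar>s\<bar>" for s using that by (auto simp: \<Theta>_def \<Theta>0(3) abs_if split: if_splits)
  have even: "\<Theta> (- s) = \<Theta> s" for s by (simp add: \<Theta>_def)
  have r: "0 \<le> r" "r < L" "2 * r < L" using P d by (auto simp: r_def)
  define \<Theta>2 where "\<Theta>2 s = \<Theta> (s / 2)" for s
  have \<Theta>2: "C2 \<Theta>2" unfolding \<Theta>2_def using C2_affine[OF \<Theta>, of "1/2" 0] by simp
  have c: "continuous_on UNIV \<theta>" using \<theta> by (rule C2E)
  have c\<Theta>: "continuous_on UNIV \<Theta>" using \<Theta> by (rule C2E)
  have c\<Theta>2: "continuous_on UNIV \<Theta>2" using \<Theta>2 by (rule C2E)
  \<comment> \<open>\<open>\<Delta>0\<close> leads from the given cutoff to \<open>\<Theta>\<close>,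
    and \<open>\<Delta>\<close> from one dyadic scale to the next. Each is a difference of two
    functions equal to 1 near the phase derivatives in question, hence zero there.\<close>
  define \<Delta>0 where "\<Delta>0 s = \<Theta> s - \<theta> s" for s
  define \<Delta> where "\<Delta> s = \<Theta>2 s - \<Theta> s" for s
  have \<Delta>0: "C2 \<Delta>0" and \<Delta>: "C2 \<Delta>" unfolding \<Delta>0_def \<Delta>_def using \<theta> \<Theta> \<Theta>2 by (auto intro: C2_diff)
  have c\<Delta>0: "continuous_on UNIV \<Delta>0" using \<Delta>0 by (rule C2E)
  have c\<Delta>: "continuous_on UNIV \<Delta>" using \<Delta> by (rule C2E)
  have "\<exists>C\<ge>0. \<forall>\<psi> \<psi>' \<tau> y v M. phase a b k N \<psi> \<psi>' \<longrightarrow>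
      (\<forall>u\<in>{a..b}. \<forall>s. \<bar>s - \<psi>' u\<bar> < d \<longrightarrow> \<Delta>0 s = 0) \<longrightarrow> 0 < \<tau> \<longrightarrow> bounded_Ck a b True k M v \<longrightarrow>
      norm (osc_integral \<Delta>0 L a b 0 \<psi> \<psi>' \<tau> y v) \<le> C * M / \<tau> ^ Suc k"
    using L0 r d ab N \<theta>0 \<Theta>z by (intro osc_integral_bound[OF \<Delta>0, of "max L0 r"]) (auto simp: \<Delta>0_def)
  then obtain C0 where C0: "0 \<le> C0" "\<And>\<psi> \<psi>' \<tau> y v M. phase a b k N \<psi> \<psi>' \<Longrightarrow>
      (\<forall>u\<in>{a..b}. \<forall>s. \<bar>s - \<psi>' u\<bar> < d \<longrightarrow> \<Delta>0 s = 0) \<Longrightarrow> 0 < \<tau> \<Longrightarrow> bounded_Ck a b True k M v \<Longrightarrow>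
      norm (osc_integral \<Delta>0 L a b 0 \<psi> \<psi>' \<tau> y v) \<le> C0 * M / \<tau> ^ Suc k"
    by blast
  have "\<exists>C\<ge>0. \<forall>\<psi> \<psi>' \<tau> y v M. phase a b k N \<psi> \<psi>' \<longrightarrow>
      (\<forall>u\<in>{a..b}. \<forall>s. \<bar>s - \<psi>' u\<bar> < d \<longrightarrow> \<Delta> s = 0) \<longrightarrow> 0 < \<tau> \<longrightarrow> bounded_Ck a b True k M v \<longrightarrow>
      norm (osc_integral \<Delta> L a b 0 \<psi> \<psi>' \<tau> y v) \<le> C * M / \<tau> ^ Suc k"
    using r d ab N \<Theta>z by (intro osc_integral_bound[OF \<Delta>, of "2 * r"]) (auto simp: \<Delta>_def \<Theta>2_def)
  then obtain C1 where C1: "0 \<le> C1" "\<And>\<psi> \<psi>' \<tau> y v M. phase a b k N \<psi> \<psi>' \<Longrightarrow>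
      (\<forall>u\<in>{a..b}. \<forall>s. \<bar>s - \<psi>' u\<bar> < d \<longrightarrow> \<Delta> s = 0) \<Longrightarrow> 0 < \<tau> \<Longrightarrow> bounded_Ck a b True k M v \<Longrightarrow>
      norm (osc_integral \<Delta> L a b 0 \<psi> \<psi>' \<tau> y v) \<le> C1 * M / \<tau> ^ Suc k"
    by blast
  have "norm (2 * of_real pi * (if y \<in> {a..b} then v y * cis (\<tau> * \<psi> y) else 0) -
        of_real \<tau> * osc_integral \<theta> L a b 0 \<psi> \<psi>' \<tau> y v) \<le> (C0 + 2 * C1) * M / \<tau> ^ k"
    if ph: "phase a b k N \<psi> \<psi>'"
      and near: "\<forall>u\<in>{a..b}. \<bar>\<psi>' u\<bar> \<le> P \<and> (\<forall>s. \<bar>s - \<psi>' u\<bar> < d \<longrightarrow> \<theta> s = 1)"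
      and \<tau>: "0 < \<tau>" and v: "bounded_Ck a b True k M v" for \<psi> \<psi>' \<tau> y v M
  proof -
    have M: "0 \<le> M" using bounded_Ck_nonneg[OF v ab] .
    have vc: "continuous_on {a..b} v" using bounded_Ck_0[OF v] by simp
    have \<psi>c: "continuous_on {a..b} \<psi>" using phase_continuous[OF ph] by blast
    define F where "F u = v u * cis (\<tau> * \<psi> u)" for u
    define W where "W = of_real \<tau> * osc_integral \<theta> L a b 0 \<psi> \<psi>' \<tau> y v"
    \<comment> \<open>Up to the factor \<open>2 * pi\<close>, this is the function \<open>F\<close>
      after applying the multiplier \<open>\<Theta> (s / 2 ^ n)\<close>, with frequencies measured
      in units of \<open>\<tau>\<close>.\<close>
    define E where "E n = of_real (2 ^ n * \<tau>) * integral {a..b} (\<lambda>u. F u * fourier_kernel \<Theta> L (2 ^ n * \<tau> * (y - u)))" for n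
    have Fc: "continuous_on {a..b} F" unfolding F_def by (intro continuous_intros vc \<psi>c)
    have Fi: "(\<lambda>u. F u * fourier_kernel m L (c * (y - u))) integrable_on {a..b}" if "continuous_on UNIV m" for m c
      by (intro integrable_continuous_real continuous_intros Fc continuous_on_compose2[OF fourier_kernel_continuous[OF that]]) auto
    have near\<Theta>: "\<bar>s\<bar> \<le> P + d" if "u \<in> {a..b}" "\<bar>s - q * \<psi>' u\<bar> < d" "\<bar>q\<bar> \<le> 1" for s u q
    proof -
      have "\<bar>q * \<psi>' u\<bar> \<le> 1 * P" unfolding abs_mult using that near by (intro mult_mono) auto
      with that(2) show ?thesis by linarith
    qed
    have base: "norm (E 0 - W) \<le> C0 * M / \<tau> ^ k"
    proof -
      have "E 0 - W = of_real \<tau> * osc_integral \<Delta>0 L a b 0 \<psi> \<psi>' \<tau> y v"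
        unfolding osc_integral_0[OF c\<Delta>0 \<psi>c vc] W_def osc_integral_0[OF c \<psi>c vc] E_def \<Delta>0_def
          fourier_kernel_diff[OF c\<Theta> c] F_def[symmetric]
        using integral_diff[OF Fi[OF c\<Theta>, of \<tau>] Fi[OF c, of \<tau>]] by (simp add: right_diff_distrib)
      moreover have "norm (osc_integral \<Delta>0 L a b 0 \<psi> \<psi>' \<tau> y v) \<le> C0 * M / \<tau> ^ Suc k"
        using near near\<Theta>[of _ _ 1] \<Theta>1 by (intro C0(2) ph \<tau> v) (auto simp: \<Delta>0_def)
      ultimately show ?thesis using \<tau> by (simp add: norm_mult field_simps)
    qed
    have step: "norm (E (Suc n) - E n) \<le> C1 * M / \<tau> ^ k / 2 ^ n" for n
    proof -
      \<comment> \<open>At scale \<open>T\<close> the phase has to be \<open>q * \<psi>\<close> for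
        the exponential to remain the same. Its derivative is still at most \<open>P\<close> in
        modulus, so \<open>\<Delta>\<close> vanishes within \<open>d\<close> of it.\<close>
      define q where "q = (1 / 2 ^ n :: real)"
      define T where "T = 2 ^ n * \<tau>"
      have q: "\<bar>q\<bar> \<le> 1" by (simp add: q_def)
      have T: "0 < T" "T * q = \<tau>" using \<tau> by (auto simp: T_def q_def)
      have ph': "phase a b k N (\<lambda>u. q * \<psi> u) (\<lambda>u. q * \<psi>' u)" using phase_scale[OF ph q N] .
      have "fourier_kernel \<Theta>2 L w = 2 * fourier_kernel \<Theta> L (2 * w)" for w
        unfolding \<Theta>2_def by (rule fourier_kernel_dilate[OF c\<Theta> \<Theta>z]) (use r in auto)
      then have \<Delta>k: "fourier_kernel \<Delta> L w = 2 * fourier_kernel \<Theta> L (2 * w) - fourier_kernel \<Theta> L w" for w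
        unfolding \<Delta>_def fourier_kernel_diff[OF c\<Theta>2 c\<Theta>] by simp
      have "osc_integral \<Delta> L a b 0 (\<lambda>u. q * \<psi> u) (\<lambda>u. q * \<psi>' u) T y v =
          integral {a..b} (\<lambda>u. F u * fourier_kernel \<Delta> L (T * (y - u)))"
        using T by (subst osc_integral_0[OF c\<Delta> phase_continuous(1)[OF ph'] vc]) (simp add: F_def flip: mult.assoc)
      also have "\<dots> = integral {a..b} (\<lambda>u. 2 * (F u * fourier_kernel \<Theta> L (2 * T * (y - u))) -
          F u * fourier_kernel \<Theta> L (T * (y - u)))"
        unfolding \<Delta>k by (simp add: algebra_simps)
      also have "\<dots> = 2 * integral {a..b} (\<lambda>u. F u * fourier_kernel \<Theta> L (2 * T * (y - u))) -
          integral {a..b} (\<lambda>u. F u * fourier_kernel \<Theta> L (T * (y - u)))"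
        by (subst integral_diff[OF integrable_on_mult_right[OF Fi[OF c\<Theta>]] Fi[OF c\<Theta>]]) simp
      finally have osc: "osc_integral \<Delta> L a b 0 (\<lambda>u. q * \<psi> u) (\<lambda>u. q * \<psi>' u) T y v =
          2 * integral {a..b} (\<lambda>u. F u * fourier_kernel \<Theta> L (2 * T * (y - u))) -
          integral {a..b} (\<lambda>u. F u * fourier_kernel \<Theta> L (T * (y - u)))" .
      have "E (Suc n) = of_real T * (2 * integral {a..b} (\<lambda>u. F u * fourier_kernel \<Theta> L (2 * T * (y - u))))"
        "E n = of_real T * integral {a..b} (\<lambda>u. F u * fourier_kernel \<Theta> L (T * (y - u)))"
        by (simp_all add: E_def T_def mult.assoc mult.left_commute)
      then have "E (Suc n) - E n = of_real T * osc_integral \<Delta> L a b 0 (\<lambda>u. q * \<psi> u) (\<lambda>u. q * \<psi>' u) T y v"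
        unfolding osc by (simp only: right_diff_distrib)
      moreover have "norm (osc_integral \<Delta> L a b 0 (\<lambda>u. q * \<psi> u) (\<lambda>u. q * \<psi>' u) T y v) \<le> C1 * M / T ^ Suc k"
        using near\<Theta>[OF _ _ q] \<Theta>1 by (intro C1(2) ph' T(1) v) (force simp: \<Delta>_def \<Theta>2_def)
      ultimately have "norm (E (Suc n) - E n) \<le> C1 * M / T ^ k"
        using T by (simp add: norm_mult field_simps)
      also have "\<dots> = C1 * M / \<tau> ^ k / (2 ^ n) ^ k" by (simp add: T_def power_mult_distrib mult.commute)
      also have "\<dots> \<le> C1 * M / \<tau> ^ k / 2 ^ n"
      proof -
        \<comment> \<open>Here \<open>k = Suc k'\<close> is used: at least one negative power of
          \<open>2 ^ n\<close> survives, which makes the series of steps geometric.\<close>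
        have "(2::real) ^ n * 1 \<le> 2 ^ n * (2 ^ n) ^ k'" by (intro mult_left_mono one_le_power) auto
        then show ?thesis using C1(1) M \<tau> Suc by (intro divide_left_mono) auto
      qed
      finally show ?thesis .
    qed
    \<comment> \<open>\<open>2 - 2 / 2 ^ n\<close> is the sum of the first \<open>n\<close> terms of
      1 + 1/2 + 1/4 + ...\<close>
    have E: "norm (E n - W) \<le> (C0 + C1 * (2 - 2 / 2 ^ n)) * (M / \<tau> ^ k)" for n
    proof (induction n)
      case 0
      then show ?case using base by simp
    next
      case (Suc n)
      have "norm (E (Suc n) - W) \<le> norm (E (Suc n) - E n) + norm (E n - W)"
        using norm_triangle_ineq[of "E (Suc n) - E n" "E n - W"] by simp
      also have "\<dots> \<le> C1 * M / \<tau> ^ k / 2 ^ n + (C0 + C1 * (2 - 2 / 2 ^ n)) * (M / \<tau> ^ k)"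
        by (intro add_mono step Suc)
      also have "\<dots> = (C0 + C1 * (2 - 2 / 2 ^ Suc n)) * (M / \<tau> ^ k)"
        using \<tau> by (simp add: field_simps)
      finally show ?case .
    qed
    have E': "norm (E n - W) \<le> (C0 + 2 * C1) * M / \<tau> ^ k" for n
    proof -
      have "(C0 + C1 * (2 - 2 / 2 ^ n)) * (M / \<tau> ^ k) \<le> (C0 + C1 * 2) * (M / \<tau> ^ k)"
        using C1(1) M \<tau> by (intro mult_right_mono add_mono mult_left_mono) auto
      with E[of n] show ?thesis by (simp add: mult.commute)
    qed
    \<comment> \<open>A positive \<open>k\<close> gives \<open>v\<close> the one derivative that the
      approximate identity requires.\<close>
    have "bounded_Ck a b True (Suc k') M v" using v Suc by simp
    then obtain v' where v': "bounded_Ck a b True 0 M v" "bounded_Ck a b True k' M v'"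
      "\<And>u. u \<in> {a..b} \<Longrightarrow> (v has_vector_derivative v' u) (at u within {a..b})"
      by (rule bounded_Ck_SucE) blast
    have v'c: "continuous_on {a..b} v'" using bounded_Ck_0[OF v'(2)] by simp
    have \<psi>: "(\<psi> has_real_derivative \<psi>' u) (at u within {a..b})" if "u \<in> {a..b}" for u
      using ph that unfolding phase_def by blast
    have dF: "(F has_vector_derivative v u * (\<i> * of_real (\<tau> * \<psi>' u) * cis (\<tau> * \<psi> u)) + v' u * cis (\<tau> * \<psi> u))
        (at u within {a..b})" if "u \<in> {a..b}" for u
      unfolding F_def[abs_def]
      by (intro has_vector_derivative_mult has_vector_derivative_cis DERIV_cmult v'(3) \<psi> that)
    have dFc: "continuous_on {a..b} (\<lambda>u. v u * (\<i> * of_real (\<tau> * \<psi>' u) * cis (\<tau> * \<psi> u)) + v' u * cis (\<tau> * \<psi> u))"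
      by (intro continuous_intros vc v'c \<psi>c phase_continuous(2)[OF ph])
    have "filterlim (\<lambda>n. 2 ^ n :: real) at_top sequentially"
      by (rule filterlim_at_infinity_imp_filterlim_at_top[OF filterlim_realpow_sequentially_gt1]) auto
    then have "filterlim (\<lambda>n. \<tau> * 2 ^ n) at_top sequentially"
      using \<tau> by (intro filterlim_tendsto_pos_mult_at_top[OF tendsto_const])
    then have X: "filterlim (\<lambda>n. 2 ^ n * \<tau>) at_top sequentially" by (simp add: mult.commute)
    have F0: "F a = 0" "F b = 0" using v'(1) by (auto simp: F_def)
    have one: "\<Theta> 0 = 1" using P d by (intro \<Theta>1) simp
    have "(\<lambda>n. E n) \<longlonglongrightarrow> 2 * of_real pi * (if y \<in> {a..b} then F y else 0)"
      unfolding E_def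
      by (rule approximate_identity[OF \<Theta> \<Theta>z r(1,2) even one ab dF dFc F0 X])
    then have "(\<lambda>n. norm (E n - W)) \<longlonglongrightarrow> norm (2 * of_real pi * (if y \<in> {a..b} then F y else 0) - W)"
      by (intro tendsto_intros)
    then have "norm (2 * of_real pi * (if y \<in> {a..b} then F y else 0) - W) \<le> (C0 + 2 * C1) * M / \<tau> ^ k"
      by (rule LIMSEQ_le_const2) (use E' in auto)
    then show ?thesis unfolding F_def W_def .
  qed
  moreover have "0 \<le> C0 + 2 * C1" using C0(1) C1(1) by simp
  ultimately show ?thesis by blast
qed

subsection \<open>Van der Corput bounds\<close>

text \<open>Integrate by parts after dividing by \<open>\<Phi>'\<close>. Monotonicity of
  \<open>\<Phi>'\<close> makes the integral of the derivative of its reciprocal telescope to a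
  difference of two reciprocals of the same sign, at most \<open>1 / \<nu>\<close>; with the two
  boundary terms this accounts for \<open>3 * M\<close>.\<close>

lemma van_der_corput_first:
  fixes v :: "real \<Rightarrow> complex"
  assumes pq: "p \<le> q" and \<Phi>: "\<And>u. u \<in> {p..q} \<Longrightarrow> (\<Phi> has_real_derivative \<Phi>' u) (at u within {p..q})"
    "\<And>u. u \<in> {p..q} \<Longrightarrow> (\<Phi>' has_real_derivative \<Phi>'' u) (at u within {p..q})"
    and c: "continuous_on {p..q} \<Phi>''" and pos: "\<And>u. u \<in> {p..q} \<Longrightarrow> 0 \<le> \<Phi>'' u"
    and \<nu>: "0 < \<nu>" "(\<forall>u\<in>{p..q}. \<nu> \<le> \<Phi>' u) \<or> (\<forall>u\<in>{p..q}. \<Phi>' u \<le> - \<nu>)"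
    and v: "\<And>u. u \<in> {p..q} \<Longrightarrow> (v has_vector_derivative v' u) (at u within {p..q})"
    and v': "continuous_on {p..q} v'"
    and b: "\<And>u. u \<in> {p..q} \<Longrightarrow> norm (v u) \<le> M" "\<And>u. u \<in> {p..q} \<Longrightarrow> norm (v' u) \<le> M'"
  shows "norm (integral {p..q} (\<lambda>u. v u * cis (\<Phi> u))) \<le> (3 * M + M' * (q - p)) / \<nu>"
proof -
  have cts: "continuous_on {p..q} \<Phi>" "continuous_on {p..q} \<Phi>'" "continuous_on {p..q} v"
    using DERIV_continuous_on \<Phi> continuous_on_vector_derivative v by blast+
  have ge: "\<nu> \<le> \<bar>\<Phi>' u\<bar>" if "u \<in> {p..q}" for u using \<nu> that by force
  then have ne: "\<Phi>' u \<noteq> 0" if "u \<in> {p..q}" for u using that \<nu>(1) by force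
  have M: "0 \<le> M" "0 \<le> M'"
    using order_trans[OF norm_ge_zero b(1)[of p]] order_trans[OF norm_ge_zero b(2)[of p]] pq by auto
  have inv_bound: "norm (of_real (inverse (\<Phi>' u)) * c) \<le> D / \<nu>"
    if "u \<in> {p..q}" "norm c \<le> D" for u D and c :: complex
  proof -
    have "inverse \<bar>\<Phi>' u\<bar> * norm c \<le> inverse \<nu> * D"
      using ge[OF that(1)] \<nu>(1) that(2) by (intro mult_mono le_imp_inverse_le) auto
    then show ?thesis by (simp add: norm_mult norm_inverse divide_inverse mult.commute)
  qed
  define f where "f u = of_real (inverse (\<Phi>' u)) * v u" for u
  define R where "R u = \<Phi>'' u / (\<Phi>' u)\<^sup>2" for u
  define f' where "f' u = of_real (inverse (\<Phi>' u)) * v' u + of_real (- R u) * v u" for u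
  have inv: "((\<lambda>u. inverse (\<Phi>' u)) has_real_derivative - R u) (at u within {p..q})" if "u \<in> {p..q}" for u
    using ne[OF that] \<Phi>(2)[OF that]
    by (auto intro!: derivative_eq_intros simp: R_def power2_eq_square field_simps)
  have f: "(f has_vector_derivative f' u) (at u within {p..q})" if "u \<in> {p..q}" for u
    unfolding f_def[abs_def] f'_def
    by (intro has_vector_derivative_mult has_vector_derivative_of_real inv v that)
  have Rc: "continuous_on {p..q} R" unfolding R_def using cts c ne by (intro continuous_intros) auto
  have f'c: "continuous_on {p..q} f'" unfolding f'_def using Rc cts v' ne by (intro continuous_intros) auto
  have e: "((\<lambda>u. cis (\<Phi> u)) has_vector_derivative \<i> * of_real (\<Phi>' u) * cis (\<Phi> u)) (at u within {p..q})" if "u \<in> {p..q}" for u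
    by (intro has_vector_derivative_cis \<Phi> that)
  have "\<i> * integral {p..q} (\<lambda>u. v u * cis (\<Phi> u)) = integral {p..q} (\<lambda>u. \<i> * (v u * cis (\<Phi> u)))"
    by (rule integral_mult_right[symmetric])
  also have "\<dots> = integral {p..q} (\<lambda>u. f u * (\<i> * of_real (\<Phi>' u) * cis (\<Phi> u)))"
    using ne by (intro integral_cong) (simp add: f_def field_simps)
  also have "\<dots> = f q * cis (\<Phi> q) - f p * cis (\<Phi> p) - integral {p..q} (\<lambda>u. f' u * cis (\<Phi> u))"
    by (rule integral_by_parts_complex[OF pq f e f'c]) (use cts in \<open>auto intro!: continuous_intros\<close>)
  finally have eq: "\<i> * integral {p..q} (\<lambda>u. v u * cis (\<Phi> u)) =
      f q * cis (\<Phi> q) - f p * cis (\<Phi> p) - integral {p..q} (\<lambda>u. f' u * cis (\<Phi> u))" .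
  have fb: "norm (f u) \<le> M / \<nu>" if "u \<in> {p..q}" for u
    unfolding f_def using inv_bound[OF that b(1)[OF that]] .
  have R: "(R has_integral inverse (\<Phi>' p) - inverse (\<Phi>' q)) {p..q}"
  proof -
    have "((\<lambda>u. - R u) has_integral inverse (\<Phi>' q) - inverse (\<Phi>' p)) {p..q}"
      using inv by (intro fundamental_theorem_of_calculus pq)
        (simp add: has_real_derivative_iff_has_vector_derivative)
    from has_integral_neg[OF this] show ?thesis by simp
  qed
  have ib: "norm (integral {p..q} (\<lambda>u. f' u * cis (\<Phi> u))) \<le> M' * (q - p) / \<nu> + M / \<nu>"
  proof -
    have "norm (integral {p..q} (\<lambda>u. f' u * cis (\<Phi> u))) \<le> integral {p..q} (\<lambda>u. M' / \<nu> + M * R u)"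
    proof (rule integral_norm_bound_integral)
      show "(\<lambda>u. f' u * cis (\<Phi> u)) integrable_on {p..q}"
        by (intro integrable_continuous_real continuous_intros f'c cts)
      show "(\<lambda>u. M' / \<nu> + M * R u) integrable_on {p..q}"
        by (intro integrable_continuous_real continuous_intros Rc)
      show "norm (f' u * cis (\<Phi> u)) \<le> M' / \<nu> + M * R u" if u: "u \<in> {p..q}" for u
      proof -
        have "norm (of_real (inverse (\<Phi>' u)) * v' u) \<le> M' / \<nu>"
          using inv_bound[OF u b(2)[OF u]] .
        moreover have "norm (of_real (- R u) * v u) \<le> M * R u"
        proof -
          have "0 \<le> R u" using pos[OF u] by (simp add: R_def)
          with mult_left_mono[OF b(1)[OF u] this] show ?thesis
            unfolding norm_mult norm_of_real by (simp add: mult.commute)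
        qed
        ultimately show ?thesis
          unfolding norm_mult[of _ "cis (\<Phi> u)"] norm_cis mult_1_right f'_def by (intro norm_triangle_le add_mono)
      qed
    qed
    also have "\<dots> = M' / \<nu> * (q - p) + M * (inverse (\<Phi>' p) - inverse (\<Phi>' q))"
      using has_integral_add[OF has_integral_const_real[of "M' / \<nu>" p q] has_integral_mult_right[OF R, of M]] pq
      by (simp add: integral_unique mult.commute)
    also have "\<dots> \<le> M' / \<nu> * (q - p) + M * (1 / \<nu>)"
    proof -
      have "inverse (\<Phi>' p) - inverse (\<Phi>' q) \<le> 1 / \<nu>"
        using \<nu>(2)
      proof
        assume *: "\<forall>u\<in>{p..q}. \<nu> \<le> \<Phi>' u"
        then have "inverse (\<Phi>' p) \<le> inverse \<nu>" "0 \<le> inverse (\<Phi>' q)" using pq \<nu>(1) by (auto intro!: le_imp_inverse_le intro: order_trans[of 0 \<nu>])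
        then show ?thesis unfolding inverse_minus_eq inverse_eq_divide[of \<nu>] by linarith
      next
        assume *: "\<forall>u\<in>{p..q}. \<Phi>' u \<le> - \<nu>"
        then have "inverse (- \<Phi>' q) \<le> inverse \<nu>" "0 \<le> inverse (- \<Phi>' p)" using pq \<nu>(1) by (force intro!: le_imp_inverse_le)+
        then show ?thesis unfolding inverse_minus_eq inverse_eq_divide[of \<nu>] by linarith
      qed
      then show ?thesis using M by (intro add_left_mono mult_left_mono)
    qed
    finally show ?thesis by simp
  qed
  have "norm (integral {p..q} (\<lambda>u. v u * cis (\<Phi> u))) = norm (\<i> * integral {p..q} (\<lambda>u. v u * cis (\<Phi> u)))"
    by (simp add: norm_mult)
  also have "\<dots> \<le> norm (f q) + norm (f p) + norm (integral {p..q} (\<lambda>u. f' u * cis (\<Phi> u)))"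
    unfolding eq by (rule order_trans[OF norm_triangle_ineq4] add_mono norm_triangle_ineq4[THEN order_trans])+ (simp_all add: norm_mult)
  also have "\<dots> \<le> M / \<nu> + M / \<nu> + (M' * (q - p) / \<nu> + M / \<nu>)"
    using pq by (intro add_mono fb ib) auto
  also have "\<dots> = (3 * M + M' * (q - p)) / \<nu>" by (simp add: add_divide_distrib)
  finally show ?thesis .
qed

text \<open>\<open>\<Phi>'\<close> grows at rate at least \<open>\<mu>\<close>, so it exceeds
  \<open>sqrt \<mu>\<close> in modulus outside an interval of radius \<open>1 / sqrt \<mu>\<close>.
  There the trivial bound costs \<open>2 * M / sqrt \<mu>\<close>; each outer piece costs the first
  derivative bound with \<open>3 * M\<close>, in total \<open>8 * M\<close>.\<close>

lemma van_der_corput_second_pos: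
  fixes v :: "real \<Rightarrow> complex"
  assumes ab: "a \<le> b" and \<Phi>: "\<And>u. u \<in> {a..b} \<Longrightarrow> (\<Phi> has_real_derivative \<Phi>' u) (at u within {a..b})"
    "\<And>u. u \<in> {a..b} \<Longrightarrow> (\<Phi>' has_real_derivative \<Phi>'' u) (at u within {a..b})"
    and c: "continuous_on {a..b} \<Phi>''" and \<mu>: "0 < \<mu>" "\<And>u. u \<in> {a..b} \<Longrightarrow> \<mu> \<le> \<Phi>'' u"
    and v: "\<And>u. u \<in> {a..b} \<Longrightarrow> (v has_vector_derivative v' u) (at u within {a..b})"
    and v': "continuous_on {a..b} v'"
    and b: "\<And>u. u \<in> {a..b} \<Longrightarrow> norm (v u) \<le> M" "\<And>u. u \<in> {a..b} \<Longrightarrow> norm (v' u) \<le> M'"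
  shows "norm (integral {a..b} (\<lambda>u. v u * cis (\<Phi> u))) \<le> (8 * M + 2 * M' * (b - a)) / sqrt \<mu>"
proof -
  have cts: "continuous_on {a..b} \<Phi>" "continuous_on {a..b} \<Phi>'" "continuous_on {a..b} v"
    using DERIV_continuous_on \<Phi> continuous_on_vector_derivative v by blast+
  have M: "0 \<le> M" "0 \<le> M'"
    using order_trans[OF norm_ge_zero b(1)[of a]] order_trans[OF norm_ge_zero b(2)[of a]] ab by auto
  have incr: "\<mu> * (u - w) \<le> \<Phi>' u - \<Phi>' w" if "w \<in> {a..b}" "u \<in> {a..b}" "w \<le> u" for u w
  proof -
    have "\<exists>x\<in>{w..u}. \<Phi>' u - \<Phi>' w = (\<lambda>h. h * \<Phi>'' x) (u - w)"
      using that DERIV_subset[OF \<Phi>(2), of _ "{w..u}"]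
      by (intro mvt_very_simple) (auto simp: has_field_derivative_def mult_commute_abs)
    then obtain x where x: "x \<in> {w..u}" "\<Phi>' u - \<Phi>' w = (u - w) * \<Phi>'' x" by auto
    have "(u - w) * \<mu> \<le> (u - w) * \<Phi>'' x" using x(1) that by (intro mult_left_mono \<mu>(2)) auto
    then show ?thesis using x(2) by (simp add: mult.commute)
  qed
  \<comment> \<open>The point nearest to stationary: the zero of \<open>\<Phi>'\<close> if there is
    one, otherwise the end at which \<open>\<bar>\<Phi>'\<bar>\<close> is least.\<close>
  obtain z where z: "z \<in> {a..b}" and zl: "\<And>u. u \<in> {a..b} \<Longrightarrow> u < z \<Longrightarrow> \<Phi>' u \<le> - (\<mu> * (z - u))"
    and zr: "\<And>u. u \<in> {a..b} \<Longrightarrow> z < u \<Longrightarrow> \<mu> * (u - z) \<le> \<Phi>' u"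
  proof -
    consider "0 \<le> \<Phi>' a" | "\<Phi>' b \<le> 0" | "\<Phi>' a \<le> 0" "0 \<le> \<Phi>' b" by linarith
    then show ?thesis
    proof cases
      case 1
      show ?thesis
      proof (rule that[of a])
        show "\<mu> * (u - a) \<le> \<Phi>' u" if "u \<in> {a..b}" "a < u" for u using incr[of a u] 1 that by auto
      qed (use ab in auto)
    next
      case 2
      show ?thesis
      proof (rule that[of b])
        show "\<Phi>' u \<le> - (\<mu> * (b - u))" if "u \<in> {a..b}" "u < b" for u using incr[of u b] 2 that by auto
      qed (use ab in auto)
    next
      case 3
      then obtain z where z: "a \<le> z" "z \<le> b" "\<Phi>' z = 0" using IVT'[OF 3 ab cts(2)] by blast
      show ?thesis
      proof (rule that[of z])
        show "\<Phi>' u \<le> - (\<mu> * (z - u))" if "u \<in> {a..b}" "u < z" for u using incr[of u z] z that by auto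
        show "\<mu> * (u - z) \<le> \<Phi>' u" if "u \<in> {a..b}" "z < u" for u using incr[of z u] z that by auto
      qed (use z in auto)
    qed
  qed
  \<comment> \<open>This radius balances the trivial bound, proportional to \<open>\<delta>\<close>,
    against the first derivative bound, proportional to
    \<open>1 / (\<mu> * \<delta>)\<close>.\<close>
  define \<delta> where "\<delta> = 1 / sqrt \<mu>"
  have \<delta>: "0 < \<delta>" "\<mu> * \<delta> = sqrt \<mu>" using \<mu>(1) by (auto simp: \<delta>_def real_div_sqrt)
  define p where "p = max a (z - \<delta>)"
  define q where "q = min b (z + \<delta>)"
  have pq: "a \<le> p" "p \<le> q" "q \<le> b" using z \<delta>(1) by (auto simp: p_def q_def)
  let ?f = "\<lambda>u. v u * cis (\<Phi> u)"
  have fi: "continuous_on {a..b} ?f" by (intro continuous_intros cts)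
  have outer: "norm (integral {s..t} ?f) \<le> (3 * M + M' * (t - s)) / sqrt \<mu>"
    if st: "a \<le> s" "s \<le> t" "t \<le> b"
      and large: "(\<forall>u\<in>{s..t}. sqrt \<mu> \<le> \<Phi>' u) \<or> (\<forall>u\<in>{s..t}. \<Phi>' u \<le> - sqrt \<mu>)" for s t
  proof (rule van_der_corput_first[OF st(2) _ _ _ _ _ large])
    show "(\<Phi> has_real_derivative \<Phi>' u) (at u within {s..t})" if "u \<in> {s..t}" for u
      using st that by (intro DERIV_subset[OF \<Phi>(1)]) auto
    show "(\<Phi>' has_real_derivative \<Phi>'' u) (at u within {s..t})" if "u \<in> {s..t}" for u
      using st that by (intro DERIV_subset[OF \<Phi>(2)]) auto
    show "(v has_vector_derivative v' u) (at u within {s..t})" if "u \<in> {s..t}" for u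
      using st that by (intro has_vector_derivative_within_subset[OF v]) auto
    show "continuous_on {s..t} \<Phi>''" "continuous_on {s..t} v'"
      using st by (auto intro: continuous_on_subset[OF c] continuous_on_subset[OF v'])
    show "0 \<le> \<Phi>'' u" if "u \<in> {s..t}" for u using \<mu>(2)[of u] \<mu>(1) st that by simp
  qed (use b st \<mu>(1) in auto)
  have left: "norm (integral {a..p} ?f) \<le> (3 * M + M' * (b - a)) / sqrt \<mu>"
  proof (cases "a < p")
    case True
    have "\<Phi>' u \<le> - sqrt \<mu>" if "u \<in> {a..p}" for u
    proof -
      have u: "u \<le> z - \<delta>" using True that by (auto simp: p_def max_def split: if_splits)
      have "\<mu> * \<delta> \<le> \<mu> * (z - u)" using u \<mu>(1) by (intro mult_left_mono) auto
      with zl[of u] that u \<delta> pq show ?thesis by auto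
    qed
    then have "norm (integral {a..p} ?f) \<le> (3 * M + M' * (p - a)) / sqrt \<mu>"
      using pq by (intro outer) auto
    also have "\<dots> \<le> (3 * M + M' * (b - a)) / sqrt \<mu>"
      using pq M \<mu>(1) by (intro divide_right_mono add_left_mono mult_left_mono) auto
    finally show ?thesis .
  next
    case False
    then have "p = a" using pq by simp
    then show ?thesis using M ab \<mu>(1) by simp
  qed
  have right: "norm (integral {q..b} ?f) \<le> (3 * M + M' * (b - a)) / sqrt \<mu>"
  proof (cases "q < b")
    case True
    have "sqrt \<mu> \<le> \<Phi>' u" if "u \<in> {q..b}" for u
    proof -
      have u: "z + \<delta> \<le> u" using True that by (auto simp: q_def min_def split: if_splits)
      have "\<mu> * \<delta> \<le> \<mu> * (u - z)" using u \<mu>(1) by (intro mult_left_mono) auto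
      with zr[of u] that u \<delta> pq show ?thesis by auto
    qed
    then have "norm (integral {q..b} ?f) \<le> (3 * M + M' * (b - q)) / sqrt \<mu>"
      using pq by (intro outer) auto
    also have "\<dots> \<le> (3 * M + M' * (b - a)) / sqrt \<mu>"
      using pq M \<mu>(1) by (intro divide_right_mono add_left_mono mult_left_mono) auto
    finally show ?thesis .
  next
    case False
    then have "q = b" using pq by simp
    then show ?thesis using M ab \<mu>(1) by simp
  qed
  have "norm (integral {p..q} ?f) \<le> M * (q - p)"
    using pq b by (intro norm_integral_le_const continuous_on_subset[OF fi]) (auto simp: norm_mult)
  also have "\<dots> \<le> M * (2 * \<delta>)" using M by (intro mult_left_mono) (auto simp: p_def q_def)
  finally have mid: "norm (integral {p..q} ?f) \<le> 2 * M / sqrt \<mu>" by (simp add: \<delta>_def mult.commute)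
  have split: "integral {a..b} ?f = integral {a..p} ?f + integral {p..q} ?f + integral {q..b} ?f"
  proof -
    have "integral {a..p} ?f + integral {p..q} ?f = integral {a..q} ?f"
      using pq by (intro Henstock_Kurzweil_Integration.integral_combine integrable_continuous_real continuous_on_subset[OF fi]) auto
    moreover have "integral {a..q} ?f + integral {q..b} ?f = integral {a..b} ?f"
      using pq fi by (intro Henstock_Kurzweil_Integration.integral_combine integrable_continuous_real) auto
    ultimately show ?thesis by simp
  qed
  have "norm (integral {a..b} ?f) \<le> norm (integral {a..p} ?f) + norm (integral {p..q} ?f) + norm (integral {q..b} ?f)"
    unfolding split by (intro norm_triangle_le add_right_mono norm_triangle_ineq)
  also have "\<dots> \<le> (3 * M + M' * (b - a)) / sqrt \<mu> + 2 * M / sqrt \<mu> + (3 * M + M' * (b - a)) / sqrt \<mu>"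
    by (intro add_mono left mid right)
  also have "\<dots> = (8 * M + 2 * M' * (b - a)) / sqrt \<mu>"
    by (simp add: add_divide_distrib[symmetric] algebra_simps)
  finally show ?thesis .
qed

text \<open>A continuous \<open>\<Phi>''\<close> bounded away from 0 has constant sign on the
  interval, and complex conjugation exchanges the two signs.\<close>

lemma van_der_corput_second:
  fixes v :: "real \<Rightarrow> complex"
  assumes ab: "a \<le> b" and \<Phi>: "\<And>u. u \<in> {a..b} \<Longrightarrow> (\<Phi> has_real_derivative \<Phi>' u) (at u within {a..b})"
    "\<And>u. u \<in> {a..b} \<Longrightarrow> (\<Phi>' has_real_derivative \<Phi>'' u) (at u within {a..b})"
    and c: "continuous_on {a..b} \<Phi>''" and \<mu>: "0 < \<mu>" "\<And>u. u \<in> {a..b} \<Longrightarrow> \<mu> \<le> \<bar>\<Phi>'' u\<bar>"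
    and v: "bounded_Ck a b z 1 M v"
  shows "norm (integral {a..b} (\<lambda>u. v u * cis (\<Phi> u))) \<le> (8 + 2 * (b - a)) * M / sqrt \<mu>"
proof -
  obtain v' where v': "bounded_Ck a b z 0 M v" "bounded_Ck a b z 0 M v'"
    "\<And>u. u \<in> {a..b} \<Longrightarrow> (v has_vector_derivative v' u) (at u within {a..b})"
    using v unfolding One_nat_def by (rule bounded_Ck_SucE) blast
  have sign: "(\<forall>u\<in>{a..b}. \<mu> \<le> \<Phi>'' u) \<or> (\<forall>u\<in>{a..b}. \<mu> \<le> - \<Phi>'' u)"
  proof (rule ccontr)
    assume "\<not> ?thesis"
    then obtain s t where st: "s \<in> {a..b}" "t \<in> {a..b}" "\<not> \<mu> \<le> \<Phi>'' s" "\<not> \<mu> \<le> - \<Phi>'' t" by blast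
    then have "\<Phi>'' s < 0" "0 < \<Phi>'' t" using \<mu>(1) \<mu>(2)[of s] \<mu>(2)[of t] by linarith+
    moreover have "connected (\<Phi>'' ` {a..b})" using c by (intro connected_continuous_image) auto
    ultimately have "0 \<in> \<Phi>'' ` {a..b}" using st(1,2) by (meson connectedD_interval image_eqI less_imp_le)
    then obtain w where "w \<in> {a..b}" "\<Phi>'' w = 0" by auto
    then show False using \<mu>(1) \<mu>(2)[of w] by simp
  qed
  have "norm (integral {a..b} (\<lambda>u. v u * cis (\<Phi> u))) \<le> (8 * M + 2 * M * (b - a)) / sqrt \<mu>"
    using sign
  proof
    assume *: "\<forall>u\<in>{a..b}. \<mu> \<le> \<Phi>'' u"
    show ?thesis
      by (rule van_der_corput_second_pos[OF ab \<Phi> c \<mu>(1) _ v'(3)]) (use * v' in auto)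
  next
    assume *: "\<forall>u\<in>{a..b}. \<mu> \<le> - \<Phi>'' u"
    have "norm (integral {a..b} (\<lambda>u. cnj (v u) * cis (- \<Phi> u))) \<le> (8 * M + 2 * M * (b - a)) / sqrt \<mu>"
    proof (rule van_der_corput_second_pos[OF ab _ _ _ \<mu>(1)])
      show "((\<lambda>u. - \<Phi> u) has_real_derivative - \<Phi>' u) (at u within {a..b})" if "u \<in> {a..b}" for u
        using \<Phi>(1)[OF that] by (rule DERIV_minus)
      show "((\<lambda>u. - \<Phi>' u) has_real_derivative - \<Phi>'' u) (at u within {a..b})" if "u \<in> {a..b}" for u
        using \<Phi>(2)[OF that] by (rule DERIV_minus)
      show "((\<lambda>u. cnj (v u)) has_vector_derivative cnj (v' u)) (at u within {a..b})" if "u \<in> {a..b}" for u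
        using v'(3)[OF that] by (rule has_vector_derivative_cnj)
    qed (use * v' c in \<open>auto intro!: continuous_intros\<close>)
    moreover have "integral {a..b} (\<lambda>u. cnj (v u) * cis (- \<Phi> u)) = cnj (integral {a..b} (\<lambda>u. v u * cis (\<Phi> u)))"
      by (simp add: Henstock_Kurzweil_Integration.integral_cnj cis_cnj)
    ultimately show ?thesis by simp
  qed
  then show ?thesis by (simp add: algebra_simps)
qed

subsection \<open>Pullback and rescaling\<close>

lemma bounded_Ck_family:
  fixes h :: "nat \<Rightarrow> real \<Rightarrow> complex"
  assumes d: "\<And>i u. u \<in> {a..b} \<Longrightarrow> (h i has_vector_derivative h (Suc i) u) (at u within {a..b})"
    and b: "\<And>i u. n \<le> i \<Longrightarrow> i \<le> n + k \<Longrightarrow> u \<in> {a..b} \<Longrightarrow> norm (h i u) \<le> N"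
  shows "bounded_Ck a b False k N (h n)"
  using b
proof (induction k arbitrary: n)
  case 0
  have "continuous_on {a..b} (h n)" by (rule continuous_on_vector_derivative[OF d])
  then show ?case using 0 by auto
next
  case (Suc k)
  have "continuous_on {a..b} (h n)" by (rule continuous_on_vector_derivative[OF d])
  then have "bounded_Ck a b False 0 N (h n)" using Suc.prems[of n] by auto
  then show ?case
    by (rule bounded_Ck_SucI[OF _ Suc.IH]) (use d Suc.prems in auto)
qed

text \<open>Coefficient and exponent are arbitrary because differentiation changes both.\<close>

lemma bounded_Ck_powr:
  assumes "0 < a" "a \<le> b"
  shows "\<exists>N\<ge>0. bounded_Ck a b False k N (\<lambda>u. of_real (c * u powr r))"
proof (induction k arbitrary: c r)
  case 0
  have c: "continuous_on {a..b} (\<lambda>u. of_real (c * u powr r) :: complex)"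
    using assms by (intro continuous_intros) auto
  then have "bounded ((\<lambda>u. of_real (c * u powr r) :: complex) ` {a..b})"
    by (intro compact_imp_bounded compact_continuous_image) auto
  then obtain N where N: "\<forall>y\<in>(\<lambda>u. of_real (c * u powr r) :: complex) ` {a..b}. norm y \<le> N"
    unfolding bounded_iff by blast
  then have N': "norm (of_real (c * u powr r) :: complex) \<le> N" if "u \<in> {a..b}" for u using that by blast
  have "0 \<le> N" using order_trans[OF norm_ge_zero N'[of a]] assms by simp
  moreover have "bounded_Ck a b False 0 N (\<lambda>u. of_real (c * u powr r))" using c N' by auto
  ultimately show ?case by blast
next
  case (Suc k)
  obtain N0 where N0: "0 \<le> N0" "bounded_Ck a b False k N0 (\<lambda>u. of_real (c * u powr r))" using Suc.IH by blast
  obtain N1 where N1: "0 \<le> N1" "bounded_Ck a b False k N1 (\<lambda>u. of_real (c * r * u powr (r - 1)))" using Suc.IH by blast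
  define N where "N = max N0 N1"
  have "((\<lambda>u. of_real (c * u powr r) :: complex) has_vector_derivative of_real (c * r * u powr (r - 1)))
      (at u within {a..b})" if "u \<in> {a..b}" for u
    using that assms by (intro has_vector_derivative_of_real) (auto intro!: derivative_eq_intros)
  moreover have "bounded_Ck a b False 0 N (\<lambda>u. of_real (c * u powr r))"
    by (rule bounded_Ck_mono[OF bounded_Ck_0[OF N0(2)]]) (simp add: N_def)
  moreover have "bounded_Ck a b False k N (\<lambda>u. of_real (c * r * u powr (r - 1)))"
    by (rule bounded_Ck_mono[OF N1(2)]) (simp add: N_def)
  ultimately have "bounded_Ck a b False (Suc k) N (\<lambda>u. of_real (c * u powr r))"
    by (intro bounded_Ck_SucI)
  then show ?case using N0(1) by (intro exI[of _ N]) (auto simp: N_def)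
qed

text \<open>The chain rule turns \<open>h n \<circ> sqrt\<close> into
  \<open>h (Suc n) \<circ> sqrt\<close> times a fixed power of \<open>u\<close>, so the induction
  runs along a whole sequence of successive derivatives. \<open>K\<close> is chosen before
  \<open>h\<close>, which makes the final constants linear in the norm of \<open>g\<close>.\<close>

lemma bounded_Ck_sqrt:
  assumes ab: "0 < a" "a \<le> b"
  shows "\<exists>K\<ge>1. \<forall>h M n. (\<forall>i x. (h i has_vector_derivative h (Suc i) x) (at x)) \<longrightarrow>
    (\<forall>i\<le>n + k. \<forall>x. norm (h i x) \<le> M) \<longrightarrow> (\<forall>i. h i (sqrt a) = 0 \<and> h i (sqrt b) = 0) \<longrightarrow>
    bounded_Ck a b True k (K * M) (\<lambda>u. h n (sqrt u))"
proof (induction k)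
  case 0
  have "bounded_Ck a b True 0 (1 * M) (\<lambda>u. h n (sqrt u))"
    if "\<forall>i x. (h i has_vector_derivative h (Suc i) x) (at x)" "\<forall>i\<le>n. \<forall>x. norm (h i x) \<le> M"
      "\<forall>i. h i (sqrt a) = 0 \<and> h i (sqrt b) = 0" for h :: "nat \<Rightarrow> real \<Rightarrow> complex" and M n
  proof -
    have "continuous_on UNIV (h n)"
      using that(1) by (intro continuous_on_vector_derivative) auto
    then have "continuous_on {a..b} (\<lambda>u. h n (sqrt u))"
      by (rule continuous_on_compose2) (auto intro!: continuous_intros)
    then show ?thesis using that by auto
  qed
  then show ?case by (intro exI[of _ 1]) (simp del: bounded_Ck.simps)
next
  case (Suc k)
  obtain K where K: "1 \<le> K" and IH: "\<And>h M n. (\<forall>i x. (h i has_vector_derivative h (Suc i) x) (at x)) \<Longrightarrow>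
    (\<forall>i\<le>n + k. \<forall>x. norm (h i x) \<le> M) \<Longrightarrow> (\<forall>i. h i (sqrt a) = 0 \<and> h i (sqrt b) = 0) \<Longrightarrow>
    bounded_Ck a b True k (K * M) (\<lambda>u. h n (sqrt u))"
    using Suc.IH by blast
  obtain N where N: "0 \<le> N" "bounded_Ck a b False k N (\<lambda>u. of_real (1 / 2 * u powr (- 1 / 2)))"
    using bounded_Ck_powr[OF ab] by blast
  define K' where "K' = max K (2 ^ k * K * N)"
  have "bounded_Ck a b True (Suc k) (K' * M) (\<lambda>u. h n (sqrt u))"
    if h: "\<forall>i x. (h i has_vector_derivative h (Suc i) x) (at x)" and b: "\<forall>i\<le>n + Suc k. \<forall>x. norm (h i x) \<le> M"
      and z: "\<forall>i. h i (sqrt a) = 0 \<and> h i (sqrt b) = 0" for h :: "nat \<Rightarrow> real \<Rightarrow> complex" and M n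
  proof -
    have M: "0 \<le> M" using b order_trans[OF norm_ge_zero] by blast
    have K': "K * M \<le> K' * M" using M by (intro mult_right_mono) (auto simp: K'_def)
    have "bounded_Ck a b True k (K * M) (\<lambda>u. h n (sqrt u))"
      using h b z by (intro IH) auto
    from bounded_Ck_mono[OF bounded_Ck_0[OF this] K']
    have 0: "bounded_Ck a b True 0 (K' * M) (\<lambda>u. h n (sqrt u))" .
    have "bounded_Ck a b True k (K * M) (\<lambda>u. h (Suc n) (sqrt u))"
      using h b z by (intro IH) auto
    from bounded_Ck_mult[OF ab(2) this N(2)]
    have 1: "bounded_Ck a b True k (K' * M) (\<lambda>u. h (Suc n) (sqrt u) * of_real (1 / 2 * u powr (- 1 / 2)))"
    proof (rule bounded_Ck_mono)
      have "2 ^ k * K * N * M \<le> K' * M" using M by (intro mult_right_mono) (auto simp: K'_def)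
      then show "2 ^ k * (K * M) * N \<le> K' * M" by (simp add: mult_ac)
    qed
    have "((\<lambda>u. h n (sqrt u)) has_vector_derivative h (Suc n) (sqrt u) * of_real (1 / 2 * u powr (- 1 / 2)))
        (at u within {a..b})" if "u \<in> {a..b}" for u
    proof -
      have u: "0 < u" using that ab by simp
      have "(sqrt has_vector_derivative 1 / 2 * u powr (- 1 / 2)) (at u)"
        using DERIV_real_sqrt[OF u] u
        by (simp add: has_real_derivative_iff_has_vector_derivative powr_minus powr_half_sqrt divide_simps mult.commute)
      from vector_diff_chain_at[OF this] h
      have "((h n \<circ> sqrt) has_vector_derivative (1 / 2 * u powr (- 1 / 2)) *\<^sub>R h (Suc n) (sqrt u)) (at u)" by blast
      from has_vector_derivative_at_within[OF this] show ?thesis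
        by (simp only: o_def scaleR_conv_of_real mult.commute[of "of_real _" "h _ _"])
    qed
    then show ?thesis by (rule bounded_Ck_SucI[OF 0 1])
  qed
  moreover have "1 \<le> K'" using K by (simp add: K'_def)
  ultimately show ?case by blast
qed

section \<open>Iterated derivatives, supports, and comparison beyond the unit interval\<close>

lemma has_vector_derivative_nth_deriv:
  assumes "smooth_on S f" "x \<in> S"
  shows "(nth_deriv n f has_vector_derivative nth_deriv (Suc n) f x) (at x)"
  using assms by (simp add: smooth_on_def nth_deriv_def vector_derivative_works[symmetric])

lemma smooth_on_continuous:
  assumes "smooth_on S f"
  shows "continuous_on S (nth_deriv n f)"
  using assms by (auto simp: smooth_on_def intro!: continuous_at_imp_continuous_on differentiable_imp_continuous_within)

text \<open>Outside the support this is locality of derivatives; continuity carries it to the two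
  ends, which is what makes the boundary terms at \<open>u = 1/4\<close> and \<open>u = 4\<close>
  vanish.\<close>

lemma nth_deriv_zero_outside:
  assumes g: "smooth_on UNIV g" and supp: "tsupport g \<subseteq> {p..q}"
  shows "x \<le> p \<or> q \<le> x \<Longrightarrow> nth_deriv n g x = 0"
proof -
  have out: "nth_deriv n g x = 0" if "x < p \<or> q < x" for n x
    using that
  proof (induction n arbitrary: x)
    case 0
    then have "x \<notin> tsupport g" using supp by auto
    then have "x \<notin> {x. g x \<noteq> 0}" using closure_subset[of "{x. g x \<noteq> 0}"] by (auto simp: tsupport_def)
    then show ?case by (simp add: nth_deriv_def)
  next
    case (Suc n)
    have "((\<lambda>x. 0) has_vector_derivative nth_deriv (Suc n) g x) (at x)"
      using has_vector_derivative_nth_deriv[OF g, of x n]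
    proof (rule has_vector_derivative_transform_within_open)
      show "open (- {p..q})" by auto
    qed (use Suc in auto)
    then show ?case using vector_derivative_unique_at has_vector_derivative_const by blast
  qed
  have cl: "closed {x. nth_deriv n g x = 0}"
    using smooth_on_continuous[OF g] by (intro closed_Collect_eq continuous_intros)
  have "closure {..<p} \<subseteq> {x. nth_deriv n g x = 0}" "closure {q<..} \<subseteq> {x. nth_deriv n g x = 0}"
    by (rule closure_minimal; use out cl in auto)+
  then show "x \<le> p \<or> q \<le> x \<Longrightarrow> nth_deriv n g x = 0" by auto
qed

lemma norm_nth_deriv_le_Ck_norm:
  assumes g: "smooth_on UNIV g" and supp: "tsupport g \<subseteq> {p..q}" and j: "j \<le> k"
  shows "norm (nth_deriv j g x) \<le> Ck_norm k g"
proof -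
  have le: "norm (nth_deriv i g x) \<le> (SUP x. norm (nth_deriv i g x))" for i x
  proof (rule cSUP_upper)
    have "bounded (nth_deriv i g ` {p..q})"
      by (intro compact_imp_bounded compact_continuous_image continuous_on_subset[OF smooth_on_continuous[OF g]]) auto
    then obtain B where "\<forall>y\<in>nth_deriv i g ` {p..q}. norm y \<le> B" unfolding bounded_iff by blast
    then have "norm (nth_deriv i g x) \<le> max B 0" for x
      using nth_deriv_zero_outside[OF g supp, of x i] by (cases "x \<in> {p..q}") (auto simp: le_max_iff_disj)
    then show "bdd_above (range (\<lambda>x. norm (nth_deriv i g x)))" by (auto intro!: bdd_aboveI2)
  qed simp
  have "(SUP x. norm (nth_deriv j g x)) \<le> Ck_norm k g"
    unfolding Ck_norm_def using j order_trans[OF norm_ge_zero le] by (intro member_le_sum) auto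
  with le[of j x] show ?thesis by linarith
qed

text \<open>For lam above 1/2 the points \<open>lam\<^sup>2 * u\<close> leave the interval on which
  the behaviour of \<open>\<phi>\<close> is prescribed. On \<open>{1..R}\<close> the quotient
  \<open>A r / B r\<close> is continuous, so compactness bounds it.\<close>

lemma lesssim_on_extend:
  assumes "lesssim_on {0<..<1} A B" and c: "continuous_on {0<..} A" "continuous_on {0<..} B"
    and pos: "\<And>r. 1 \<le> r \<Longrightarrow> r \<le> R \<Longrightarrow> 0 < B r" and nn: "\<And>r. 0 \<le> B r"
  shows "lesssim_on {0<..R} A B"
proof -
  obtain C where C: "0 < C" "\<And>r. r \<in> {0<..<1} \<Longrightarrow> A r \<le> C * B r" using assms(1) unfolding lesssim_on_def by blast
  have "continuous_on {1..R} (\<lambda>r. A r / B r)"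
    using pos by (intro continuous_intros continuous_on_subset[OF c(1)] continuous_on_subset[OF c(2)]) force+
  then have "bounded ((\<lambda>r. A r / B r) ` {1..R})"
    by (intro compact_imp_bounded compact_continuous_image) auto
  then obtain D where D: "\<forall>y\<in>(\<lambda>r. A r / B r) ` {1..R}. norm y \<le> D" unfolding bounded_iff by blast
  have "A r \<le> max C D * B r" if "r \<in> {0<..R}" for r
  proof (cases "r < 1")
    case True
    then have "A r \<le> C * B r" using C that by simp
    also have "\<dots> \<le> max C D * B r" using nn by (intro mult_right_mono) auto
    finally show ?thesis .
  next
    case False
    then have r: "r \<in> {1..R}" using that by simp
    then have "norm (A r / B r) \<le> D" using D by blast
    then have "A r / B r \<le> D" by (simp only: real_norm_def abs_le_iff)
    then have "A r \<le> D * B r" using pos[of r] r by (simp add: pos_divide_le_eq)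
    also have "\<dots> \<le> max C D * B r" using nn by (intro mult_right_mono) auto
    finally show ?thesis .
  qed
  then show ?thesis unfolding lesssim_on_def using C(1) by (intro exI[of _ "max C D"]) auto
qed

lemma powr_bounds_quarter_four:
  fixes u x :: real
  assumes "u \<in> {1/4..4}"
  shows "u powr x \<le> 4 powr \<bar>x\<bar>" "4 powr - \<bar>x\<bar> \<le> u powr x"
proof -
  have "ln (1/4) \<le> ln u" "ln u \<le> ln 4" using assms by (auto intro!: ln_mono simp del: ln_div)
  then have "\<bar>ln u\<bar> \<le> ln 4" by (simp add: ln_div)
  then have "\<bar>x * ln u\<bar> \<le> \<bar>x\<bar> * ln 4" unfolding abs_mult by (intro mult_left_mono) auto
  then show "u powr x \<le> 4 powr \<bar>x\<bar>" "4 powr - \<bar>x\<bar> \<le> u powr x"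
    using assms by (auto simp: powr_def)
qed

subsection \<open>The decomposition\<close>

text \<open>Order \<open>n = 0\<close> is the rescaled phase and order \<open>n\<close> its
  \<open>n\<close>-th derivative in \<open>u\<close>, so that derivative bounds for
  \<open>\<phi>\<close> translate order by order.\<close>

definition rescaled_phase :: "(real \<Rightarrow> real) \<Rightarrow> real \<Rightarrow> real \<Rightarrow> nat \<Rightarrow> real \<Rightarrow> real" where
  "rescaled_phase \<phi> m lam n u = lam powr (- 2 * m) * (lam\<^sup>2) ^ n * nth_deriv n \<phi> (lam\<^sup>2 * u)"

lemma has_real_derivative_nth_deriv:
  assumes "smooth_on {0<..} \<phi>" "0 < r"
  shows "(nth_deriv n \<phi> has_real_derivative nth_deriv (Suc n) \<phi> r) (at r)"
  using has_vector_derivative_nth_deriv[OF assms(1), of r n] assms(2)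
  by (simp add: has_real_derivative_iff_has_vector_derivative)

lemma nth_deriv_dilation:
  assumes \<phi>: "smooth_on {0<..} \<phi>" and pos: "0 < q" "0 < u"
  shows "((\<lambda>u. nth_deriv n \<phi> (q * u)) has_real_derivative nth_deriv (Suc n) \<phi> (q * u) * q) (at u within S)"
proof -
  have "((\<lambda>u. q * u) has_real_derivative q) (at u)" by (auto intro!: derivative_eq_intros)
  from DERIV_chain2[OF has_real_derivative_nth_deriv[OF \<phi>] this] pos
  show ?thesis by (intro has_field_derivative_at_within[of _ _ _ S]) simp
qed

lemma rescaled_phase_deriv:
  assumes \<phi>: "smooth_on {0<..} \<phi>" and pos: "0 < lam" "0 < u"
  shows "(rescaled_phase \<phi> m lam n has_real_derivative rescaled_phase \<phi> m lam (Suc n) u) (at u within S)"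
proof -
  have "0 < lam\<^sup>2" using pos by simp
  from DERIV_cmult[OF nth_deriv_dilation[OF \<phi> this pos(2)], of "lam powr (- 2 * m) * (lam\<^sup>2) ^ n"]
  show ?thesis unfolding rescaled_phase_def[abs_def] by (simp add: mult_ac)
qed

lemma rescaled_phase_eq:
  assumes "0 < lam"
  shows "rescaled_phase \<phi> m lam n u = (lam\<^sup>2) powr (real n - m) * nth_deriv n \<phi> (lam\<^sup>2 * u)"
proof -
  have "(lam\<^sup>2) powr (real n - m) = lam powr (- 2 * m) * (lam\<^sup>2) ^ n"
  proof -
    have "(lam\<^sup>2) powr m = lam powr (2 * m)"
      using assms powr_powr[of lam 2 m] by simp
    moreover have "(lam\<^sup>2) powr real n = (lam\<^sup>2) ^ n" using assms by (intro powr_realpow) simp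
    ultimately show ?thesis unfolding powr_diff by (simp add: powr_minus divide_inverse mult.commute)
  qed
  then show ?thesis by (simp add: rescaled_phase_def)
qed

lemma scaled_powr:
  fixes q u x :: real
  assumes "0 < q" "0 < u"
  shows "q powr x * (q * u) powr (- x) = u powr (- x)"
  using assms by (simp add: powr_mult powr_minus field_simps)

text \<open>The bound for order \<open>n\<close> is homogeneous of degree \<open>m - real n\<close>,
  exactly opposite to the scaling factor. The powers of \<open>lam\<close> cancel, and only a power
  of \<open>u\<close> on \<open>{1/4..4}\<close> is left.\<close>

lemma rescaled_phase_upper:
  assumes "lesssim_on {0<..R} (\<lambda>r. \<bar>nth_deriv n \<phi> r\<bar>) (\<lambda>r. r powr (m - real n))"
  shows "\<exists>N>0. \<forall>lam u. 0 < lam \<longrightarrow> u \<in> {1/4..4} \<longrightarrow> lam\<^sup>2 * u \<le> R \<longrightarrow> \<bar>rescaled_phase \<phi> m lam n u\<bar> \<le> N"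
proof -
  obtain C where C: "0 < C" "\<And>r. r \<in> {0<..R} \<Longrightarrow> \<bar>nth_deriv n \<phi> r\<bar> \<le> C * r powr (m - real n)"
    using assms unfolding lesssim_on_def by blast
  have "\<bar>rescaled_phase \<phi> m lam n u\<bar> \<le> C * 4 powr \<bar>m - real n\<bar>"
    if "0 < lam" and u: "u \<in> {1/4..4}" and "lam\<^sup>2 * u \<le> R" for lam u
  proof -
    have pos: "0 < lam\<^sup>2" "0 < u" using that by auto
    have "\<bar>rescaled_phase \<phi> m lam n u\<bar> = (lam\<^sup>2) powr (real n - m) * \<bar>nth_deriv n \<phi> (lam\<^sup>2 * u)\<bar>"
      using that by (simp add: rescaled_phase_eq abs_mult)
    also have "\<dots> \<le> (lam\<^sup>2) powr (real n - m) * (C * (lam\<^sup>2 * u) powr (m - real n))"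
      using that pos by (intro mult_left_mono C(2)) auto
    also have "\<dots> = C * u powr (m - real n)"
      using scaled_powr[OF pos, of "real n - m"] by (simp add: mult_ac)
    also have "\<dots> \<le> C * 4 powr \<bar>m - real n\<bar>"
      using C(1) powr_bounds_quarter_four(1)[OF u] by (intro mult_left_mono) auto
    finally show ?thesis .
  qed
  then show ?thesis using C(1) by (intro exI[of _ "C * 4 powr \<bar>m - real n\<bar>"]) auto
qed

text \<open>The same cancellation from below, for a general exponent: it serves the first derivative
  with \<open>x = 1 - m\<close> and the second with \<open>x = 2 - \<alpha>\<close>.\<close>

lemma rescaled_lower:
  assumes "lesssim_on {0<..R} (\<lambda>r. r powr - x) (\<lambda>r. \<bar>f r\<bar>)"
  shows "\<exists>c>0. \<forall>lam u. 0 < lam \<longrightarrow> u \<in> {1/4..4} \<longrightarrow> lam\<^sup>2 * u \<le> R \<longrightarrow> c \<le> (lam\<^sup>2) powr x * \<bar>f (lam\<^sup>2 * u)\<bar>"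
proof -
  obtain C where C: "0 < C" "\<And>r. r \<in> {0<..R} \<Longrightarrow> r powr - x \<le> C * \<bar>f r\<bar>"
    using assms unfolding lesssim_on_def by blast
  have "4 powr - \<bar>x\<bar> / C \<le> (lam\<^sup>2) powr x * \<bar>f (lam\<^sup>2 * u)\<bar>"
    if "0 < lam" and u: "u \<in> {1/4..4}" and "lam\<^sup>2 * u \<le> R" for lam u
  proof -
    have pos: "0 < lam\<^sup>2" "0 < u" using that by auto
    have "4 powr - \<bar>x\<bar> \<le> u powr - x" using powr_bounds_quarter_four(2)[OF u, of "- x"] by simp
    also have "\<dots> = (lam\<^sup>2) powr x * (lam\<^sup>2 * u) powr - x" using scaled_powr[OF pos] by simp
    also have "\<dots> \<le> (lam\<^sup>2) powr x * (C * \<bar>f (lam\<^sup>2 * u)\<bar>)"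
      using that pos by (intro mult_left_mono C(2)) auto
    finally show ?thesis using C(1) by (simp add: field_simps)
  qed
  then show ?thesis using C(1) by (intro exI[of _ "4 powr - \<bar>x\<bar> / C"]) auto
qed

text \<open>The factor \<open>1 / (2 * pi)\<close> is that of Fourier inversion, and the exponent is
  \<open>T * (\<psi> u - s * u)\<close> in the rescaled variables.\<close>

definition amplitude ::
  "(real \<Rightarrow> real) \<Rightarrow> real \<Rightarrow> (real \<Rightarrow> real) \<Rightarrow> (real \<Rightarrow> complex) \<Rightarrow> real \<Rightarrow> real \<Rightarrow> real \<Rightarrow> complex" where
  "amplitude \<phi> m \<theta> g t lam s = of_real (\<theta> s / (2 * pi)) *
     integral {1/4..4} (\<lambda>u. g (sqrt u) * cis (t * \<phi> (lam\<^sup>2 * u) - t * lam powr (2 * m) * s * u))"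

text \<open>Taken as whatever the integral term leaves over: the decomposition then holds by
  definition, and the content lies in the support and the bounds.\<close>

definition remainder ::
  "(real \<Rightarrow> real) \<Rightarrow> (real \<Rightarrow> complex) \<Rightarrow> real \<Rightarrow> (real \<Rightarrow> real) \<Rightarrow> (real \<Rightarrow> complex) \<Rightarrow> real \<Rightarrow> real \<Rightarrow> real \<Rightarrow> complex" where
  "remainder \<phi> \<eta> m \<theta> g t lam x = g (sqrt x / lam) * exp (\<i> * of_real (t * \<phi> x)) -
     of_real (t * lam powr (2 * m)) * \<eta> (x / lam\<^sup>2) *
       (LBINT s. exp (\<i> * of_real (x * t * lam powr (2 * m - 2) * s)) * amplitude \<phi> m \<theta> g t lam s)"

lemma continuous_on_rescaled:
  fixes \<phi> :: "real \<Rightarrow> 'a::topological_space" and lam :: real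
  assumes "continuous_on {0<..} \<phi>" "0 < lam"
  shows "continuous_on {1/4..4} (\<lambda>u. \<phi> (lam\<^sup>2 * u))"
proof (rule continuous_on_compose2[OF assms(1)])
  show "(\<lambda>u. lam\<^sup>2 * u) ` {1/4..4} \<subseteq> {0<..}"
    using assms(2) by (intro image_subsetI) simp
qed (intro continuous_intros)

lemma amplitude_continuous:
  assumes \<phi>: "continuous_on {0<..} \<phi>" and g: "continuous_on UNIV g" and \<theta>: "continuous_on UNIV \<theta>" and lam: "0 < lam"
  shows "continuous_on A (amplitude \<phi> m \<theta> g t lam)"
proof -
  have "continuous_on (UNIV \<times> cbox (1/4) 4)
      (\<lambda>(s, u). g (sqrt u) * cis (t * \<phi> (lam\<^sup>2 * u) - t * lam powr (2 * m) * s * u))"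
    unfolding case_prod_beta
    by (intro continuous_intros continuous_on_compose2[OF g] continuous_on_compose2[OF continuous_on_rescaled[OF \<phi> lam]]) auto
  from integral_continuous_on_param[OF this]
  have "continuous_on UNIV (\<lambda>s. integral {1/4..4} (\<lambda>u. g (sqrt u) * cis (t * \<phi> (lam\<^sup>2 * u) - t * lam powr (2 * m) * s * u)))"
    by simp
  from continuous_on_subset[OF this] show ?thesis
    unfolding amplitude_def[abs_def]
    by (intro continuous_intros continuous_on_subset[OF \<theta>]) auto
qed

text \<open>With \<open>y = x / lam\<^sup>2\<close> and \<open>T = t * lam powr (2 * m)\<close> one
  has \<open>x * t * lam powr (2 * m - 2) = T * y\<close>, so the two exponentials combine to the
  phase of \<open>osc_integral\<close>.\<close>

lemma integral_amplitude:
  assumes \<phi>: "continuous_on {0<..} \<phi>" and g: "continuous_on UNIV g" and \<theta>: "continuous_on UNIV \<theta>"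
    and z: "\<And>s. L \<le> \<bar>s\<bar> \<Longrightarrow> \<theta> s = 0" and lam: "0 < lam"
  shows "(LBINT s. exp (\<i> * of_real (x * t * lam powr (2 * m - 2) * s)) * amplitude \<phi> m \<theta> g t lam s) =
    of_real (1 / (2 * pi)) * osc_integral \<theta> L (1/4) 4 0 (rescaled_phase \<phi> m lam 0) \<psi>' (t * lam powr (2 * m)) (x / lam\<^sup>2) (\<lambda>u. g (sqrt u))"
proof -
  let ?T = "t * lam powr (2 * m)"
  let ?f = "\<lambda>s. exp (\<i> * of_real (x * t * lam powr (2 * m - 2) * s)) * amplitude \<phi> m \<theta> g t lam s"
  let ?G = "\<lambda>s u. of_real (\<theta> s / (s - \<psi>' u) ^ 0) * g (sqrt u) *
      cis (?T * (rescaled_phase \<phi> m lam 0 u + (x / lam\<^sup>2 - u) * s))"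
  have zero: "?f s = 0" if "s \<notin> {-L..L}" for s
    using z[of s] that by (auto simp: amplitude_def)
  have "(LBINT s. ?f s) = (LBINT s:{-L..L}. ?f s)"
    unfolding set_lebesgue_integral_def
    by (intro Bochner_Integration.integral_cong refl) (use zero in \<open>auto simp: indicator_def\<close>)
  also have "\<dots> = integral {-L..L} ?f"
    by (intro set_borel_integral_eq_integral borel_integrable_atLeastAtMost' continuous_intros
        amplitude_continuous[OF \<phi> g \<theta> lam])
  also have "\<dots> = integral {-L..L} (\<lambda>s. of_real (1 / (2 * pi)) * integral {1/4..4} (?G s))"
  proof (intro integral_cong)
    fix s
    have T: "?T * rescaled_phase \<phi> m lam 0 u = t * \<phi> (lam\<^sup>2 * u)" for u
      using lam by (simp add: rescaled_phase_def nth_deriv_def powr_minus)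
    have e: "exp (\<i> * of_real (x * t * lam powr (2 * m - 2) * s)) = cis (?T * (x / lam\<^sup>2) * s)"
      using lam by (simp add: cis_conv_exp powr_diff mult_ac)
    have "?G s u = of_real (\<theta> s) * cis (?T * (x / lam\<^sup>2) * s) *
        (g (sqrt u) * cis (t * \<phi> (lam\<^sup>2 * u) - ?T * s * u))" for u
    proof -
      have "?T * (rescaled_phase \<phi> m lam 0 u + (x / lam\<^sup>2 - u) * s) =
          ?T * (x / lam\<^sup>2) * s + (t * \<phi> (lam\<^sup>2 * u) - ?T * s * u)"
        unfolding T[symmetric] by (simp add: algebra_simps)
      then show ?thesis by (simp only: cis_mult[symmetric] power_0 div_by_1 mult_ac)
    qed
    then have G: "integral {1/4..4} (?G s) = of_real (\<theta> s) * cis (?T * (x / lam\<^sup>2) * s) *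
        integral {1/4..4} (\<lambda>u. g (sqrt u) * cis (t * \<phi> (lam\<^sup>2 * u) - ?T * s * u))"
      by (simp only: integral_mult_right)
    show "?f s = of_real (1 / (2 * pi)) * integral {1/4..4} (?G s)"
      unfolding e amplitude_def G by (simp add: field_simps)
  qed
  also have "\<dots> = of_real (1 / (2 * pi)) * integral {-L..L} (\<lambda>s. integral {1/4..4} (?G s))"
    by (rule integral_mult_right)
  finally show ?thesis unfolding osc_integral_def .
qed

text \<open>\<open>4 * lam\<^sup>2 \<le> R\<close> keeps \<open>lam\<^sup>2 * u\<close> in the range
  where \<open>\<phi>\<close> is controlled, for all \<open>u\<close> in \<open>{1/4..4}\<close>.
  The cutoff and all constants are obtained before \<open>g\<close>, \<open>t\<close> and
  \<open>lam\<close>.\<close>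

lemma remainder_bounds:
  assumes \<phi>: "smooth_on {0<..} \<phi>"
    and upper: "\<And>n. 1 \<le> n \<Longrightarrow> lesssim_on {0<..R} (\<lambda>r. \<bar>nth_deriv n \<phi> r\<bar>) (\<lambda>r. r powr (m - real n))"
    and lower: "lesssim_on {0<..R} (\<lambda>r. r powr (m - 1)) (\<lambda>r. \<bar>nth_deriv 1 \<phi> r\<bar>)"
    and sign: "\<bar>\<sigma>\<bar> = 1" "\<And>r. r \<in> {0<..R} \<Longrightarrow> 0 \<le> \<sigma> * nth_deriv 1 \<phi> r"
    and \<eta>: "smooth_on UNIV \<eta>" "tsupport \<eta> \<subseteq> {1/5..5}" "\<And>x. x \<in> {1/4..4} \<Longrightarrow> \<eta> x = 1"
  obtains \<theta> c0 B C where "1 < c0" "continuous_on UNIV \<theta>" "\<forall>s. \<bar>\<theta> s\<bar> \<le> B"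
    "\<forall>s. \<theta> s \<noteq> 0 \<longrightarrow> s \<in> (\<lambda>s. \<sigma> * s) ` {2 / c0..2 * c0}"
    "\<forall>g t lam. smooth_on UNIV g \<and> tsupport g \<subseteq> {1/2..2} \<and> 0 < t \<and> 0 < lam \<and> 4 * lam\<^sup>2 \<le> R \<longrightarrow>
      (\<forall>x. x \<notin> {lam\<^sup>2 / 5..5 * lam\<^sup>2} \<longrightarrow> remainder \<phi> \<eta> m \<theta> g t lam x = 0) \<and>
      (\<forall>k x. norm (remainder \<phi> \<eta> m \<theta> g t lam x) \<le> C k * Ck_norm k g / (t * lam powr (2 * m)) ^ k)"
proof -
  let ?\<psi> = "rescaled_phase \<phi> m"
  let ?I = "{1/4..4::real}"
  define ok where "ok lam \<longleftrightarrow> 0 < lam \<and> 4 * lam\<^sup>2 \<le> R" for lam :: real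
  have okR: "lam\<^sup>2 * u \<in> {0<..R}" if "ok lam" "u \<in> ?I" for lam u
  proof -
    have "lam\<^sup>2 * u \<le> 4 * lam\<^sup>2" using mult_left_mono[of u 4 "lam\<^sup>2"] that by simp
    then have "lam\<^sup>2 * u \<le> R" using that unfolding ok_def by linarith
    then show ?thesis using that by (auto simp: ok_def)
  qed
  obtain N where N: "\<And>n. 1 \<le> n \<Longrightarrow> 0 < N n"
    "\<And>n lam u. 1 \<le> n \<Longrightarrow> ok lam \<Longrightarrow> u \<in> ?I \<Longrightarrow> \<bar>?\<psi> lam n u\<bar> \<le> N n"
  proof -
    have "\<forall>n. \<exists>N. 1 \<le> n \<longrightarrow> 0 < N \<and> (\<forall>lam u. ok lam \<longrightarrow> u \<in> ?I \<longrightarrow> \<bar>?\<psi> lam n u\<bar> \<le> N)"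
    proof
      fix n show "\<exists>N. 1 \<le> n \<longrightarrow> 0 < N \<and> (\<forall>lam u. ok lam \<longrightarrow> u \<in> ?I \<longrightarrow> \<bar>?\<psi> lam n u\<bar> \<le> N)"
      proof (cases "1 \<le> n")
        case True
        from rescaled_phase_upper[OF upper[OF this]] okR show ?thesis
          unfolding ok_def by (metis greaterThanAtMost_iff)
      qed auto
    qed
    from choice[OF this] that show ?thesis by blast
  qed
  obtain c1 where c1: "0 < c1" "\<And>lam u. ok lam \<Longrightarrow> u \<in> ?I \<Longrightarrow> c1 \<le> \<bar>?\<psi> lam 1 u\<bar>"
  proof -
    have "lesssim_on {0<..R} (\<lambda>r. r powr - (1 - m)) (\<lambda>r. \<bar>nth_deriv 1 \<phi> r\<bar>)"
      using lower by simp
    from rescaled_lower[OF this] obtain c where c: "0 < c" "\<And>lam u. 0 < lam \<Longrightarrow> u \<in> ?I \<Longrightarrow> lam\<^sup>2 * u \<le> R \<Longrightarrow>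
        c \<le> (lam\<^sup>2) powr (1 - m) * \<bar>nth_deriv 1 \<phi> (lam\<^sup>2 * u)\<bar>" by blast
    show ?thesis
    proof (rule that[OF c(1)])
      fix lam u assume *: "ok lam" "u \<in> ?I"
      then show "c \<le> \<bar>?\<psi> lam 1 u\<bar>"
        using c(2)[of lam u] okR[OF *] by (simp add: rescaled_phase_eq ok_def abs_mult)
    qed
  qed
  define P where "P = N 1"
  have P: "0 < P" "\<And>lam u. ok lam \<Longrightarrow> u \<in> ?I \<Longrightarrow> \<bar>?\<psi> lam 1 u\<bar> \<le> P" using N(1,2)[of 1] by (auto simp: P_def)
  have sgn\<psi>: "\<sigma> * ?\<psi> lam 1 u = \<bar>?\<psi> lam 1 u\<bar>" if "ok lam" "u \<in> ?I" for lam u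
  proof -
    have "\<sigma> * ?\<psi> lam 1 u = (lam\<^sup>2) powr (1 - m) * (\<sigma> * nth_deriv 1 \<phi> (lam\<^sup>2 * u))"
      using that by (simp add: rescaled_phase_eq ok_def)
    also have "0 \<le> \<dots>" by (intro mult_nonneg_nonneg powr_ge_zero sign(2) okR that)
    finally (xtrans) have "0 \<le> \<sigma> * ?\<psi> lam 1 u" .
    then show ?thesis using sign(1) by (metis abs_mult abs_of_nonneg mult_1)
  qed
  \<comment> \<open>The modulus of the rescaled first derivative lies in \<open>[c1, P]\<close>;
    \<open>\<theta>0\<close> is 1 on the neighbourhood of radius \<open>c1 / 2\<close> intersected
    with the whole range and still stays away from 0. The argument \<open>\<sigma> * s\<close> then
    reflects it to the sign of the derivative.\<close>
  obtain \<theta>0 where \<theta>0: "C2 \<theta>0" "\<And>s. c1 / 2 \<le> s \<Longrightarrow> s \<le> P + c1 / 2 \<Longrightarrow> \<theta>0 s = 1"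
    "\<And>s. s \<le> c1 / 4 \<or> P + c1 \<le> s \<Longrightarrow> \<theta>0 s = 0"
    by (rule C2_cutoff_exists[of "c1 / 4" "c1 / 2" "P + c1 / 2" "P + c1"]) (use c1(1) P(1) in auto)
  define \<theta> where "\<theta> s = \<theta>0 (\<sigma> * s)" for s
  have \<theta>: "C2 \<theta>" unfolding \<theta>_def using C2_affine[OF \<theta>0(1), of \<sigma> 0] by simp
  have \<theta>c: "continuous_on UNIV \<theta>" using \<theta> by (rule C2E)
  have \<sigma>: "\<sigma> = 1 \<or> \<sigma> = -1" using sign(1) by linarith
  have \<theta>z: "\<theta> s = 0" if "P + c1 \<le> \<bar>s\<bar>" for s
    unfolding \<theta>_def using that \<sigma> c1(1) P(1) by (intro \<theta>0(3)) (auto simp: abs_if split: if_splits)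
  obtain B where B: "0 \<le> B" "\<And>s. \<bar>\<theta> s\<bar> \<le> B"
    by (rule C2_compact_support[OF \<theta>, of "P + c1"]) (use \<theta>z c1(1) P(1) in auto)
  define d where "d = c1 / 2"
  have d: "0 < d" using c1(1) by (simp add: d_def)
  have near: "\<theta> s = 1" if "ok lam" "u \<in> ?I" "\<bar>s - ?\<psi> lam 1 u\<bar> < d" for lam u s
  proof -
    have "\<bar>\<sigma> * s - \<sigma> * ?\<psi> lam 1 u\<bar> < d"
      using that(3) sign(1) by (simp add: right_diff_distrib[symmetric] abs_mult)
    then have "\<bar>\<sigma> * s - \<bar>?\<psi> lam 1 u\<bar>\<bar> < c1 / 2" unfolding sgn\<psi>[OF that(1,2)] d_def .
    then show ?thesis unfolding \<theta>_def using c1(2)[OF that(1,2)] P(2)[OF that(1,2)]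
      by (intro \<theta>0(2)) linarith+
  qed
  \<comment> \<open>Exceeds both the support radius \<open>P + c1\<close> of \<open>\<theta>\<close>
    and the \<open>2 * (P + d + 1)\<close> that the dilated cutoffs require. The value of
    \<open>c0\<close> makes \<open>2 / c0 \<le> c1 / 4\<close> and
    \<open>P + c1 \<le> 2 * c0\<close>.\<close>
  define L where "L = 2 * (P + d + 1) + (P + c1)"
  define c0 where "c0 = max 2 (max (8 / c1) (P + c1))"
  obtain E where E: "0 \<le> E" "\<And>y. norm (\<eta> y) \<le> E"
  proof -
    have "norm (\<eta> y) \<le> Ck_norm 0 \<eta>" for y
      using norm_nth_deriv_le_Ck_norm[OF \<eta>(1,2), of 0 0 y] by (simp add: nth_deriv_def)
    moreover from this[of 0] have "0 \<le> Ck_norm 0 \<eta>" using norm_ge_zero order_trans by blast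
    ultimately show ?thesis using that by blast
  qed
  have \<eta>z: "\<eta> y = 0" if "y \<notin> {1/5..5}" for y
  proof -
    have "y \<notin> closure {x. \<eta> x \<noteq> 0}" using \<eta>(2) that unfolding tsupport_def by blast
    then show ?thesis using closure_subset[of "{x. \<eta> x \<noteq> 0}"] by auto
  qed
  \<comment> \<open>A common bound for the second derivative of the rescaled phase and its first
    \<open>k\<close> derivatives, that is for the orders 2 to \<open>k + 2\<close>.\<close>
  define NN where "NN k = (\<Sum>i\<le>k. N (2 + i))" for k
  have NN: "N (2 + i) \<le> NN k" if "i \<le> k" for i k
    unfolding NN_def using that N(1)[of "2 + _"] by (intro member_le_sum) (auto intro: less_imp_le)
  have phase: "phase (1/4) 4 k (NN k) (?\<psi> lam 0) (?\<psi> lam 1)" if lam: "ok lam" for lam k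
  proof -
    have d: "(?\<psi> lam n has_real_derivative ?\<psi> lam (Suc n) u) (at u within ?I)" if "u \<in> ?I" for n u
      using lam that by (intro rescaled_phase_deriv[OF \<phi>]) (auto simp: ok_def)
    have "bounded_Ck (1/4) 4 False k (NN k) (\<lambda>u. of_real (?\<psi> lam 2 u))"
    proof (rule bounded_Ck_family[where h = "\<lambda>i u. of_real (?\<psi> lam i u)"])
      show "((\<lambda>u. of_real (?\<psi> lam i u) :: complex) has_vector_derivative of_real (?\<psi> lam (Suc i) u)) (at u within ?I)"
        if "u \<in> ?I" for i u
        using d[OF that] by (rule has_vector_derivative_of_real)
      show "norm (of_real (?\<psi> lam i u) :: complex) \<le> NN k" if "2 \<le> i" "i \<le> 2 + k" "u \<in> ?I" for i u
      proof -
        have "i - 2 \<le> k" using that by simp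
        from NN[OF this] have "N i \<le> NN k" using that by (simp only: le_add_diff_inverse)
        with N(2)[of i lam u] that lam show ?thesis by simp
      qed
    qed
    moreover have "\<forall>u\<in>?I. (?\<psi> lam 0 has_real_derivative ?\<psi> lam 1 u) (at u within ?I)"
      "\<forall>u\<in>?I. (?\<psi> lam 1 has_real_derivative ?\<psi> lam 2 u) (at u within ?I)"
      using d[of _ 0] d[of _ 1] by (auto simp: numeral_2_eq_2)
    ultimately show ?thesis unfolding phase_def by blast
  qed
  have ex: "\<forall>k. \<exists>C\<ge>0. \<forall>\<psi> \<psi>' \<tau> y v M. phase (1/4) 4 k (NN k) \<psi> \<psi>' \<longrightarrow>
      (\<forall>u\<in>?I. \<bar>\<psi>' u\<bar> \<le> P \<and> (\<forall>s. \<bar>s - \<psi>' u\<bar> < d \<longrightarrow> \<theta> s = 1)) \<longrightarrow> 0 < \<tau> \<longrightarrow>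
      bounded_Ck (1/4) 4 True k M v \<longrightarrow>
      norm (2 * of_real pi * (if y \<in> ?I then v y * cis (\<tau> * \<psi> y) else 0) -
        of_real \<tau> * osc_integral \<theta> L (1/4) 4 0 \<psi> \<psi>' \<tau> y v) \<le> C * M / \<tau> ^ k"
  proof
    fix k
    have "0 \<le> NN k" using NN[of 0 k] N(1)[of 2] by simp
    then show "\<exists>C\<ge>0. \<forall>\<psi> \<psi>' \<tau> y v M. phase (1/4) 4 k (NN k) \<psi> \<psi>' \<longrightarrow>
      (\<forall>u\<in>?I. \<bar>\<psi>' u\<bar> \<le> P \<and> (\<forall>s. \<bar>s - \<psi>' u\<bar> < d \<longrightarrow> \<theta> s = 1)) \<longrightarrow> 0 < \<tau> \<longrightarrow>
      bounded_Ck (1/4) 4 True k M v \<longrightarrow>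
      norm (2 * of_real pi * (if y \<in> ?I then v y * cis (\<tau> * \<psi> y) else 0) -
        of_real \<tau> * osc_integral \<theta> L (1/4) 4 0 \<psi> \<psi>' \<tau> y v) \<le> C * M / \<tau> ^ k"
      using c1(1) P(1) d \<theta>z by (intro frequency_localization[OF \<theta>, of "P + c1"]) (auto simp: L_def)
  qed
  obtain CF where CF: "\<And>k. 0 \<le> CF k" "\<And>k \<psi> \<psi>' \<tau> y v M. phase (1/4) 4 k (NN k) \<psi> \<psi>' \<Longrightarrow>
      (\<forall>u\<in>?I. \<bar>\<psi>' u\<bar> \<le> P \<and> (\<forall>s. \<bar>s - \<psi>' u\<bar> < d \<longrightarrow> \<theta> s = 1)) \<Longrightarrow> 0 < \<tau> \<Longrightarrow>
      bounded_Ck (1/4) 4 True k M v \<Longrightarrow>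
      norm (2 * of_real pi * (if y \<in> ?I then v y * cis (\<tau> * \<psi> y) else 0) -
        of_real \<tau> * osc_integral \<theta> L (1/4) 4 0 \<psi> \<psi>' \<tau> y v) \<le> CF k * M / \<tau> ^ k"
    using choice[OF ex] by blast
  have "\<forall>k. \<exists>K\<ge>0. \<forall>g. smooth_on UNIV g \<longrightarrow> tsupport g \<subseteq> {1/2..2} \<longrightarrow>
      bounded_Ck (1/4) 4 True k (K * Ck_norm k g) (\<lambda>u. g (sqrt u))"
  proof
    fix k
    obtain K where K: "1 \<le> K" "\<And>h M n. (\<forall>i x. (h i has_vector_derivative h (Suc i) x) (at x)) \<Longrightarrow>
      (\<forall>i\<le>n + k. \<forall>x. norm (h i x) \<le> M) \<Longrightarrow> (\<forall>i. h i (sqrt (1/4)) = 0 \<and> h i (sqrt 4) = 0) \<Longrightarrow>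
      bounded_Ck (1/4) 4 True k (K * M) (\<lambda>u. h n (sqrt u))"
      using bounded_Ck_sqrt[of "1/4" 4 k] by auto
    have s4: "sqrt (1/4) = 1/2" "sqrt 4 = (2::real)" by (auto simp: real_sqrt_divide)
    have "bounded_Ck (1/4) 4 True k (K * Ck_norm k g) (\<lambda>u. g (sqrt u))"
      if g: "smooth_on UNIV g" "tsupport g \<subseteq> {1/2..2}" for g :: "real \<Rightarrow> complex"
    proof -
      have "bounded_Ck (1/4) 4 True k (K * Ck_norm k g) (\<lambda>u. nth_deriv 0 g (sqrt u))"
      proof (rule K(2)[where h = "\<lambda>i. nth_deriv i g"])
        show "\<forall>i x. (nth_deriv i g has_vector_derivative nth_deriv (Suc i) g x) (at x)"
          using has_vector_derivative_nth_deriv[OF g(1)] by blast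
        show "\<forall>i\<le>0 + k. \<forall>x. norm (nth_deriv i g x) \<le> Ck_norm k g"
          using norm_nth_deriv_le_Ck_norm[OF g] by simp
        show "\<forall>i. nth_deriv i g (sqrt (1/4)) = 0 \<and> nth_deriv i g (sqrt 4) = 0"
          unfolding s4 using nth_deriv_zero_outside[OF g] by simp
      qed
      then show ?thesis by (simp add: nth_deriv_def)
    qed
    then show "\<exists>K\<ge>0. \<forall>g. smooth_on UNIV g \<longrightarrow> tsupport g \<subseteq> {1/2..2} \<longrightarrow>
      bounded_Ck (1/4) 4 True k (K * Ck_norm k g) (\<lambda>u. g (sqrt u))"
      using K(1) by (intro exI[of _ K]) auto
  qed
  from choice[OF this] obtain K where K: "\<And>k. 0 \<le> K k"
    "\<And>k g. smooth_on UNIV g \<Longrightarrow> tsupport g \<subseteq> {1/2..2} \<Longrightarrow>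
      bounded_Ck (1/4) 4 True k (K k * Ck_norm k g) (\<lambda>u. g (sqrt u))" by blast
  define C where "C k = E * (CF k * K k)" for k
  have outside: "remainder \<phi> \<eta> m \<theta> g t lam x = 0"
    if g: "smooth_on UNIV g" "tsupport g \<subseteq> {1/2..2}" and "0 < lam" and x: "x \<notin> {lam\<^sup>2 / 5..5 * lam\<^sup>2}" for g t lam x
  proof -
    have lam2: "0 < lam\<^sup>2" using that by simp
    have "\<eta> (x / lam\<^sup>2) = 0" using x lam2 by (intro \<eta>z) (auto simp: field_simps)
    moreover have "g (sqrt x / lam) = 0"
    proof -
      have "sqrt x / lam \<le> 1/2 \<or> 2 \<le> sqrt x / lam"
      proof (rule ccontr)
        assume "\<not> ?thesis"
        then have s: "lam / 2 < sqrt x" "sqrt x < 2 * lam" using \<open>0 < lam\<close> by (auto simp: field_simps)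
        have "0 < lam / 2" using \<open>0 < lam\<close> by simp
        then have "0 < sqrt x" using s(1) by (rule less_trans)
        then have x0: "0 < x" by simp
        have "(lam / 2)\<^sup>2 < (sqrt x)\<^sup>2"
          by (rule power_strict_mono[OF s(1)]) (use \<open>0 < lam\<close> in auto)
        moreover have "(sqrt x)\<^sup>2 < (2 * lam)\<^sup>2"
          by (rule power_strict_mono[OF s(2)]) (use x0 in auto)
        ultimately have "lam\<^sup>2 / 4 < x" "x < 4 * lam\<^sup>2" using x0 by (auto simp: power_divide power_mult_distrib)
        then show False using x lam2 by auto
      qed
      then show ?thesis using nth_deriv_zero_outside[OF g, of _ 0] by (simp add: nth_deriv_def)
    qed
    ultimately show ?thesis by (simp add: remainder_def)
  qed
  have bound: "norm (remainder \<phi> \<eta> m \<theta> g t lam x) \<le> C k * Ck_norm k g / (t * lam powr (2 * m)) ^ k"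
    if g: "smooth_on UNIV g" "tsupport g \<subseteq> {1/2..2}" and t: "0 < t" and lam: "0 < lam" "4 * lam\<^sup>2 \<le> R" for g t lam x k
  proof (cases "x \<in> {lam\<^sup>2 / 5..5 * lam\<^sup>2}")
    case False
    have "0 \<le> Ck_norm k g" using norm_nth_deriv_le_Ck_norm[OF g, of 0 k] norm_ge_zero order_trans by blast
    then show ?thesis using outside[OF g lam(1) False] t E(1) CF(1) K(1) by (simp add: C_def)
  next
    case True
    define T where "T = t * lam powr (2 * m)"
    define y where "y = x / lam\<^sup>2"
    have lam2: "0 < lam\<^sup>2" using lam by simp
    have T: "0 < T" using t lam by (simp add: T_def)
    have ok: "ok lam" using lam by (simp add: ok_def)
    have x: "0 < x" using True lam2 by (auto intro: less_le_trans[of 0 "lam\<^sup>2 / 5"])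
    have xy: "x = lam\<^sup>2 * y" using lam2 by (simp add: y_def)
    have sy: "sqrt x / lam = sqrt y" using lam by (simp add: xy real_sqrt_mult)
    have gc: "continuous_on UNIV g" "continuous_on {0<..} \<phi>"
      using smooth_on_continuous[OF g(1), of 0] smooth_on_continuous[OF \<phi>, of 0] by (auto simp: nth_deriv_def)
    have J: "(LBINT s. exp (\<i> * of_real (x * t * lam powr (2 * m - 2) * s)) * amplitude \<phi> m \<theta> g t lam s) =
        of_real (1 / (2 * pi)) * osc_integral \<theta> L (1/4) 4 0 (?\<psi> lam 0) (?\<psi> lam 1) T y (\<lambda>u. g (sqrt u))"
      unfolding T_def y_def by (rule integral_amplitude[OF gc(2,1) \<theta>c _ lam(1)])
        (use \<theta>z P(1) c1(1) d in \<open>auto simp: L_def\<close>)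
    define F where "F = (if y \<in> ?I then g (sqrt y) * cis (T * ?\<psi> lam 0 y) else 0)"
    \<comment> \<open>The factor \<open>\<eta> y\<close> may be inserted in front of
      \<open>F\<close>: it is 1 on \<open>{1/4..4}\<close>, and \<open>g (sqrt y)\<close> vanishes
      elsewhere.\<close>
    have F: "g (sqrt x / lam) * exp (\<i> * of_real (t * \<phi> x)) = \<eta> y * F"
    proof (cases "y \<in> ?I")
      case True
      have "T * ?\<psi> lam 0 y = t * \<phi> x"
        using lam by (simp add: T_def rescaled_phase_def nth_deriv_def powr_minus xy)
      then show ?thesis using True \<eta>(3) unfolding F_def sy by (simp add: cis_conv_exp)
    next
      case False
      have "sqrt y \<le> 1/2 \<or> 2 \<le> sqrt y"
      proof -
        from False consider "y \<le> (1/2)\<^sup>2" | "2\<^sup>2 \<le> y" by (fastforce simp: power2_eq_square)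
        then show ?thesis
        proof cases
          case 1
          from real_sqrt_le_mono[OF this] show ?thesis by (simp only: real_sqrt_abs) simp
        next
          case 2
          from real_sqrt_le_mono[OF this] show ?thesis by (simp only: real_sqrt_abs) simp
        qed
      qed
      then have "g (sqrt y) = 0" using nth_deriv_zero_outside[OF g, of _ 0] by (simp add: nth_deriv_def)
      then show ?thesis using False unfolding F_def sy by simp
    qed
    have rem: "remainder \<phi> \<eta> m \<theta> g t lam x = of_real (1 / (2 * pi)) * \<eta> y *
        (2 * of_real pi * F - of_real T * osc_integral \<theta> L (1/4) 4 0 (?\<psi> lam 0) (?\<psi> lam 1) T y (\<lambda>u. g (sqrt u)))"
      unfolding remainder_def J F T_def[symmetric] y_def[symmetric] by (simp add: field_simps)
    have main: "norm (2 * of_real pi * F - of_real T * osc_integral \<theta> L (1/4) 4 0 (?\<psi> lam 0) (?\<psi> lam 1) T y (\<lambda>u. g (sqrt u)))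
        \<le> CF k * (K k * Ck_norm k g) / T ^ k"
      unfolding F_def using P(2)[OF ok] near[OF ok]
      by (intro CF(2) phase[OF ok] T K(2) g) blast
    have "norm (of_real (1 / (2 * pi)) * \<eta> y) \<le> 1 * E"
      unfolding norm_mult using E(2)[of y] pi_gt3 by (intro mult_mono) (auto simp: norm_divide divide_le_eq)
    then have "norm (remainder \<phi> \<eta> m \<theta> g t lam x) \<le> E * (CF k * (K k * Ck_norm k g) / T ^ k)"
      unfolding rem norm_mult[of "_ * \<eta> y"] using main E(1) by (intro mult_mono) auto
    then show ?thesis by (simp add: C_def T_def mult_ac)
  qed
  show ?thesis
  proof (rule that[of c0 \<theta> B C])
    show "1 < c0" by (simp add: c0_def)
    show "\<forall>s. \<theta> s \<noteq> 0 \<longrightarrow> s \<in> (\<lambda>s. \<sigma> * s) ` {2 / c0..2 * c0}"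
    proof (intro allI impI image_eqI)
      fix s assume nz: "\<theta> s \<noteq> 0"
      have "\<sigma> * \<sigma> = 1" using \<sigma> by auto
      then show "s = \<sigma> * (\<sigma> * s)" by (simp flip: mult.assoc)
      have "\<not> (\<sigma> * s \<le> c1 / 4 \<or> P + c1 \<le> \<sigma> * s)" using nz \<theta>0(3) unfolding \<theta>_def by blast
      then have s: "c1 / 4 < \<sigma> * s" "\<sigma> * s < P + c1" by auto
      have c0: "0 < c0" "8 / c1 \<le> c0" "P + c1 \<le> c0" by (auto simp: c0_def)
      have "2 / c0 \<le> c1 / 4" using c0(1,2) c1(1) by (simp add: field_simps)
      then show "\<sigma> * s \<in> {2 / c0..2 * c0}" using s c0 by auto
    qed
    show "\<forall>g t lam. smooth_on UNIV g \<and> tsupport g \<subseteq> {1/2..2} \<and> 0 < t \<and> 0 < lam \<and> 4 * lam\<^sup>2 \<le> R \<longrightarrow>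
      (\<forall>x. x \<notin> {lam\<^sup>2 / 5..5 * lam\<^sup>2} \<longrightarrow> remainder \<phi> \<eta> m \<theta> g t lam x = 0) \<and>
      (\<forall>k x. norm (remainder \<phi> \<eta> m \<theta> g t lam x) \<le> C k * Ck_norm k g / (t * lam powr (2 * m)) ^ k)"
      using outside bound by blast
  qed (use \<theta>c B in auto)
qed

section \<open>Bounds for the amplitude\<close>

lemma Ck_norm_nonneg:
  assumes "smooth_on UNIV g" "tsupport g \<subseteq> {p..q}"
  shows "0 \<le> Ck_norm k g"
  using norm_nth_deriv_le_Ck_norm[OF assms, of 0 k 0] norm_ge_zero order_trans by blast

text \<open>On \<open>{1/4..4}\<close> the derivative \<open>1 / (2 * sqrt u)\<close> of the root is
  at most 1, so pulling back costs no constant.\<close>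

lemma sqrt_pullback_bound:
  fixes g :: "real \<Rightarrow> complex"
  assumes g: "smooth_on UNIV g" "tsupport g \<subseteq> {1/2..2}"
  shows "bounded_Ck (1/4) 4 False 1 (Ck_norm 1 g) (\<lambda>u. g (sqrt u))"
proof -
  have d: "(nth_deriv n g has_vector_derivative nth_deriv (Suc n) g x) (at x)" for n x
    using has_vector_derivative_nth_deriv[OF g(1)] by blast
  have c: "continuous_on {1/4..4} (\<lambda>u. nth_deriv n g (sqrt u))" for n
    by (rule continuous_on_compose2[OF smooth_on_continuous[OF g(1)]]) (auto intro!: continuous_intros)
  have b: "norm (nth_deriv n g x) \<le> Ck_norm 1 g" if "n \<le> 1" for n x
    using norm_nth_deriv_le_Ck_norm[OF g that] .
  have s: "1 / 2 \<le> sqrt u" if "u \<in> {1/4..4}" for u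
    using that by (intro real_le_rsqrt) (auto simp: power2_eq_square)
  define w where "w u = inverse (2 * sqrt u)" for u
  have "bounded_Ck (1/4) 4 False 0 (Ck_norm 1 g) (nth_deriv 0 g \<circ> sqrt)"
    using c[of 0] b[of 0] by (simp add: o_def)
  moreover have "bounded_Ck (1/4) 4 False 0 (Ck_norm 1 g) (\<lambda>u. w u *\<^sub>R nth_deriv 1 g (sqrt u))"
  proof -
    have "\<bar>w u\<bar> * norm (nth_deriv 1 g (sqrt u)) \<le> 1 * Ck_norm 1 g" if "u \<in> {1/4..4}" for u
    proof (intro mult_mono b)
      have "1 \<le> 2 * sqrt u" using s[OF that] by simp
      then have "w u \<le> inverse 1" unfolding w_def by (rule le_imp_inverse_le) simp
      moreover have "0 \<le> w u" using that by (simp add: w_def)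
      ultimately show "\<bar>w u\<bar> \<le> 1" by simp
    qed auto
    moreover have "continuous_on {1/4..4} w"
      unfolding w_def using s by (intro continuous_intros) force
    ultimately show ?thesis using c[of 1] by (auto intro!: continuous_intros)
  qed
  moreover have "((nth_deriv 0 g \<circ> sqrt) has_vector_derivative w u *\<^sub>R nth_deriv 1 g (sqrt u)) (at u within {1/4..4})"
    if "u \<in> {1/4..4}" for u
  proof -
    have "(sqrt has_real_derivative inverse (sqrt u) / 2) (at u)"
      using that by (intro DERIV_real_sqrt) simp
    moreover have "inverse (sqrt u) / 2 = w u" by (simp add: w_def)
    ultimately have "(sqrt has_vector_derivative w u) (at u)"
      by (simp only: has_real_derivative_iff_has_vector_derivative)
    from has_vector_derivative_at_within[OF vector_diff_chain_at[OF this d[of 0]]] show ?thesis by simp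
  qed
  ultimately have "bounded_Ck (1/4) 4 False (Suc 0) (Ck_norm 1 g) (nth_deriv 0 g \<circ> sqrt)"
    by (rule bounded_Ck_SucI)
  then show ?thesis by (simp add: nth_deriv_def o_def)
qed

lemma norm_over_2pi_le:
  fixes r B :: real
  assumes "\<bar>r\<bar> \<le> B"
  shows "norm (of_real (r / (2 * pi)) :: complex) \<le> B"
proof -
  have "\<bar>r\<bar> * 1 \<le> B * (2 * pi)" using assms pi_gt3 by (intro mult_mono) auto
  then show ?thesis unfolding norm_of_real by (simp add: abs_divide divide_le_eq)
qed

lemma norm_amplitude_le:
  fixes g :: "real \<Rightarrow> complex"
  assumes \<phi>: "continuous_on {0<..} \<phi>" and lam: "0 < lam"
    and g: "smooth_on UNIV g" "tsupport g \<subseteq> {1/2..2}" and \<theta>: "\<bar>\<theta> s\<bar> \<le> B"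
  shows "norm (amplitude \<phi> m \<theta> g t lam s) \<le> B * 4 * Ck_norm 1 g"
proof -
  have gb: "bounded_Ck (1/4) 4 False 0 (Ck_norm 1 g) (\<lambda>u. g (sqrt u))"
    using bounded_Ck_0[OF sqrt_pullback_bound[OF g]] .
  have "norm (integral {1/4..4} (\<lambda>u. g (sqrt u) * cis (t * \<phi> (lam\<^sup>2 * u) - t * lam powr (2 * m) * s * u)))
      \<le> Ck_norm 1 g * (4 - 1/4)"
    using gb by (intro norm_integral_le_const continuous_intros continuous_on_rescaled[OF \<phi> lam])
      (auto simp: norm_mult)
  also have "\<dots> \<le> 4 * Ck_norm 1 g" using Ck_norm_nonneg[OF g, of 1] by simp
  finally have I: "norm (integral {1/4..4} (\<lambda>u. g (sqrt u) * cis (t * \<phi> (lam\<^sup>2 * u) - t * lam powr (2 * m) * s * u)))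
      \<le> 4 * Ck_norm 1 g" .
  have "norm (of_real (\<theta> s / (2 * pi)) :: complex) \<le> B" by (rule norm_over_2pi_le[OF \<theta>])
  then have "norm (amplitude \<phi> m \<theta> g t lam s) \<le> B * (4 * Ck_norm 1 g)"
    unfolding amplitude_def norm_mult using \<theta> by (intro mult_mono I) auto
  then show ?thesis by simp
qed

text \<open>The frequency \<open>s\<close> enters the exponent through a term linear in
  \<open>u\<close>, so the second derivative test gives a bound uniform in \<open>s\<close>. It
  decays like \<open>1 / (t powr (1/2) * lam powr \<alpha>)\<close>, which fixes the weight on the
  left.\<close>

lemma norm_amplitude_le_stationary:
  fixes g :: "real \<Rightarrow> complex"
  assumes \<phi>: "smooth_on {0<..} \<phi>" and lam: "0 < lam" and t: "0 < t"
    and g: "smooth_on UNIV g" "tsupport g \<subseteq> {1/2..2}" and \<theta>: "\<bar>\<theta> s\<bar> \<le> B"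
    and c: "0 < c" "\<And>u. u \<in> {1/4..4} \<Longrightarrow> c \<le> (lam\<^sup>2) powr (2 - \<alpha>) * \<bar>nth_deriv 2 \<phi> (lam\<^sup>2 * u)\<bar>"
  shows "t powr (1/2) * lam powr \<alpha> * norm (amplitude \<phi> m \<theta> g t lam s) \<le> B * 16 / sqrt c * Ck_norm 1 g"
proof -
  let ?\<Phi> = "\<lambda>u. t * \<phi> (lam\<^sup>2 * u) - t * lam powr (2 * m) * s * u"
  let ?I = "integral {1/4..4} (\<lambda>u. g (sqrt u) * cis (?\<Phi> u))"
  define D where "D n u = t * (lam\<^sup>2) ^ n * nth_deriv n \<phi> (lam\<^sup>2 * u)" for n u
  \<comment> \<open>Two \<open>u\<close>-derivatives of the phase give
    \<open>t * (lam\<^sup>2)\<^sup>2\<close> times the second derivative of \<open>\<phi>\<close>,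
    which is at least \<open>c * (lam\<^sup>2) powr (\<alpha> - 2)\<close> in modulus.\<close>
  define \<mu> where "\<mu> = t * c * (lam\<^sup>2) powr \<alpha>"
  have lam2: "0 < lam\<^sup>2" using lam by simp
  have \<mu>: "0 < \<mu>" using t c(1) lam2 by (simp add: \<mu>_def)
  have D: "(D n has_real_derivative D (Suc n) u) (at u within {1/4..4})" if "u \<in> {1/4..4}" for n u
  proof -
    have "0 < u" using that by simp
    from DERIV_cmult[OF nth_deriv_dilation[OF \<phi> lam2 this], of "t * (lam\<^sup>2) ^ n"]
    show ?thesis unfolding D_def[abs_def] by (simp add: mult_ac)
  qed
  have "norm ?I \<le> (8 + 2 * (4 - 1/4)) * Ck_norm 1 g / sqrt \<mu>"
  proof (rule van_der_corput_second[OF _ _ _ _ \<mu> _ sqrt_pullback_bound[OF g]])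
    show "(?\<Phi> has_real_derivative D 1 u - t * lam powr (2 * m) * s) (at u within {1/4..4})" if "u \<in> {1/4..4}" for u
    proof -
      have "D 0 = (\<lambda>u. t * \<phi> (lam\<^sup>2 * u))" by (simp add: D_def[abs_def] nth_deriv_def)
      then show ?thesis
        using DERIV_diff[OF D[OF that, of 0] DERIV_cmult_Id[of "t * lam powr (2 * m) * s"]] by simp
    qed
    show "((\<lambda>u. D 1 u - t * lam powr (2 * m) * s) has_real_derivative D 2 u) (at u within {1/4..4})" if "u \<in> {1/4..4}" for u
      using D[OF that, of 1] by (auto intro!: derivative_eq_intros simp: numeral_2_eq_2)
    show "continuous_on {1/4..4} (D 2)"
      by (rule DERIV_continuous_on[OF D])
    show "\<mu> \<le> \<bar>D 2 u\<bar>" if u: "u \<in> {1/4..4}" for u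
    proof -
      have "(lam\<^sup>2) powr \<alpha> * (lam\<^sup>2) powr (2 - \<alpha>) = (lam\<^sup>2) powr 2"
        by (simp flip: powr_add)
      then have p: "(lam\<^sup>2) powr \<alpha> * (lam\<^sup>2) powr (2 - \<alpha>) = (lam\<^sup>2)\<^sup>2" using lam2 by simp
      have "\<mu> \<le> t * (lam\<^sup>2) powr \<alpha> * ((lam\<^sup>2) powr (2 - \<alpha>) * \<bar>nth_deriv 2 \<phi> (lam\<^sup>2 * u)\<bar>)"
        using c(2)[OF u] t by (simp add: \<mu>_def mult.commute[of c] mult.assoc mult_left_mono)
      also have "\<dots> = t * (lam\<^sup>2)\<^sup>2 * \<bar>nth_deriv 2 \<phi> (lam\<^sup>2 * u)\<bar>"
        unfolding p[symmetric] by (simp only: mult_ac)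
      also have "\<dots> = \<bar>D 2 u\<bar>"
        using t by (simp add: D_def abs_mult)
      finally show ?thesis .
    qed
  qed auto
  \<comment> \<open>The interval has length 15/4, so the constant is 8 + 15/2.\<close>
  also have "\<dots> \<le> 16 * Ck_norm 1 g / sqrt \<mu>"
    using Ck_norm_nonneg[OF g, of 1] \<mu> by (intro divide_right_mono mult_right_mono) auto
  finally have "norm ?I \<le> 16 * Ck_norm 1 g / sqrt \<mu>" .
  moreover have "sqrt \<mu> = t powr (1/2) * lam powr \<alpha> * sqrt c"
  proof -
    have "sqrt ((lam\<^sup>2) powr \<alpha>) = lam powr \<alpha>"
    proof (rule real_sqrt_unique)
      have "(lam powr \<alpha>)\<^sup>2 = lam powr (2 * \<alpha>)" by (simp add: power2_eq_square flip: powr_add)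
      also have "\<dots> = (lam\<^sup>2) powr \<alpha>" using lam powr_powr[of lam 2 \<alpha>] by simp
      finally show "(lam powr \<alpha>)\<^sup>2 = (lam\<^sup>2) powr \<alpha>" .
    qed simp
    then show ?thesis using t by (simp add: \<mu>_def real_sqrt_mult powr_half_sqrt)
  qed
  moreover have "0 < t powr (1/2) * lam powr \<alpha>" using t lam by simp
  ultimately have I: "t powr (1/2) * lam powr \<alpha> * norm ?I \<le> 16 / sqrt c * Ck_norm 1 g"
    using c(1) by (simp add: field_simps)
  have "norm (of_real (\<theta> s / (2 * pi)) :: complex) \<le> B" by (rule norm_over_2pi_le[OF \<theta>])
  then have "norm (of_real (\<theta> s / (2 * pi)) :: complex) * (t powr (1/2) * lam powr \<alpha> * norm ?I) \<le>
      B * (16 / sqrt c * Ck_norm 1 g)"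
    using \<theta> by (intro mult_mono I) auto
  then show ?thesis unfolding amplitude_def norm_mult by (simp add: mult_ac)
qed

section \<open>Assembly of the two decompositions\<close>

theorem theorem3p2:
  fixes \<phi> :: "real \<Rightarrow> real" and \<eta> :: "real \<Rightarrow> complex" and m2 \<Lambda> :: real
  assumes phi_smooth: "smooth_on {0<..} \<phi>"
    and m2: "m2 > 0"
    and phi1: "sim_on {0<..<1} (\<lambda>r. \<bar>nth_deriv 1 \<phi> r\<bar>) (\<lambda>r. r powr (m2 - 1))"
    and phi_higher: "\<And>\<alpha>::nat. \<alpha> \<ge> 2 \<Longrightarrow>
          lesssim_on {0<..<1} (\<lambda>r. \<bar>nth_deriv \<alpha> \<phi> r\<bar>) (\<lambda>r. r powr (m2 - real \<alpha>))"
    and eta_smooth: "smooth_on UNIV \<eta>"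
    and eta_supp: "tsupport \<eta> \<subseteq> {1/5..5}"
    and eta_one: "\<And>x. x \<in> {1/4..4} \<Longrightarrow> \<eta> x = 1"
    and Lambda: "0 < \<Lambda>" "\<Lambda> \<le> 1"
    and phi1_nz: "\<And>r. r \<in> {1..4 * \<Lambda>\<^sup>2} \<Longrightarrow> nth_deriv 1 \<phi> r \<noteq> 0"
  shows "(\<exists>C D. \<forall>g :: real \<Rightarrow> complex. smooth_on UNIV g \<and> tsupport g \<subseteq> {1/2..2} \<longrightarrow>
           (\<exists>c0>1. \<exists>\<rho> a. admissible_pair (sgn (nth_deriv 1 \<phi> (1/2))) m2 \<Lambda> C D g c0 \<rho> a \<and>
             (\<forall>x>0. \<forall>t>0. \<forall>lam. 0 < lam \<and> lam < \<Lambda> \<longrightarrow>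
               g (sqrt x / lam) * exp (\<i> * of_real (t * \<phi> x)) =
                 \<rho> t x lam + of_real (t * lam powr (2 * m2)) * \<eta> (x / lam\<^sup>2) *
                   (LBINT s. exp (\<i> * of_real (x * t * lam powr (2 * m2 - 2) * s)) * a t s lam)))) \<and>
         (\<forall>\<alpha>2>0.
           sim_on {0<..<1} (\<lambda>r. \<bar>nth_deriv 2 \<phi> r\<bar>) (\<lambda>r. r powr (\<alpha>2 - 2)) \<and>
           (\<forall>r\<in>{1..4 * \<Lambda>\<^sup>2}. nth_deriv 2 \<phi> r \<noteq> 0) \<longrightarrow>
           (\<exists>C D. \<forall>g :: real \<Rightarrow> complex. smooth_on UNIV g \<and> tsupport g \<subseteq> {1/2..2} \<longrightarrow>
             (\<exists>c0>1. \<exists>\<rho> a. admissible_pair (sgn (nth_deriv 1 \<phi> (1/2))) m2 \<Lambda> C D g c0 \<rho> a \<and>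
               (\<forall>x>0. \<forall>t>0. \<forall>lam. 0 < lam \<and> lam < \<Lambda> \<longrightarrow>
                 g (sqrt x / lam) * exp (\<i> * of_real (t * \<phi> x)) =
                   \<rho> t x lam + of_real (t powr (1/2) * lam powr (2 * m2 - \<alpha>2)) * \<eta> (x / lam\<^sup>2) *
                     (LBINT s. exp (\<i> * of_real (x * t * lam powr (2 * m2 - 2) * s)) * a t s lam)))))"
proof -
  \<comment> \<open>The values of \<open>x\<close> with \<open>g (sqrt x / lam)\<close> nonzero are
    below \<open>4 * \<Lambda>\<^sup>2\<close>. If this exceeds 1, nonvanishing of the derivative on
    \<open>{1..R}\<close> and compactness extend the comparisons from the unit interval.\<close>
  define R where "R = 4 * \<Lambda>\<^sup>2"
  define \<sigma> where "\<sigma> = sgn (nth_deriv 1 \<phi> (1/2))"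
  have R: "0 < R" "R \<le> 4" using Lambda by (auto simp: R_def power_le_one)
  have \<phi>c: "continuous_on {0<..} (nth_deriv n \<phi>)" for n
    using smooth_on_continuous[OF phi_smooth] .
  have \<phi>c0: "continuous_on {0<..} \<phi>" using \<phi>c[of 0] by (simp add: nth_deriv_def)
  have pc: "continuous_on {0<..} (\<lambda>r::real. r powr x)" for x by (intro continuous_intros) auto
  have upper: "lesssim_on {0<..R} (\<lambda>r. \<bar>nth_deriv n \<phi> r\<bar>) (\<lambda>r. r powr (m2 - real n))" if "1 \<le> n" for n
  proof (rule lesssim_on_extend[OF _ _ pc])
    show "lesssim_on {0<..<1} (\<lambda>r. \<bar>nth_deriv n \<phi> r\<bar>) (\<lambda>r. r powr (m2 - real n))"
      using that phi1 phi_higher[of n] by (cases "n = 1") (auto simp: sim_on_def)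
  qed (auto intro!: continuous_intros \<phi>c)
  have lower: "lesssim_on {0<..R} (\<lambda>r. r powr (m2 - 1)) (\<lambda>r. \<bar>nth_deriv 1 \<phi> r\<bar>)"
  proof (rule lesssim_on_extend[OF _ pc])
    show "lesssim_on {0<..<1} (\<lambda>r. r powr (m2 - 1)) (\<lambda>r. \<bar>nth_deriv 1 \<phi> r\<bar>)"
      using phi1 by (simp add: sim_on_def)
    show "0 < \<bar>nth_deriv 1 \<phi> r\<bar>" if "1 \<le> r" "r \<le> R" for r
      using phi1_nz[of r] that by (auto simp: R_def)
  qed (auto intro!: continuous_intros \<phi>c)
  have nz: "nth_deriv 1 \<phi> r \<noteq> 0" if "0 < r" "r < 1 \<or> r \<le> R" for r
  proof (cases "r < 1")
    case True
    obtain C where "0 < C" "\<And>r. r \<in> {0<..<1} \<Longrightarrow> r powr (m2 - 1) \<le> C * \<bar>nth_deriv 1 \<phi> r\<bar>"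
      using phi1 unfolding sim_on_def lesssim_on_def by blast
    from this(2)[of r] that True show ?thesis by (auto simp: not_le)
  next
    case False
    then show ?thesis using phi1_nz[of r] that by (simp add: R_def)
  qed
  have \<sigma>1: "\<bar>\<sigma>\<bar> = 1" using nz[of "1/2"] by (simp add: \<sigma>_def abs_sgn_eq)
  have sign: "0 \<le> \<sigma> * nth_deriv 1 \<phi> r" if r: "r \<in> {0<..R}" for r
  proof (rule ccontr)
    assume neg: "\<not> 0 \<le> \<sigma> * nth_deriv 1 \<phi> r"
    \<comment> \<open>The interval joining \<open>r\<close> to the reference point 1/2. Each of its
      points is below 1 or at most \<open>R\<close>, so the first derivative has no zero on it, and
      a change of sign contradicts connectedness.\<close>
    define S where "S = {min r (1/2)..max r (1/2)}"
    have S: "x \<in> S \<Longrightarrow> 0 < x \<and> (x < 1 \<or> x \<le> R)" for x using r by (auto simp: S_def min_def max_def split: if_splits)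
    have "continuous_on S (\<lambda>r. \<sigma> * nth_deriv 1 \<phi> r)"
      using S by (intro continuous_intros continuous_on_subset[OF \<phi>c]) auto
    then have "connected ((\<lambda>r. \<sigma> * nth_deriv 1 \<phi> r) ` S)"
      by (intro connected_continuous_image) (auto simp: S_def)
    moreover have "\<sigma> * nth_deriv 1 \<phi> (1/2) \<ge> 0" by (auto simp: \<sigma>_def sgn_if)
    moreover have "r \<in> S" "1/2 \<in> S" by (auto simp: S_def)
    ultimately have "0 \<in> (\<lambda>r. \<sigma> * nth_deriv 1 \<phi> r) ` S"
      using neg by (meson connectedD_interval image_eqI less_imp_le not_le)
    then obtain x where "x \<in> S" "\<sigma> * nth_deriv 1 \<phi> x = 0" by auto
    then show False using nz[of x] S[of x] \<sigma>1 by auto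
  qed
  obtain \<theta> c0 B C where c0: "1 < c0" and \<theta>: "continuous_on UNIV \<theta>" "\<forall>s. \<bar>\<theta> s\<bar> \<le> B"
    "\<forall>s. \<theta> s \<noteq> 0 \<longrightarrow> s \<in> (\<lambda>s. \<sigma> * s) ` {2 / c0..2 * c0}"
    and rem: "\<forall>g t lam. smooth_on UNIV g \<and> tsupport g \<subseteq> {1/2..2} \<and> 0 < t \<and> 0 < lam \<and> 4 * lam\<^sup>2 \<le> R \<longrightarrow>
      (\<forall>x. x \<notin> {lam\<^sup>2 / 5..5 * lam\<^sup>2} \<longrightarrow> remainder \<phi> \<eta> m2 \<theta> g t lam x = 0) \<and>
      (\<forall>k x. norm (remainder \<phi> \<eta> m2 \<theta> g t lam x) \<le> C k * Ck_norm k g / (t * lam powr (2 * m2)) ^ k)"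
    by (rule remainder_bounds[OF phi_smooth upper lower \<sigma>1 sign eta_smooth eta_supp eta_one])
      (assumption | (rule that; assumption))+
  have lamR: "4 * lam\<^sup>2 \<le> R" if "0 < lam" "lam < \<Lambda>" for lam
    using that by (auto simp: R_def intro!: power_mono)
  \<comment> \<open>The weight \<open>w\<close> is 1 in the first decomposition and
    \<open>t powr (1/2) * lam powr \<alpha>2\<close> in the second. It rescales the amplitude at
    fixed \<open>t\<close> and \<open>lam\<close>, leaving the frequency support within the same
    interval and the remainder unchanged.\<close>
  have admissible: "admissible_pair \<sigma> m2 \<Lambda> (\<lambda>k N. C k * N) D g c0 (\<lambda>t x lam. remainder \<phi> \<eta> m2 \<theta> g t lam x)
      (\<lambda>t s lam. of_real (w t lam) * amplitude \<phi> m2 \<theta> g t lam s)"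
    if g: "smooth_on UNIV g" "tsupport g \<subseteq> {1/2..2}"
      and D: "\<And>t lam s. 0 < t \<Longrightarrow> 0 < lam \<Longrightarrow> lam < \<Lambda> \<Longrightarrow>
        norm (of_real (w t lam) * amplitude \<phi> m2 \<theta> g t lam s) \<le> D (Ck_norm 1 g)"
    for D :: "real \<Rightarrow> real" and g :: "real \<Rightarrow> complex" and w :: "real \<Rightarrow> real \<Rightarrow> real"
    unfolding admissible_pair_def
  proof (intro allI impI conjI; (elim conjE)?)
    fix t lam :: real assume t: "0 < t" and lam: "0 < lam" "lam < \<Lambda>"
    have gc: "continuous_on UNIV g" using smooth_on_continuous[OF g(1), of 0] by (simp add: nth_deriv_def)
    show "tsupport (\<lambda>x. remainder \<phi> \<eta> m2 \<theta> g t lam x) \<subseteq> {lam\<^sup>2 / 5..5 * lam\<^sup>2}"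
      unfolding tsupport_def using rem g t lam(1) lamR[OF lam] by (intro closure_minimal) blast+
    show "norm (remainder \<phi> \<eta> m2 \<theta> g t lam x) \<le> C k * Ck_norm k g / (t * lam powr (2 * m2)) ^ k" for k x
      using rem g t lam(1) lamR[OF lam] by blast
    show "(\<lambda>s. of_real (w t lam) * amplitude \<phi> m2 \<theta> g t lam s) \<in> borel_measurable borel"
      by (intro borel_measurable_continuous_onI continuous_intros amplitude_continuous[OF \<phi>c0 gc \<theta>(1) lam(1)])
    show "tsupport (\<lambda>s. of_real (w t lam) * amplitude \<phi> m2 \<theta> g t lam s) \<subseteq> (\<lambda>s. \<sigma> * s) ` {2 / c0..2 * c0}"
      unfolding tsupport_def
    proof (rule closure_minimal)
      show "{s. of_real (w t lam) * amplitude \<phi> m2 \<theta> g t lam s \<noteq> 0} \<subseteq> (\<lambda>s. \<sigma> * s) ` {2 / c0..2 * c0}"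
        using \<theta>(3) by (auto simp: amplitude_def)
      show "closed ((\<lambda>s. \<sigma> * s) ` {2 / c0..2 * c0})"
        by (intro compact_imp_closed compact_continuous_image continuous_intros) auto
    qed
    show "norm (of_real (w t lam) * amplitude \<phi> m2 \<theta> g t lam s) \<le> D (Ck_norm 1 g)" for s
      using D[OF t lam] .
  qed
  show ?thesis
    unfolding \<sigma>_def[symmetric]
  proof (intro conjI allI impI; (elim conjE)?)
    show "\<exists>C D. \<forall>g :: real \<Rightarrow> complex. smooth_on UNIV g \<and> tsupport g \<subseteq> {1/2..2} \<longrightarrow>
           (\<exists>c0>1. \<exists>\<rho> a. admissible_pair \<sigma> m2 \<Lambda> C D g c0 \<rho> a \<and>
             (\<forall>x>0. \<forall>t>0. \<forall>lam. 0 < lam \<and> lam < \<Lambda> \<longrightarrow>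
               g (sqrt x / lam) * exp (\<i> * of_real (t * \<phi> x)) =
                 \<rho> t x lam + of_real (t * lam powr (2 * m2)) * \<eta> (x / lam\<^sup>2) *
                   (LBINT s. exp (\<i> * of_real (x * t * lam powr (2 * m2 - 2) * s)) * a t s lam)))"
    proof (intro exI[of _ "\<lambda>k N. C k * N"] exI[of _ "\<lambda>N. B * 4 * N"] allI impI exI[of _ c0] conjI c0; elim conjE)
      fix g :: "real \<Rightarrow> complex" assume g: "smooth_on UNIV g" "tsupport g \<subseteq> {1/2..2}"
      show "\<exists>\<rho> a. admissible_pair \<sigma> m2 \<Lambda> (\<lambda>k N. C k * N) (\<lambda>N. B * 4 * N) g c0 \<rho> a \<and>
             (\<forall>x>0. \<forall>t>0. \<forall>lam. 0 < lam \<and> lam < \<Lambda> \<longrightarrow>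
               g (sqrt x / lam) * exp (\<i> * of_real (t * \<phi> x)) =
                 \<rho> t x lam + of_real (t * lam powr (2 * m2)) * \<eta> (x / lam\<^sup>2) *
                   (LBINT s. exp (\<i> * of_real (x * t * lam powr (2 * m2 - 2) * s)) * a t s lam))"
      proof (intro exI conjI)
        show "admissible_pair \<sigma> m2 \<Lambda> (\<lambda>k N. C k * N) (\<lambda>N. B * 4 * N) g c0
            (\<lambda>t x lam. remainder \<phi> \<eta> m2 \<theta> g t lam x) (\<lambda>t s lam. of_real 1 * amplitude \<phi> m2 \<theta> g t lam s)"
        proof (rule admissible[OF g])
          fix t lam s :: real assume "0 < lam"
          from norm_amplitude_le[where \<theta> = \<theta> and s = s and B = B, OF \<phi>c0 this g \<theta>(2)[rule_format]]
          show "norm (of_real 1 * amplitude \<phi> m2 \<theta> g t lam s) \<le> B * 4 * Ck_norm 1 g" by simp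
        qed
      qed (simp add: remainder_def)
    qed
  next
    fix \<alpha>2 :: real
    assume "0 < \<alpha>2" and sim2: "sim_on {0<..<1} (\<lambda>r. \<bar>nth_deriv 2 \<phi> r\<bar>) (\<lambda>r. r powr (\<alpha>2 - 2))"
      and nz2: "\<forall>r\<in>{1..4 * \<Lambda>\<^sup>2}. nth_deriv 2 \<phi> r \<noteq> 0"
    have "lesssim_on {0<..R} (\<lambda>r. r powr - (2 - \<alpha>2)) (\<lambda>r. \<bar>nth_deriv 2 \<phi> r\<bar>)"
    proof (rule lesssim_on_extend[OF _ pc])
      show "lesssim_on {0<..<1} (\<lambda>r. r powr - (2 - \<alpha>2)) (\<lambda>r. \<bar>nth_deriv 2 \<phi> r\<bar>)"
        using sim2 by (simp add: sim_on_def)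
      show "0 < \<bar>nth_deriv 2 \<phi> r\<bar>" if "1 \<le> r" "r \<le> R" for r
        using nz2 that by (auto simp: R_def)
    qed (auto intro!: continuous_intros \<phi>c)
    from rescaled_lower[OF this] obtain c where c: "0 < c" "\<And>lam u. 0 < lam \<Longrightarrow> u \<in> {1/4..4} \<Longrightarrow>
        lam\<^sup>2 * u \<le> R \<Longrightarrow> c \<le> (lam\<^sup>2) powr (2 - \<alpha>2) * \<bar>nth_deriv 2 \<phi> (lam\<^sup>2 * u)\<bar>" by blast
    define D where "D N = B * 16 / sqrt c * N" for N
    show "\<exists>C D. \<forall>g :: real \<Rightarrow> complex. smooth_on UNIV g \<and> tsupport g \<subseteq> {1/2..2} \<longrightarrow>
             (\<exists>c0>1. \<exists>\<rho> a. admissible_pair \<sigma> m2 \<Lambda> C D g c0 \<rho> a \<and>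
               (\<forall>x>0. \<forall>t>0. \<forall>lam. 0 < lam \<and> lam < \<Lambda> \<longrightarrow>
                 g (sqrt x / lam) * exp (\<i> * of_real (t * \<phi> x)) =
                   \<rho> t x lam + of_real (t powr (1/2) * lam powr (2 * m2 - \<alpha>2)) * \<eta> (x / lam\<^sup>2) *
                     (LBINT s. exp (\<i> * of_real (x * t * lam powr (2 * m2 - 2) * s)) * a t s lam)))"
    proof (intro exI[of _ "\<lambda>k N. C k * N"] exI[of _ D] allI impI exI[of _ c0] conjI c0; elim conjE)
      fix g :: "real \<Rightarrow> complex" assume g: "smooth_on UNIV g" "tsupport g \<subseteq> {1/2..2}"
      let ?w = "\<lambda>t lam :: real. t powr (1/2) * lam powr \<alpha>2"
      show "\<exists>\<rho> a. admissible_pair \<sigma> m2 \<Lambda> (\<lambda>k N. C k * N) D g c0 \<rho> a \<and>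
               (\<forall>x>0. \<forall>t>0. \<forall>lam. 0 < lam \<and> lam < \<Lambda> \<longrightarrow>
                 g (sqrt x / lam) * exp (\<i> * of_real (t * \<phi> x)) =
                   \<rho> t x lam + of_real (t powr (1/2) * lam powr (2 * m2 - \<alpha>2)) * \<eta> (x / lam\<^sup>2) *
                     (LBINT s. exp (\<i> * of_real (x * t * lam powr (2 * m2 - 2) * s)) * a t s lam))"
      proof (intro exI conjI allI impI; (elim conjE)?)
        show "admissible_pair \<sigma> m2 \<Lambda> (\<lambda>k N. C k * N) D g c0
            (\<lambda>t x lam. remainder \<phi> \<eta> m2 \<theta> g t lam x) (\<lambda>t s lam. of_real (?w t lam) * amplitude \<phi> m2 \<theta> g t lam s)"
        proof (rule admissible[OF g])
          fix t lam s :: real assume t: "0 < t" and lam: "0 < lam" "lam < \<Lambda>"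
          have "c \<le> (lam\<^sup>2) powr (2 - \<alpha>2) * \<bar>nth_deriv 2 \<phi> (lam\<^sup>2 * u)\<bar>" if "u \<in> {1/4..4}" for u
          proof -
            have "lam\<^sup>2 * u \<le> 4 * lam\<^sup>2" using mult_left_mono[of u 4 "lam\<^sup>2"] that by simp
            with lamR[OF lam] show ?thesis by (intro c(2) lam that) linarith
          qed
          from norm_amplitude_le_stationary[where \<theta> = \<theta> and s = s and B = B,
              OF phi_smooth lam(1) t g \<theta>(2)[rule_format] c(1) this]
          show "norm (of_real (?w t lam) * amplitude \<phi> m2 \<theta> g t lam s) \<le> D (Ck_norm 1 g)"
            unfolding D_def by (simp add: norm_mult)
        qed
        fix x t lam :: real assume "0 < x" and t: "0 < t" and lam: "0 < lam" "lam < \<Lambda>"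
        \<comment> \<open>The prefactor of the second decomposition times its weight is again
          \<open>t * lam powr (2 * m2)\<close>, which identifies the remainder with the earlier
          one.\<close>
        have "t powr (1/2) * t powr (1/2) = t"
          using t by (simp flip: powr_add)
        moreover have "lam powr (2 * m2 - \<alpha>2) * lam powr \<alpha>2 = lam powr (2 * m2)" by (simp flip: powr_add)
        ultimately have w: "t powr (1/2) * lam powr (2 * m2 - \<alpha>2) * ?w t lam = t * lam powr (2 * m2)"
          by (metis mult.assoc mult.left_commute)
        have "(LBINT s. exp (\<i> * of_real (x * t * lam powr (2 * m2 - 2) * s)) * (of_real (?w t lam) * amplitude \<phi> m2 \<theta> g t lam s)) =
          (LBINT s. of_real (?w t lam) * (exp (\<i> * of_real (x * t * lam powr (2 * m2 - 2) * s)) * amplitude \<phi> m2 \<theta> g t lam s))"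
          by (simp only: mult.left_commute)
        also have "\<dots> = of_real (?w t lam) * (LBINT s. exp (\<i> * of_real (x * t * lam powr (2 * m2 - 2) * s)) * amplitude \<phi> m2 \<theta> g t lam s)"
          by (rule Bochner_Integration.integral_mult_right_zero)
        finally show "g (sqrt x / lam) * exp (\<i> * of_real (t * \<phi> x)) =
            remainder \<phi> \<eta> m2 \<theta> g t lam x + of_real (t powr (1/2) * lam powr (2 * m2 - \<alpha>2)) * \<eta> (x / lam\<^sup>2) *
              (LBINT s. exp (\<i> * of_real (x * t * lam powr (2 * m2 - 2) * s)) * (of_real (?w t lam) * amplitude \<phi> m2 \<theta> g t lam s))"
          unfolding remainder_def w[symmetric] of_real_mult by (simp add: mult_ac)
      qed
    qed
  qed
qed

end
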